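(* Let $F_1,\ldots,F_l$ be vector fields on $\mathbb{R}^n$ that are smooth and bounded together with their derivatives of each order, let $\mathcal{U}=L^2([0,1],\mathbb{R}^l)$, and for $u\in\mathcal{U}$ let $\Phi_u$ be the time-one flow of $\dot x=\sum_{i=1}^l F_i(x)u_i$. Let $\Psi:\mathbb{R}^n\to\mathbb{R}^n$ be a diffeomorphism diffeotopic to the identity, let $a:\mathbb{R}^n\to\mathbb{R}$ be smooth with $a\ge0$ and $a(0)=0$, and let $\Psi$ and $a$ be Lipschitz continuous with constants $L_\Psi$ and $L_a$ respectively. Let $\beta>0$, let $K\subset\mathbb{R}^n$ be compact and, for every $M\ge1$, let $x^{1,M},\ldots,x^{M,M}$ be pairwise distinct points of $K$, with $\mu_M:=\frac1M\sum_{j=1}^M\delta_{x^{j,M}}$. Assume that there exists a Borel probability measure $\mu$ supported in $K$ such that $\mu_M\to\mu$ weakly, i.e. $\int f\,d\mu_M\to\int f\,d\mu$ for every bounded continuous $f:\mathbb{R}^n\to\mathbb{R}$. For $u\in\mathcal{U}$ set $$\mathcal{F}^M(u):=\int_{\mathbb{R}^n}a(\Phi_u-\Psi)\,d\mu_M+\frac\beta2\|u\|_{L^2}^2,\qquad \mathcal{F}(u):=\int_{\mathbb{R}^n}a(\Phi_u-\Psi)\,d\mu+\frac\beta2\|u\|_{L^2}^2,$$ $$\kappa_\beta:=\sup\Big\{\int_K a(\Phi_{\tilde u}(x)-\Psi(x))\,d\mu(x)\ :\ \tilde u\in\arg\min_{\mathcal{U}}\mathcal{F}\Big\}.$$ Then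 there exists a constant $L_\beta$, independent of $M$, such that for every sequence $(\tilde u^M)_{M\ge1}$ with $\tilde u^M$ a minimizer of $\mathcal{F}^M$ over $\mathcal{U}$, the flow $\Phi_{\tilde u^M}$ is Lipschitz continuous with constant $L_\beta$ for every $M\geq 1$, and for all $M$ large enough $$\mathbb{E}_\mu\big[a(\Phi_{\tilde u^M}(\cdot)-\Psi(\cdot))\big]=\int_K a(\Phi_{\tilde u^M}(y)-\Psi(y))\,d\mu(y)\le 2\kappa_\beta+L_a(L_\Psi+L_\beta)\,W_1(\mu_M,\mu).$$
   Context: For $u\in\mathcal{U}$ and $x_0\in\mathbb{R}^n$, let $x_{u,x_0}:[0,1]\to\mathbb{R}^n$ be the unique (Carath\'eodory) solution of $\dot x(s)=\sum_{i=1}^l F_i(x(s))u_i(s)$, $x(0)=x_0$; the flow is $\Phi_u(x_0):=x_{u,x_0}(1)$. A diffeomorphism $\Psi$ is diffeotopic to the identity if there is a family of diffeomorphisms $(\Psi_s)_{s\in[0,1]}$ of $\mathbb{R}^n$ depending smoothly on $s$ with $\Psi_0=\mathrm{Id}$, $\Psi_1=\Psi$. For Borel probability measures $\nu_1,\nu_2$ on $K$, $W_1(\nu_1,\nu_2):=\inf_\pi\int_{K\times K}|x-y|_2\,d\pi(x,y)$, the infimum over Borel probability measures $\pi$ on $K\times K$ with marginals $\nu_1$ and $\nu_2$. Lipschitz constants are with respect to the Euclidean norm $|\cdot|_2$. *)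

theory Defs
  imports "HOL-Probability.Probability"
begin

section \<open>Smooth maps and diffeotopies\<close>

primrec iterated_derivative ::
    "'a list \<Rightarrow> ('a::real_normed_vector \<Rightarrow> 'b::real_normed_vector) \<Rightarrow> 'a \<Rightarrow> 'b" where
  "iterated_derivative [] f = f"
| "iterated_derivative (v # vs) f =
     iterated_derivative vs (\<lambda>x. frechet_derivative f (at x) v)"

text \<open>Being of class \<open>C\<^sup>\<infinity>\<close>: every iterated directional derivative exists and is itself
  Frechet differentiable (hence continuous). In finite dimension this is the usual notion.\<close>

definition smooth_on_open :: "'a::euclidean_space set \<Rightarrow> ('a \<Rightarrow> 'b::euclidean_space) \<Rightarrow> bool" where
  "smooth_on_open S f \<longleftrightarrow>
     open S \<and> (\<forall>vs. \<forall>x\<in>S. iterated_derivative vs f differentiable at x)"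

abbreviation smooth :: "('a::euclidean_space \<Rightarrow> 'b::euclidean_space) \<Rightarrow> bool" where
  "smooth f \<equiv> smooth_on_open UNIV f"

text \<open>Boundedness along each fixed tuple of directions amounts, in finite dimension, to
  boundedness of the norm of the derivative tensor of each order; the empty list bounds \<open>f\<close>.\<close>

definition bounded_with_derivatives :: "('a::euclidean_space \<Rightarrow> 'b::euclidean_space) \<Rightarrow> bool" where
  "bounded_with_derivatives f \<longleftrightarrow> (\<forall>vs. bounded (range (iterated_derivative vs f)))"

definition diffeomorphism :: "('a::euclidean_space \<Rightarrow> 'a) \<Rightarrow> bool" where
  "diffeomorphism \<Psi> \<longleftrightarrow> bij \<Psi> \<and> smooth \<Psi> \<and> smooth (inv \<Psi>)"

text \<open>Smooth dependence on the parameter means joint smoothness on \<open>[0,1] \<times> \<real>\<^sup>n\<close>; as this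
  set is not open, smoothness means having a smooth extension to an open neighbourhood.\<close>

definition diffeotopic_to_id :: "('a::euclidean_space \<Rightarrow> 'a) \<Rightarrow> bool" where
  "diffeotopic_to_id \<Psi> \<longleftrightarrow>
     (\<exists>\<Psi>s :: real \<Rightarrow> 'a \<Rightarrow> 'a.
        (\<forall>s\<in>{0..1}. diffeomorphism (\<Psi>s s)) \<and> \<Psi>s 0 = id \<and> \<Psi>s 1 = \<Psi> \<and>
        (\<exists>W G. {0..1} \<times> UNIV \<subseteq> W \<and> smooth_on_open W G \<and>
           (\<forall>s\<in>{0..1}. \<forall>x. G (s, x) = \<Psi>s s x)))"


section \<open>Controls and flows\<close>

text \<open>Controls are represented by square-integrable functions rather than by their classes
  modulo null sets; the flow and the norm depend only on the class. Values outside
  \<open>[0,1]\<close> are irrelevant.\<close>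

definition L2_controls :: "(real \<Rightarrow> real^'l) set" where
  "L2_controls = {u. u \<in> borel_measurable (lebesgue_on {0..1}) \<and>
                     integrable (lebesgue_on {0..1}) (\<lambda>s. (norm (u s))\<^sup>2)}"

definition L2_norm :: "(real \<Rightarrow> real^'l) \<Rightarrow> real" where
  "L2_norm u = sqrt (LINT s|lebesgue_on {0..1}. (norm (u s))\<^sup>2)"

text \<open>Absolute continuity of functions, to be distinguished from the library's
  \<^const>\<open>absolutely_continuous\<close>, which concerns measures. A division of a set
  is a finite family of compact intervals with pairwise disjoint interiors.\<close>

definition absolutely_continuous_on :: "real set \<Rightarrow> (real \<Rightarrow> 'b::real_normed_vector) \<Rightarrow> bool" where
  "absolutely_continuous_on S f \<longleftrightarrow>
     (\<forall>\<epsilon>>0. \<exists>\<delta>>0. \<forall>D T. D division_of T \<and> T \<subseteq> S \<and> (\<Sum>k\<in>D. Sup k - Inf k) < \<delta> \<longrightarrow>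
        (\<Sum>k\<in>D. norm (f (Sup k) - f (Inf k))) < \<epsilon>)"

definition caratheodory_solution ::
    "('l::finite \<Rightarrow> real^'n \<Rightarrow> real^'n) \<Rightarrow> (real \<Rightarrow> real^'l) \<Rightarrow> real^'n \<Rightarrow> (real \<Rightarrow> real^'n) \<Rightarrow> bool" where
  "caratheodory_solution F u x0 x \<longleftrightarrow>
     absolutely_continuous_on {0..1} x \<and> x 0 = x0 \<and>
     (AE s in lebesgue_on {0..1}.
        (x has_vector_derivative (\<Sum>i\<in>UNIV. (u s $ i) *\<^sub>R F i (x s))) (at s within {0..1}))"

definition flow ::
    "('l::finite \<Rightarrow> real^'n \<Rightarrow> real^'n) \<Rightarrow> (real \<Rightarrow> real^'l) \<Rightarrow> real^'n \<Rightarrow> real^'n" where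
  "flow F u x0 = (THE y. \<exists>x. caratheodory_solution F u x0 x \<and> x 1 = y)"


section \<open>Measures\<close>

text \<open>The push-forward of the uniform measure on the indices, i.e. the average of the Dirac
  measures at \<open>p 1, \<dots>, p M\<close> (for \<open>M \<ge> 1\<close>).\<close>

definition empirical_measure :: "nat \<Rightarrow> (nat \<Rightarrow> 'a::topological_space) \<Rightarrow> 'a measure" where
  "empirical_measure M p = distr (uniform_count_measure {1..M}) borel p"

lemma emeasure_empirical_measure:
  assumes "M \<ge> 1" "A \<in> sets borel"
  shows "emeasure (empirical_measure M p) A
       = ennreal (1 / real M) * (\<Sum>j=1..M. emeasure (return borel (p j)) A)"
proof -
  let ?S = "p -` A \<inter> {1..M}"
  have "emeasure (empirical_measure M p) A = emeasure (uniform_count_measure {1..M}) ?S"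
    unfolding empirical_measure_def
    by (subst emeasure_distr)
       (use assms in \<open>auto simp: space_uniform_count_measure measurable_def sets_uniform_count_measure\<close>)
  also have "\<dots> = ennreal (card ?S / real M)"
    by (subst emeasure_uniform_count_measure) auto
  also have "\<dots> = ennreal (1 / real M) * ennreal (real (card ?S))"
    by (simp add: ennreal_mult[symmetric])
  also have "real (card ?S) = (\<Sum>j=1..M. indicator A (p j))"
    by (simp add: indicator_def sum.If_cases vimage_def Int_def conj_commute)
  also have "ennreal \<dots> = (\<Sum>j=1..M. emeasure (return borel (p j)) A)"
    using assms by (subst sum_ennreal[symmetric]) (auto simp: indicator_def ennreal_of_nat_eq_real_of_nat)
  finally show ?thesis .
qed

definition weakly_converges :: "(nat \<Rightarrow> 'a::topological_space measure) \<Rightarrow> 'a measure \<Rightarrow> bool" where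
  "weakly_converges \<mu>s \<mu> \<longleftrightarrow>
     (\<forall>f :: 'a \<Rightarrow> real. continuous_on UNIV f \<and> bounded (range f) \<longrightarrow>
        (\<lambda>M. LINT x|\<mu>s M. f x) \<longlonglongrightarrow> (LINT x|\<mu>. f x))"

text \<open>Probability measures on \<open>K\<close> (or on \<open>K \<times> K\<close>) are represented by Borel probability measures
  on the ambient space giving mass one to that set.\<close>

definition borel_prob_on :: "'a::topological_space set \<Rightarrow> 'a measure \<Rightarrow> bool" where
  "borel_prob_on K \<nu> \<longleftrightarrow> prob_space \<nu> \<and> sets \<nu> = sets borel \<and> measure \<nu> K = 1"

definition couplings ::
    "'a::euclidean_space set \<Rightarrow> 'a measure \<Rightarrow> 'a measure \<Rightarrow> ('a \<times> 'a) measure set" where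
  "couplings K \<nu>1 \<nu>2 =
     {\<pi>. borel_prob_on (K \<times> K) \<pi> \<and> distr \<pi> borel fst = \<nu>1 \<and> distr \<pi> borel snd = \<nu>2}"

definition W1 :: "'a::euclidean_space set \<Rightarrow> 'a measure \<Rightarrow> 'a measure \<Rightarrow> real" where
  "W1 K \<nu>1 \<nu>2 =
     (INF \<pi>\<in>couplings K \<nu>1 \<nu>2. LINT z:(K \<times> K)|\<pi>. norm (fst z - snd z))"


section \<open>The optimal control problem\<close>

definition cost ::
    "('l::finite \<Rightarrow> real^'n \<Rightarrow> real^'n) \<Rightarrow> (real^'n \<Rightarrow> real^'n) \<Rightarrow> (real^'n \<Rightarrow> real) \<Rightarrow> real \<Rightarrow>
     (real^'n) measure \<Rightarrow> (real \<Rightarrow> real^'l) \<Rightarrow> real" where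
  "cost F \<Psi> a \<beta> \<nu> u = (LINT x|\<nu>. a (flow F u x - \<Psi> x)) + \<beta> / 2 * (L2_norm u)\<^sup>2"

definition minimizers ::
    "('l::finite \<Rightarrow> real^'n \<Rightarrow> real^'n) \<Rightarrow> (real^'n \<Rightarrow> real^'n) \<Rightarrow> (real^'n \<Rightarrow> real) \<Rightarrow> real \<Rightarrow>
     (real^'n) measure \<Rightarrow> (real \<Rightarrow> real^'l) set" where
  "minimizers F \<Psi> a \<beta> \<nu> = {u. is_arg_min (cost F \<Psi> a \<beta> \<nu>) (\<lambda>u. u \<in> L2_controls) u}"

definition \<kappa> ::
    "('l::finite \<Rightarrow> real^'n \<Rightarrow> real^'n) \<Rightarrow> (real^'n \<Rightarrow> real^'n) \<Rightarrow> (real^'n \<Rightarrow> real) \<Rightarrow> real \<Rightarrow>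
     (real^'n) set \<Rightarrow> (real^'n) measure \<Rightarrow> real" where
  "\<kappa> F \<Psi> a \<beta> K \<mu> = (SUP u\<in>minimizers F \<Psi> a \<beta> \<mu>. LINT x:K|\<mu>. a (flow F u x - \<Psi> x))"

end

theory Submission
  imports Defs "HOL-Complex_Analysis.Great_Picard"
begin

text \<open>
  Write \<open>E\<close> for a common Lipschitz constant of the flows of all controls in the ball of \<open>L\<^sup>2\<close> that
  contains the minimizers. Then \<open>y \<mapsto> a (flow F u y - \<Psi> y)\<close> has Lipschitz constant
  \<open>L\<^sub>a * (L\<^sub>\<Psi> + E)\<close> for such \<open>u\<close>, and integrating against a coupling shows that passing
  from the empirical measure to \<open>\<mu>\<close> costs at most this constant times \<open>W1\<close>
  (\<open>lipschitz_integral_le_W1\<close>). What remains is to bound the mean error of the minimizers on the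
  empirical measures by \<open>2 * \<kappa>\<close> for large \<open>M\<close>.

  This is a \<open>\<Gamma>\<close>-convergence argument (\<open>approximate_minimizers_converge\<close>). Along a subsequence the
  minimizers converge weakly to some \<open>v\<close>; the flows then converge uniformly, so the mean errors
  converge to that of \<open>v\<close>, and since the \<open>L\<^sup>2\<close> norm is lower semicontinuous \<open>v\<close> minimizes the limit
  functional. The mean error of \<open>v\<close> is thus at most \<open>\<kappa>\<close>. If \<open>\<kappa> > 0\<close>, infinitely many mean errors
  above \<open>2 * \<kappa>\<close> are therefore impossible. The same statement with a constant sequence of measures
  yields the existence of minimizers, without which the supremum \<open>\<kappa>\<close> would carry no information.

  If \<open>\<kappa> = 0\<close>, convergence of the mean errors to \<open>0\<close> does not make them eventually \<open>\<le> 0\<close>, and a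
  different argument is used (\<open>minimizer_with_zero_mean_error\<close>). At a zero the function \<open>a\<close> has a minimum,
  so replacing a minimizer \<open>v\<close> of zero error by \<open>(1 - \<epsilon>) v\<close> increases the error only by \<open>o(\<epsilon>)\<close>, while
  it saves energy of order \<open>\<epsilon> * (L2_norm v)\<^sup>2\<close>. Hence \<open>v\<close> vanishes, and the zero control already has zero
  error on \<open>\<mu>\<close>. Comparison with the zero control bounds the error on the empirical measure by
  \<open>L\<^sub>a * (L\<^sub>\<Psi> + 1) * W1\<close>; this is absorbed by choosing \<open>L\<^sub>\<beta> = E + L\<^sub>\<Psi> + 1\<close>, which is
  larger than the Lipschitz constant \<open>E\<close>.

  Two analytic ingredients carry this argument. First, Caratheodory solutions are the same as
  continuous solutions of the integral equation (\<open>trajectory_iff_caratheodory_solution\<close>), which rests on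
  the fundamental theorem of calculus for absolutely continuous functions and on Lebesgue
  differentiation; existence follows from Banach's fixed point theorem, stability from Gronwall's
  inequality. Second, weak convergence of controls is used only in the form of uniform convergence of
  their primitives \<open>t \<mapsto> \<integral>\<^sub>0\<^sup>t u\<close>: this suffices for uniform convergence of the flows
  (\<open>flow_weakly_continuous\<close>), and the required weak compactness (\<open>L2_weakly_compact\<close>) then follows from
  the theorem of Arzela and Ascoli and the parallelogram identity.
\<close>


section \<open>Absolutely continuous functions on an interval\<close>

text \<open>
  In a fine tagged division, the intervals with tag outside \<open>N\<close> are controlled by the derivative as in
  the usual fundamental theorem. Those with tag in \<open>N\<close> lie in an open set of small measure around
  \<open>N\<close>, so absolute continuity makes the total increment of \<open>f\<close> over them small. The integral is the
  gauge integral, hence integrability of the derivative is part of the conclusion.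
\<close>

lemma absolutely_continuous_has_integral:
  fixes f :: "real \<Rightarrow> 'a::banach"
  assumes ac: "absolutely_continuous_on {a..b} f" and "a \<le> b" and N: "negligible N"
    and der: "\<And>x. x \<in> {a..b} - N \<Longrightarrow> (f has_vector_derivative f' x) (at x within {a..b})"
  shows "(f' has_integral (f b - f a)) {a..b}"
proof (cases "a = b")
  case True then show ?thesis by (simp add: has_integral_refl)
next
  case False
  with \<open>a \<le> b\<close> have ab: "a < b" by simp
  define g where "g = (\<lambda>x. if x \<in> N then 0 else f' x)"
  have "(g has_integral (f b - f a)) {a..b}"
    unfolding has_integral_factor_content_real
  proof (intro allI impI)
    fix e :: real assume "e > 0"
    define e2 where "e2 = e / 2"
    have e2: "e2 > 0" using \<open>e > 0\<close> by (simp add: e2_def)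
    have "\<forall>x. \<exists>d>0. x \<in> {a..b} - N \<longrightarrow>
         (\<forall>y\<in>{a..b}. norm (y-x) < d \<longrightarrow> norm (f y - f x - (y-x) *\<^sub>R f' x) \<le> e2 * norm (y-x))"
      using der[unfolded has_vector_derivative_def has_derivative_within_alt] e2
      by (metis (no_types, lifting) zero_less_one)
    then obtain d where d0: "\<And>x. 0 < d x"
      and d: "\<And>x y. \<lbrakk>x \<in> {a..b} - N; y \<in> {a..b}; norm (y-x) < d x\<rbrakk>
                        \<Longrightarrow> norm (f y - f x - (y-x) *\<^sub>R f' x) \<le> e2 * norm (y-x)"
      by metis
    have "e2 * (b - a) > 0" using e2 ab by simp
    with ac obtain \<delta> where \<delta>: "\<delta> > 0"
      and ac': "\<And>D T. \<lbrakk>D division_of T; T \<subseteq> {a..b}; (\<Sum>k\<in>D. Sup k - Inf k) < \<delta>\<rbrakk> \<Longrightarrow>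
        (\<Sum>k\<in>D. norm (f (Sup k) - f (Inf k))) < e2 * (b - a)"
      unfolding absolutely_continuous_on_def by meson
    have Nn: "N \<in> null_sets lebesgue" using N negligible_iff_null_sets by blast
    then have "N \<in> sets lebesgue" by auto
    then obtain T where T: "open T" "N \<subseteq> T" "T - N \<in> lmeasurable"
        "emeasure lebesgue (T - N) < ennreal \<delta>"
      using sets_lebesgue_outer_open[OF _ \<delta>] by metis
    have Tm: "T \<in> lmeasurable"
    proof -
      have "T = (T - N) \<union> N" using T(2) by auto
      then show ?thesis
        using T(3) N by (metis fmeasurable.Un negligible_imp_measurable)
    qed
    have mT: "measure lebesgue T < \<delta>"
    proof -
      have "measure lebesgue T = measure lebesgue (T - N)"
        using measure_Diff_null_set[OF _ Nn] Tm by (metis fmeasurableD)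
      also have "\<dots> < \<delta>"
        using T(3,4) \<delta> by (simp add: emeasure_eq_measure2 ennreal_less_iff)
      finally show ?thesis .
    qed
    define \<gamma> where "\<gamma> = (\<lambda>x. if x \<in> N then T else ball x (d x))"
    show "\<exists>d. gauge d \<and> (\<forall>p. p tagged_division_of {a..b} \<and> d fine p \<longrightarrow>
      norm (sum (\<lambda>(x,k). measure lborel k *\<^sub>R g x) p - (f b - f a)) \<le> e * measure lborel {a..b})"
    proof (intro exI conjI allI impI)
      show "gauge \<gamma>"
        using T d0 by (auto simp: gauge_def \<gamma>_def)
    next
      fix p assume "p tagged_division_of {a..b} \<and> \<gamma> fine p"
      then have p: "p tagged_division_of {a..b}" and fp: "\<gamma> fine p" by auto
      have finp: "finite p" using p by blast
      define p1 where "p1 = {(x,k)\<in>p. x \<in> N}"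
      define p2 where "p2 = {(x,k)\<in>p. x \<notin> N}"
      have pp: "p = p1 \<union> p2" "p1 \<inter> p2 = {}" "finite p1" "finite p2"
        using finp by (auto simp: p1_def p2_def intro: finite_subset[of _ p])
      have Kab: "\<exists>u v. K = {u..v} \<and> u \<le> v \<and> x \<in> K \<and> K \<subseteq> {a..b}" if "(x,K) \<in> p" for x K
        using tagged_division_ofD(2,3,4)[OF p that] by (metis atLeastAtMost_iff box_real(2) order_trans)
      have fba: "f b - f a = (\<Sum>(x,K)\<in>p. f(Sup K) - f(Inf K))" "b - a = (\<Sum>(x,K)\<in>p. Sup K - Inf K)"
        using additive_tagged_division_1[OF \<open>a \<le> b\<close> p, of f] additive_tagged_division_1[OF \<open>a \<le> b\<close> p, of "\<lambda>x. x"]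
        by auto
      have len: "Sup K - Inf K \<ge> 0" if "(x,K) \<in> p" for x K
        using Kab[OF that] by auto
      have s2: "norm (\<Sum>(x,K)\<in>p2. measure lborel K *\<^sub>R g x - (f (Sup K) - f (Inf K))) \<le> e2 * (b - a)"
      proof -
        have "norm (\<Sum>(x,K)\<in>p2. measure lborel K *\<^sub>R g x - (f (Sup K) - f (Inf K)))
            \<le> (\<Sum>n\<in>p2. e2 * (case n of (x,K) \<Rightarrow> Sup K - Inf K))"
        proof (rule sum_norm_le, safe)
          fix x K assume xK: "(x,K) \<in> p2"
          then have xKp: "(x,K) \<in> p" and xN: "x \<notin> N" by (auto simp: p2_def)
          obtain u v where K: "K = {u..v}" "u \<le> v" "x \<in> K" "K \<subseteq> {a..b}"
            using Kab[OF xKp] by auto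
          have "K \<subseteq> ball x (d x)" using fp xKp xN unfolding fine_def \<gamma>_def by fastforce
          then have "u \<in> ball x (d x)" "v \<in> ball x (d x)" using K(1,2) by auto
          then have nu: "norm (u - x) < d x" and nv: "norm (v - x) < d x"
            by (simp_all add: dist_norm norm_minus_commute)
          have xab: "x \<in> {a..b} - N" "u \<in> {a..b}" "v \<in> {a..b}" using K xN by auto
          have "norm ((v - u) *\<^sub>R f' x - (f v - f u))
            = norm (f u - f x - (u - x) *\<^sub>R f' x - (f v - f x - (v - x) *\<^sub>R f' x))"
            by (auto simp: algebra_simps)
          also have "\<dots> \<le> norm (f u - f x - (u - x) *\<^sub>R f' x) + norm (f v - f x - (v - x) *\<^sub>R f' x)"
            by (rule norm_triangle_ineq4)
          also have "\<dots> \<le> e2 * norm (u - x) + e2 * norm (v - x)"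
            using d[OF xab(1,2) nu] d[OF xab(1,3) nv] by simp
          also have "\<dots> = e2 * (v - u)" using K by (auto simp: algebra_simps)
          finally show "norm (measure lborel K *\<^sub>R g x - (f (Sup K) - f (Inf K))) \<le> e2 * (Sup K - Inf K)"
            using K xN by (simp add: g_def)
        qed
        also have "\<dots> = e2 * (\<Sum>(x,K)\<in>p2. Sup K - Inf K)"
          by (simp add: sum_distrib_left)
        also have "\<dots> \<le> e2 * (b - a)"
        proof -
          have "(\<Sum>(x,K)\<in>p2. Sup K - Inf K) \<le> b - a"
            unfolding fba(2) using pp len finp by (intro sum_mono2) (auto simp: p2_def)
          then show ?thesis using e2 by simp
        qed
        finally show ?thesis .
      qed
      \<comment> \<open>intervals tagged in \<open>N\<close> divide a subset of \<open>T\<close>, so their total length is below \<open>\<delta>\<close>\<close>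
      have s1: "norm (\<Sum>(x,K)\<in>p1. measure lborel K *\<^sub>R g x - (f (Sup K) - f (Inf K))) \<le> e2 * (b - a)"
      proof -
        have ptp: "p1 tagged_partial_division_of {a..b}"
          using p by (metis (no_types, lifting) pp(1) sup_ge1 tagged_division_of_def tagged_partial_division_subset)
        have p1U: "p1 tagged_division_of (\<Union>(snd ` p1))"
          using ptp by (rule tagged_partial_division_of_Union_self)
        have D: "snd ` p1 division_of (\<Union>(snd ` p1))"
          using division_of_tagged_division[OF p1U] .
        have sub: "\<Union>(snd ` p1) \<subseteq> {a..b}" using Kab pp by fastforce
        have "(\<Sum>k\<in>snd ` p1. Sup k - Inf k) = (\<Sum>k\<in>snd ` p1. measure lebesgue k)"
          using Kab pp by (intro sum.cong) fastforce+
        also have "\<dots> = measure lebesgue (\<Union>(snd ` p1))"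
          by (rule content_division[OF D])
        also have "\<dots> \<le> measure lebesgue T"
        proof (rule measure_mono_fmeasurable)
          show "\<Union>(snd ` p1) \<subseteq> T"
            using fp unfolding fine_def \<gamma>_def p1_def by fastforce
        qed (use Tm lmeasurable_division[OF D] in auto)
        finally have small: "(\<Sum>k\<in>snd ` p1. norm (f (Sup k) - f (Inf k))) < e2 * (b - a)"
          using ac'[OF D sub] mT by linarith
        \<comment> \<open>reindexing by intervals requires a summand that vanishes at the empty set\<close>
        define h where "h = (\<lambda>K. if K = {} then 0 else norm (f (Sup K) - f (Inf K)))"
        have h: "h K = norm (f (Sup K) - f (Inf K))" if "(x,K) \<in> p" for x K
          using Kab[OF that] by (auto simp: h_def)
        have "norm (\<Sum>(x,K)\<in>p1. measure lborel K *\<^sub>R g x - (f (Sup K) - f (Inf K)))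
          \<le> (\<Sum>n\<in>p1. (case n of (x,K) \<Rightarrow> h K))"
        proof (rule sum_norm_le, safe)
          fix x K assume "(x,K) \<in> p1"
          then have "(x,K) \<in> p" "x \<in> N" by (auto simp: p1_def)
          then show "norm (measure lborel K *\<^sub>R g x - (f (Sup K) - f (Inf K))) \<le> h K"
            using h by (simp add: g_def norm_minus_commute)
        qed
        also have "\<dots> = (\<Sum>k\<in>snd ` p1. h k)"
        proof (rule sum.over_tagged_division_lemma[OF p1U])
          fix u v :: real assume "box u v = {}"
          then have "v \<le> u" by (simp add: box_real)
          then show "h (cbox u v) = 0" by (cases "u = v") (auto simp: h_def)
        qed
        also have "\<dots> = (\<Sum>k\<in>snd ` p1. norm (f (Sup k) - f (Inf k)))"
        proof (rule sum.cong[OF refl])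
          fix k assume "k \<in> snd ` p1"
          then obtain x where "(x,k) \<in> p" using pp(1) by force
          then show "h k = norm (f (Sup k) - f (Inf k))" by (rule h)
        qed
        finally show ?thesis using small by simp
      qed
      have "norm (sum (\<lambda>(x,k). measure lborel k *\<^sub>R g x) p - (f b - f a))
         = norm (\<Sum>(x,K)\<in>p. measure lborel K *\<^sub>R g x - (f (Sup K) - f (Inf K)))"
        unfolding fba(1) by (simp add: sum_subtractf split_def)
      also have "\<dots> = norm ((\<Sum>(x,K)\<in>p1. measure lborel K *\<^sub>R g x - (f (Sup K) - f (Inf K)))
          + (\<Sum>(x,K)\<in>p2. measure lborel K *\<^sub>R g x - (f (Sup K) - f (Inf K))))"
        by (subst pp(1), subst sum.union_disjoint[OF pp(3,4,2)]) (rule refl)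
      also have "\<dots> \<le> e2 * (b - a) + e2 * (b - a)"
        by (rule norm_triangle_le) (use s1 s2 in linarith)
      also have "\<dots> = e * measure lborel {a..b}" using ab by (simp add: e2_def)
      finally show "norm (sum (\<lambda>(x,k). measure lborel k *\<^sub>R g x) p - (f b - f a)) \<le> e * measure lborel {a..b}" .
    qed
  qed
  then show ?thesis
    by (rule has_integral_spike[OF N, rotated]) (simp add: g_def)
qed

text \<open>
  Lebesgue differentiation over cubes with a corner at \<open>x\<close> gives the right derivative; applied to the
  reflected function it gives the left derivative.
\<close>

lemma indefinite_integral_has_vector_derivative_ae:
  fixes f :: "real \<Rightarrow> 'a::euclidean_space"
  assumes f: "f integrable_on {a..b}"
  obtains N where "negligible N"
    "\<And>x. x \<in> {a..b} - N \<Longrightarrow>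
      ((\<lambda>t. integral {a..t} f) has_vector_derivative f x) (at x within {a..b})"
proof -
  define g where "g = (\<lambda>x. if x \<in> {a..b} then f x else 0)"
  have gU: "g integrable_on UNIV"
    unfolding g_def using f by (rule integrable_restrict_UNIV[THEN iffD2])
  have gi: "g integrable_on {c..d}" for c d
    using gU by (rule integrable_on_subinterval) simp
  have gi': "(\<lambda>x. g (-x)) integrable_on {c..d}" for c d
    using gi[of "-d" "-c"] Henstock_Kurzweil_Integration.integrable_reflect_real[where f=g and a="-d" and b="-c"] by simp
  obtain N1 where N1: "negligible N1" and r: "\<And>x e. \<lbrakk>x \<notin> N1; 0 < e\<rbrakk> \<Longrightarrow>
      \<exists>d>0. \<forall>h. 0 < h \<and> h < d \<longrightarrow> norm (integral {x..x+h} g /\<^sub>R h - g x) < e"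
    using integrable_ccontinuous_explicit[of g] gi by (auto simp: box_real)
  obtain N2 where N2: "negligible N2" and l: "\<And>x e. \<lbrakk>x \<notin> N2; 0 < e\<rbrakk> \<Longrightarrow>
      \<exists>d>0. \<forall>h. 0 < h \<and> h < d \<longrightarrow> norm (integral {x..x+h} (\<lambda>x. g (-x)) /\<^sub>R h - g (-x)) < e"
    using integrable_ccontinuous_explicit[of "\<lambda>x. g (-x)"] gi' by (auto simp: box_real)
  show ?thesis
  proof
    show "negligible (N1 \<union> uminus ` N2)"
    proof (rule negligible_Un[OF N1])
      have "(uminus :: real \<Rightarrow> real) differentiable_on N2"
        by (intro differentiable_on_minus differentiable_on_ident)
      then show "negligible (uminus ` N2)"
        using negligible_differentiable_image_negligible[OF order_refl N2] by blast
    qed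
  next
    fix x assume x: "x \<in> {a..b} - (N1 \<union> uminus ` N2)"
    then have x1: "x \<notin> N1" and x2: "- x \<notin> N2" and xab: "a \<le> x" "x \<le> b"
      by (auto simp: image_iff)
    have gx: "g x = f x" using xab by (simp add: g_def)
    have G: "integral {a..t} f = integral {a..t} g" if "t \<le> b" for t
      by (rule integral_cong) (use that in \<open>auto simp: g_def\<close>)
    have comb: "integral {a..t} g - integral {a..s} g = integral {s..t} g" if "a \<le> s" "s \<le> t" for s t
      using Henstock_Kurzweil_Integration.integral_combine[OF that gi] by (simp add: algebra_simps)
    show "((\<lambda>t. integral {a..t} f) has_vector_derivative f x) (at x within {a..b})"
      unfolding has_vector_derivative_def has_derivative_within_alt
    proof (intro conjI allI impI)
      show "bounded_linear (\<lambda>h. h *\<^sub>R f x)" by (rule bounded_linear_scaleR_left)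
      fix e :: real assume e: "e > 0"
      obtain d1 where d1: "d1 > 0" "\<And>h. 0 < h \<Longrightarrow> h < d1 \<Longrightarrow> norm (integral {x..x+h} g /\<^sub>R h - g x) < e"
        using r[OF x1 e] by blast
      obtain d2 where d2: "d2 > 0"
          "\<And>h. 0 < h \<Longrightarrow> h < d2 \<Longrightarrow> norm (integral {-x..-x+h} (\<lambda>x. g (-x)) /\<^sub>R h - g x) < e"
        using l[OF x2 e] by auto
      have sc: "norm (w - h *\<^sub>R g x) \<le> e * h" if "h > 0" "norm (w /\<^sub>R h - g x) < e" for w h
      proof -
        have "w - h *\<^sub>R g x = h *\<^sub>R (w /\<^sub>R h - g x)" using that by (simp add: algebra_simps)
        then have "norm (w - h *\<^sub>R g x) = h * norm (w /\<^sub>R h - g x)" using that by simp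
        then show ?thesis using that by (simp add: mult.commute mult_left_mono)
      qed
      have "norm (integral {a..y} f - integral {a..x} f - (y - x) *\<^sub>R f x) \<le> e * norm (y - x)"
        if y: "y \<in> {a..b}" "norm (y - x) < min d1 d2" for y
      proof (cases "y = x")
        case False
        show ?thesis
        proof (cases "y > x")
          case True
          then have "norm (integral {x..y} g - (y - x) *\<^sub>R g x) \<le> e * (y - x)"
            using sc[of "y - x" "integral {x..y} g"] d1(2)[of "y - x"] y by auto
          then show ?thesis using True y xab G comb[of x y] gx by auto
        next
          case False
          with \<open>y \<noteq> x\<close> have yx: "y < x" by simp
          have "integral {-x..-x+(x-y)} (\<lambda>x. g (-x)) = integral {y..x} g"
            using Henstock_Kurzweil_Integration.integral_reflect_real[where f=g and a=y and b=x] by simp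
          then have "norm (integral {y..x} g - (x - y) *\<^sub>R g x) \<le> e * (x - y)"
            using sc[of "x - y" "integral {y..x} g"] d2(2)[of "x - y"] y yx by auto
          moreover have "integral {a..y} f - integral {a..x} f - (y - x) *\<^sub>R f x
              = - (integral {y..x} g - (x - y) *\<^sub>R g x)"
            using comb[of y x] G y xab yx gx by (auto simp: algebra_simps)
          ultimately show ?thesis using yx by (metis norm_minus_cancel norm_minus_commute abs_of_pos diff_gt_0_iff_gt real_norm_def)
        qed
      qed simp
      then show "\<exists>d>0. \<forall>y\<in>{a..b}. norm (y - x) < d \<longrightarrow>
          norm (integral {a..y} f - integral {a..x} f - (y - x) *\<^sub>R f x) \<le> e * norm (y - x)"
        using d1 d2 by (intro exI[of _ "min d1 d2"]) auto
    qed
  qed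
qed

text \<open>
  A square-integrable bound replaces the Lebesgue-theoretic absolute continuity of the
  integral by Young's inequality \<open>2 * w \<le> \<eta> * w\<^sup>2 + 1 / \<eta>\<close>: the first term is small through \<open>\<eta>\<close>, the second
  one through the total length of the division.
\<close>

lemma square_integrable_imp_absolutely_continuous:
  fixes f :: "real \<Rightarrow> 'a::euclidean_space"
  assumes f: "f integrable_on {a..b}" and w: "w integrable_on {a..b}"
    and w2: "(\<lambda>s. (w s)\<^sup>2) integrable_on {a..b}"
    and fw: "\<And>s. s \<in> {a..b} \<Longrightarrow> norm (f s) \<le> w s"
  shows "absolutely_continuous_on {a..b} (\<lambda>t. integral {a..t} f)"
  unfolding absolutely_continuous_on_def
proof (intro allI impI)
  fix \<epsilon> :: real assume \<epsilon>: "\<epsilon> > 0"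
  define I where "I = integral {a..b} (\<lambda>s. (w s)\<^sup>2)"
  have I: "I \<ge> 0" unfolding I_def by (rule integral_nonneg[OF w2]) simp
  define \<eta> where "\<eta> = \<epsilon> / (I + 1)"
  have \<eta>: "\<eta> > 0" using \<epsilon> I by (simp add: \<eta>_def)
  have "(\<Sum>k\<in>D. norm (integral {a..Sup k} f - integral {a..Inf k} f)) < \<epsilon>"
    if D: "D division_of T" "T \<subseteq> {a..b}" "(\<Sum>k\<in>D. Sup k - Inf k) < \<epsilon> * \<eta>" for D T
  proof -
    have K: "\<exists>u v. k = {u..v} \<and> u \<le> v \<and> k \<subseteq> {a..b}" if "k \<in> D" for k
      using division_ofD(2,3,4)[OF D(1) that] D(2) by (metis atLeastatMost_empty_iff2 box_real(2) subset_trans)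
    have "norm (integral {a..Sup k} f - integral {a..Inf k} f)
        \<le> (\<eta> / 2) * integral k (\<lambda>s. (w s)\<^sup>2) + (Sup k - Inf k) / (2 * \<eta>)" if kD: "k \<in> D" for k
    proof -
      obtain u v where k: "k = {u..v}" "u \<le> v" "{u..v} \<subseteq> {a..b}" using K[OF kD] by auto
      then have uv: "a \<le> u" "v \<le> b" by auto
      have fi: "f integrable_on {u..v}" and wi: "w integrable_on {u..v}"
        and w2i: "(\<lambda>s. (w s)\<^sup>2) integrable_on {u..v}"
        using f w w2 k(3) integrable_on_subinterval by blast+
      have "integral {a..v} f - integral {a..u} f = integral {u..v} f"
        using Henstock_Kurzweil_Integration.integral_combine[of a u v f] uv k(2)
          integrable_on_subinterval[OF f, of a v] by (auto simp: algebra_simps)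
      also have "norm \<dots> \<le> integral {u..v} (\<lambda>s. \<eta> / 2 * (w s)\<^sup>2 + 1 / (2 * \<eta>))"
      proof (rule Henstock_Kurzweil_Integration.integral_norm_bound_integral[OF fi])
        show "(\<lambda>s. \<eta> / 2 * (w s)\<^sup>2 + 1 / (2 * \<eta>)) integrable_on {u..v}"
          using w2i by (intro integrable_add integrable_on_mult_right) auto
        fix s assume "s \<in> {u..v}"
        then have "norm (f s) \<le> w s" using fw k(3) by auto
        also have "w s \<le> \<eta> / 2 * (w s)\<^sup>2 + 1 / (2 * \<eta>)"
        proof -
          have "0 \<le> (\<eta> * w s - 1)\<^sup>2" by simp
          then have "2 * \<eta> * w s \<le> \<eta>\<^sup>2 * (w s)\<^sup>2 + 1" by (simp add: power2_eq_square algebra_simps)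
          then show ?thesis using \<eta> by (simp add: field_simps power2_eq_square)
        qed
        finally show "norm (f s) \<le> \<eta> / 2 * (w s)\<^sup>2 + 1 / (2 * \<eta>)" .
      qed
      also have "\<dots> = (\<eta> / 2) * integral k (\<lambda>s. (w s)\<^sup>2) + (Sup k - Inf k) / (2 * \<eta>)"
        using w2i k by (subst Henstock_Kurzweil_Integration.integral_add) (auto intro!: integrable_on_mult_right)
      finally show ?thesis using k by simp
    qed
    then have "(\<Sum>k\<in>D. norm (integral {a..Sup k} f - integral {a..Inf k} f))
        \<le> (\<Sum>k\<in>D. (\<eta> / 2) * integral k (\<lambda>s. (w s)\<^sup>2) + (Sup k - Inf k) / (2 * \<eta>))"
      by (rule sum_mono)
    also have "\<dots> = \<eta> / 2 * (\<Sum>k\<in>D. integral k (\<lambda>s. (w s)\<^sup>2)) + (\<Sum>k\<in>D. Sup k - Inf k) / (2 * \<eta>)"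
      by (simp add: sum.distrib sum_distrib_left sum_divide_distrib)
    also have "(\<Sum>k\<in>D. integral k (\<lambda>s. (w s)\<^sup>2)) \<le> I"
    proof -
      have ii: "(\<lambda>s. (w s)\<^sup>2) integrable_on k" if "k \<in> D" for k
        using K[OF that] integrable_on_subinterval[OF w2] by metis
      have hT: "((\<lambda>s. (w s)\<^sup>2) has_integral (\<Sum>k\<in>D. integral k (\<lambda>s. (w s)\<^sup>2))) T"
        using ii by (intro has_integral_combine_division[OF D(1)]) (auto simp: integrable_integral)
      then have "(\<Sum>k\<in>D. integral k (\<lambda>s. (w s)\<^sup>2)) = integral T (\<lambda>s. (w s)\<^sup>2)" by (simp add: integral_unique)
      also have "\<dots> \<le> I" unfolding I_def
        by (rule integral_subset_le[OF D(2) _ w2]) (use hT in \<open>auto simp: integrable_on_def\<close>)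
      finally show ?thesis .
    qed
    also have "\<eta> / 2 * I + (\<Sum>k\<in>D. Sup k - Inf k) / (2 * \<eta>) < \<epsilon>"
    proof -
      have "(\<Sum>k\<in>D. Sup k - Inf k) / (2 * \<eta>) < \<epsilon> * \<eta> / (2 * \<eta>)"
        using D(3) \<eta> by (intro divide_strict_right_mono) auto
      then have "(\<Sum>k\<in>D. Sup k - Inf k) / (2 * \<eta>) < \<epsilon> / 2" using \<eta> by simp
      moreover have "\<eta> * I \<le> \<epsilon>"
        using \<epsilon> I by (simp add: \<eta>_def field_simps)
      ultimately show ?thesis by simp
    qed
    finally show ?thesis using \<eta> by (simp add: mult_left_mono)
  qed
  then show "\<exists>\<delta>>0. \<forall>D T. D division_of T \<and> T \<subseteq> {a..b} \<and> (\<Sum>k\<in>D. Sup k - Inf k) < \<delta> \<longrightarrow>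
        (\<Sum>k\<in>D. norm (integral {a..Sup k} f - integral {a..Inf k} f)) < \<epsilon>"
    using \<epsilon> \<eta> by (intro exI[of _ "\<epsilon> * \<eta>"]) auto
qed

lemma absolutely_continuous_on_imp_continuous_on:
  fixes f :: "real \<Rightarrow> 'a::real_normed_vector"
  assumes "absolutely_continuous_on {a..b} f"
  shows "continuous_on {a..b} f"
  unfolding continuous_on_iff
proof (intro ballI allI impI)
  fix x e :: real assume x: "x \<in> {a..b}" and "e > 0"
  with assms obtain d where d: "d > 0" and
    ac: "\<And>D T. \<lbrakk>D division_of T; T \<subseteq> {a..b}; (\<Sum>k\<in>D. Sup k - Inf k) < d\<rbrakk> \<Longrightarrow>
        (\<Sum>k\<in>D. norm (f (Sup k) - f (Inf k))) < e"
    unfolding absolutely_continuous_on_def by meson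
  have *: "norm (f t - f s) < e" if "s \<in> {a..b}" "t \<in> {a..b}" "s \<le> t" "t - s < d" for s t
  proof -
    have "{cbox s t} division_of (cbox s t)" by (rule division_of_self) (use that in auto)
    then show ?thesis using ac[of "{cbox s t}" "cbox s t"] that by simp
  qed
  show "\<exists>d>0. \<forall>x'\<in>{a..b}. dist x' x < d \<longrightarrow> dist (f x') (f x) < e"
  proof (intro exI conjI ballI impI)
    fix y assume "y \<in> {a..b}" "dist y x < d"
    then show "dist (f y) (f x) < e"
      using *[of x y] *[of y x] x by (cases "x \<le> y") (auto simp: dist_norm norm_minus_commute)
  qed (rule d)
qed

section \<open>Square-integrable controls\<close>

text \<open>The quadratic \<open>c \<mapsto> \<integral>(f - c * g)\<^sup>2\<close> is nonnegative; if \<open>\<integral>g\<^sup>2 > 0\<close>, its value at \<open>c = \<integral>f g / \<integral>g\<^sup>2\<close> gives the claim.\<close>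

lemma integral_Cauchy_Schwarz:
  fixes f g :: "'a::euclidean_space \<Rightarrow> real"
  assumes f: "(\<lambda>s. (f s)\<^sup>2) integrable_on S" and g: "(\<lambda>s. (g s)\<^sup>2) integrable_on S"
    and fg: "(\<lambda>s. f s * g s) integrable_on S"
  shows "(integral S (\<lambda>s. f s * g s))\<^sup>2 \<le> integral S (\<lambda>s. (f s)\<^sup>2) * integral S (\<lambda>s. (g s)\<^sup>2)"
proof -
  define A P G where "A = integral S (\<lambda>s. (f s)\<^sup>2)" and "P = integral S (\<lambda>s. f s * g s)"
    and "G = integral S (\<lambda>s. (g s)\<^sup>2)"
  have q: "0 \<le> A - 2 * c * P + c\<^sup>2 * G" for c
  proof -
    have "((\<lambda>s. (f s)\<^sup>2 - (2 * c) * (f s * g s) + c\<^sup>2 * (g s)\<^sup>2) has_integral A - (2 * c) * P + c\<^sup>2 * G) S"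
      unfolding A_def P_def G_def
      by (intro has_integral_add has_integral_diff has_integral_mult_right integrable_integral f g fg)
    moreover have "0 \<le> (f s)\<^sup>2 - (2 * c) * (f s * g s) + c\<^sup>2 * (g s)\<^sup>2" for s
    proof -
      have "(f s)\<^sup>2 - (2 * c) * (f s * g s) + c\<^sup>2 * (g s)\<^sup>2 = (f s - c * g s)\<^sup>2"
        by (simp add: power2_eq_square algebra_simps)
      then show ?thesis by simp
    qed
    ultimately show ?thesis by (rule has_integral_nonneg)
  qed
  have G: "G \<ge> 0" unfolding G_def by (rule integral_nonneg[OF g]) simp
  show ?thesis
  proof (cases "G = 0")
    case True
    have "P = 0"
    proof (rule ccontr)
      assume "P \<noteq> 0"
      then show False using q[of "(A + 1) / (2 * P)"] True by (simp add: field_simps)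
    qed
    then show ?thesis using True by (simp add: P_def[symmetric] G_def[symmetric])
  next
    case False
    then have "0 \<le> A - P\<^sup>2 / G" using q[of "P / G"] G by (simp add: power2_eq_square field_simps)
    then show ?thesis using False G by (simp add: P_def[symmetric] G_def[symmetric] A_def[symmetric] field_simps)
  qed
qed

lemma L2_controls_measurable:
  "u \<in> L2_controls \<Longrightarrow> u \<in> borel_measurable (lebesgue_on {0..1})"
  by (simp add: L2_controls_def)

lemma L2_controls_integrable:
  "u \<in> L2_controls \<Longrightarrow> integrable (lebesgue_on {0..1}) (\<lambda>s. (norm (u s))\<^sup>2)"
  by (simp add: L2_controls_def)

lemma L2_controls_square_integrable_on:
  fixes u :: "real \<Rightarrow> real^'l"
  assumes "u \<in> L2_controls" "{a..b} \<subseteq> {0..1}"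
  shows "(\<lambda>s. (norm (u s))\<^sup>2) integrable_on {a..b}"
  using integrable_on_lebesgue_on[OF L2_controls_integrable[OF assms(1)]] assms(2)
  by (auto intro: integrable_on_subinterval)

lemma L2_norm_power2:
  assumes "u \<in> L2_controls"
  shows "(L2_norm u)\<^sup>2 = integral {0..1} (\<lambda>s. (norm (u s))\<^sup>2)"
  using lebesgue_integral_eq_integral[OF L2_controls_integrable[OF assms], symmetric]
  by (simp add: L2_norm_def integral_nonneg_AE)

lemma L2_norm_nonneg [simp]: "L2_norm u \<ge> 0"
  by (simp add: L2_norm_def integral_nonneg_AE)

lemma L2_controls_absolutely_integrable:
  fixes u :: "real \<Rightarrow> real^'l"
  assumes "u \<in> L2_controls" "{a..b} \<subseteq> {0..1}"
  shows "u absolutely_integrable_on {a..b}"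
proof -
  have "u absolutely_integrable_on {0..1}"
  proof (rule measurable_bounded_by_integrable_imp_absolutely_integrable)
    show "(\<lambda>s. 1 + (norm (u s))\<^sup>2) integrable_on {0..1}"
      using L2_controls_square_integrable_on[OF assms(1), of 0 1] by (intro integrable_add) auto
    show "norm (u s) \<le> 1 + (norm (u s))\<^sup>2" for s
    proof -
      have "0 \<le> (norm (u s) - 1/2)\<^sup>2" by simp
      then show ?thesis by (simp add: power2_eq_square algebra_simps)
    qed
  qed (use L2_controls_measurable[OF assms(1)] in auto)
  then show ?thesis using assms(2) absolutely_integrable_on_subinterval by blast
qed

lemma L2_controls_integrable_on:
  fixes u :: "real \<Rightarrow> real^'l"
  assumes "u \<in> L2_controls" "{a..b} \<subseteq> {0..1}"
  shows "u integrable_on {a..b}" "(\<lambda>s. norm (u s)) integrable_on {a..b}"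
  using L2_controls_absolutely_integrable[OF assms] by (auto simp: absolutely_integrable_on_def)

lemma L2_controls_bounded_mult_integrable:
  fixes u :: "real \<Rightarrow> real^'l" and \<phi> :: "real \<Rightarrow> real"
  assumes u: "u \<in> L2_controls" and ab: "{a..b} \<subseteq> {0..1}" and \<phi>: "continuous_on {0..1} \<phi>"
  shows "(\<lambda>s. norm (u s) * \<phi> s) integrable_on {a..b}"
proof -
  have "bounded (\<phi> ` {0..1})" using \<phi> by (intro compact_imp_bounded compact_continuous_image) auto
  then obtain M where M: "\<And>s. s \<in> {0..1} \<Longrightarrow> \<bar>\<phi> s\<bar> \<le> M" by (force simp: bounded_iff)
  have "(\<lambda>s. norm (u s) * \<phi> s) absolutely_integrable_on {0..1}"
  proof (rule measurable_bounded_by_integrable_imp_absolutely_integrable)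
    have "\<phi> \<in> borel_measurable (lebesgue_on {0..1})"
      by (rule continuous_imp_measurable_on_sets_lebesgue[OF \<phi>]) auto
    then show "(\<lambda>s. norm (u s) * \<phi> s) \<in> borel_measurable (lebesgue_on {0..1})"
      using L2_controls_measurable[OF u] by measurable
    show "(\<lambda>s. norm (u s) * M) integrable_on {0..1}"
      using L2_controls_integrable_on(2)[OF u, of 0 1] by (intro integrable_on_mult_left) auto
    show "norm (norm (u s) * \<phi> s) \<le> norm (u s) * M" if "s \<in> {0..1}" for s
      using M[OF that] by (simp add: abs_mult mult_left_mono)
  qed auto
  then show ?thesis
    using ab by (meson absolutely_integrable_on_def integrable_on_subinterval)
qed

lemma L2_Cauchy_Schwarz:
  fixes u :: "real \<Rightarrow> real^'l" and \<phi> :: "real \<Rightarrow> real"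
  assumes u: "u \<in> L2_controls" and ab: "{a..b} \<subseteq> {0..1}" and \<phi>: "continuous_on {0..1} \<phi>"
  shows "(integral {a..b} (\<lambda>s. norm (u s) * \<phi> s))\<^sup>2 \<le> (L2_norm u)\<^sup>2 * integral {a..b} (\<lambda>s. (\<phi> s)\<^sup>2)"
proof -
  have \<phi>2: "(\<lambda>s. (\<phi> s)\<^sup>2) integrable_on {a..b}"
    using \<phi> ab by (intro integrable_continuous_interval continuous_intros) (auto intro: continuous_on_subset)
  have "(integral {a..b} (\<lambda>s. norm (u s) * \<phi> s))\<^sup>2
      \<le> integral {a..b} (\<lambda>s. (norm (u s))\<^sup>2) * integral {a..b} (\<lambda>s. (\<phi> s)\<^sup>2)"
    by (rule integral_Cauchy_Schwarz[OF L2_controls_square_integrable_on[OF u ab] \<phi>2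
          L2_controls_bounded_mult_integrable[OF u ab \<phi>]])
  also have "\<dots> \<le> (L2_norm u)\<^sup>2 * integral {a..b} (\<lambda>s. (\<phi> s)\<^sup>2)"
  proof (rule mult_right_mono)
    show "integral {a..b} (\<lambda>s. (norm (u s))\<^sup>2) \<le> (L2_norm u)\<^sup>2"
      unfolding L2_norm_power2[OF u]
      by (rule integral_subset_le[OF ab]) (use L2_controls_square_integrable_on[OF u] ab in auto)
    show "0 \<le> integral {a..b} (\<lambda>s. (\<phi> s)\<^sup>2)"
      by (rule integral_nonneg[OF \<phi>2]) simp
  qed
  finally show ?thesis .
qed

lemma L2_integral_norm_le:
  fixes u :: "real \<Rightarrow> real^'l"
  assumes u: "u \<in> L2_controls" and ab: "{a..b} \<subseteq> {0..1}" "a \<le> b"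
  shows "integral {a..b} (\<lambda>s. norm (u s)) \<le> L2_norm u * sqrt (b - a)"
proof (rule power2_le_imp_le)
  show "(integral {a..b} (\<lambda>s. norm (u s)))\<^sup>2 \<le> (L2_norm u * sqrt (b - a))\<^sup>2"
    using L2_Cauchy_Schwarz[OF u ab(1), of "\<lambda>_. 1"] ab(2) by (simp add: power_mult_distrib)
qed (use ab in simp)

lemma L2_controls_scaleR:
  fixes u :: "real \<Rightarrow> real^'l"
  assumes "u \<in> L2_controls" shows "(\<lambda>s. c *\<^sub>R u s) \<in> L2_controls"
  using assms by (auto simp: L2_controls_def power_mult_distrib)

lemma L2_controls_add:
  fixes u :: "real \<Rightarrow> real^'l"
  assumes u: "u \<in> L2_controls" and v: "v \<in> L2_controls" shows "(\<lambda>s. u s + v s) \<in> L2_controls"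
proof -
  have [measurable]: "u \<in> borel_measurable (lebesgue_on {0..1})" "v \<in> borel_measurable (lebesgue_on {0..1})"
    using u v L2_controls_measurable by auto
  have "integrable (lebesgue_on {0..1}) (\<lambda>s. (norm (u s + v s))\<^sup>2)"
  proof (rule Bochner_Integration.integrable_bound)
    show "integrable (lebesgue_on {0..1}) (\<lambda>s. 2 * (norm (u s))\<^sup>2 + 2 * (norm (v s))\<^sup>2)"
      using u v by (intro Bochner_Integration.integrable_add integrable_mult_right L2_controls_integrable)
    have "(norm (u s + v s))\<^sup>2 \<le> 2 * (norm (u s))\<^sup>2 + 2 * (norm (v s))\<^sup>2" for s
    proof -
      have "(norm (u s + v s))\<^sup>2 \<le> (norm (u s) + norm (v s))\<^sup>2"
        by (simp add: norm_triangle_ineq power_mono)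
      moreover have "0 \<le> (norm (u s) - norm (v s))\<^sup>2" by simp
      ultimately show ?thesis by (simp add: power2_eq_square algebra_simps)
    qed
    then show "AE s in lebesgue_on {0..1}. norm ((norm (u s + v s))\<^sup>2) \<le> norm (2 * (norm (u s))\<^sup>2 + 2 * (norm (v s))\<^sup>2)"
      by (simp add: abs_of_nonneg)
  qed measurable
  then show ?thesis by (simp add: L2_controls_def)
qed

lemma L2_controls_diff:
  fixes u :: "real \<Rightarrow> real^'l"
  assumes u: "u \<in> L2_controls" and v: "v \<in> L2_controls" shows "(\<lambda>s. u s - v s) \<in> L2_controls"
  using L2_controls_add[OF u L2_controls_scaleR[OF v, of "-1"]] by simp

lemma L2_controls_zero: "(\<lambda>s. 0 :: real^'l) \<in> L2_controls"
  by (simp add: L2_controls_def)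

lemma L2_norm_zero: "L2_norm (\<lambda>s. 0 :: real^'l) = 0"
  by (simp add: L2_norm_def)

lemma L2_norm_scaleR:
  fixes u :: "real \<Rightarrow> real^'l"
  assumes "u \<in> L2_controls" shows "L2_norm (\<lambda>s. c *\<^sub>R u s) = \<bar>c\<bar> * L2_norm u"
  by (simp add: L2_norm_def power_mult_distrib real_sqrt_mult)

lemma L2_parallelogram:
  fixes u :: "real \<Rightarrow> real^'l"
  assumes u: "u \<in> L2_controls" and v: "v \<in> L2_controls"
  shows "(L2_norm (\<lambda>s. u s - v s))\<^sup>2 + (L2_norm (\<lambda>s. u s + v s))\<^sup>2 = 2 * (L2_norm u)\<^sup>2 + 2 * (L2_norm v)\<^sup>2"
proof -
  have "(L2_norm (\<lambda>s. u s - v s))\<^sup>2 + (L2_norm (\<lambda>s. u s + v s))\<^sup>2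
    = integral {0..1} (\<lambda>s. (norm (u s - v s))\<^sup>2 + (norm (u s + v s))\<^sup>2)"
    unfolding L2_norm_power2[OF L2_controls_diff[OF u v]] L2_norm_power2[OF L2_controls_add[OF u v]]
    by (rule Henstock_Kurzweil_Integration.integral_add[symmetric])
       (use L2_controls_diff[OF u v] L2_controls_add[OF u v] in \<open>auto intro: L2_controls_square_integrable_on\<close>)
  also have "\<dots> = integral {0..1} (\<lambda>s. 2 * (norm (u s))\<^sup>2 + 2 * (norm (v s))\<^sup>2)"
    by (rule arg_cong[of _ _ "integral {0..1}"]) (auto simp: power2_norm_eq_inner inner_simps inner_commute)
  also have "\<dots> = 2 * (L2_norm u)\<^sup>2 + 2 * (L2_norm v)\<^sup>2"
    unfolding L2_norm_power2[OF u] L2_norm_power2[OF v]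
    using u v by (subst Henstock_Kurzweil_Integration.integral_add)
      (auto intro!: integrable_on_mult_right L2_controls_square_integrable_on)
  finally show ?thesis .
qed

lemma L2_norm_diff_le:
  fixes u :: "real \<Rightarrow> real^'l"
  assumes u: "u \<in> L2_controls" "L2_norm u \<le> R" and v: "v \<in> L2_controls" "L2_norm v \<le> R"
  shows "L2_norm (\<lambda>s. u s - v s) \<le> 2 * R"
proof (rule power2_le_imp_le)
  have "(L2_norm u)\<^sup>2 \<le> R\<^sup>2" "(L2_norm v)\<^sup>2 \<le> R\<^sup>2" using u v by (auto intro!: power_mono)
  then have "(L2_norm (\<lambda>s. u s - v s))\<^sup>2 \<le> 4 * R\<^sup>2"
    using L2_parallelogram[OF u(1) v(1)] zero_le_power2[of "L2_norm (\<lambda>s. u s + v s)"]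
    by linarith
  then show "(L2_norm (\<lambda>s. u s - v s))\<^sup>2 \<le> (2 * R)\<^sup>2" by (simp add: power_mult_distrib)
  show "0 \<le> 2 * R" using u(2) L2_norm_nonneg[of u] by linarith
qed

text \<open>
  The kernel \<open>norm (u s)\<close> is not bounded, so the usual proof by differentiation does not apply directly.
  Squaring and the Cauchy-Schwarz inequality give
  \<open>(\<phi> t)\<^sup>2 \<le> 2 * c\<^sup>2 + 2 * L\<^sup>2 * (L2_norm u)\<^sup>2 * \<integral>\<^sub>0\<^sup>t \<phi>\<^sup>2\<close>, the classical situation for \<open>\<phi>\<^sup>2\<close>. This produces
  the factor \<open>sqrt 2\<close>.
\<close>

lemma Gronwall_L2:
  fixes u :: "real \<Rightarrow> real^'l" and \<phi> :: "real \<Rightarrow> real"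
  assumes u: "u \<in> L2_controls" and \<phi>: "continuous_on {0..1} \<phi>"
    and nonneg: "\<And>t. t \<in> {0..1} \<Longrightarrow> 0 \<le> \<phi> t" and c: "0 \<le> c" and "0 \<le> L"
    and le: "\<And>t. t \<in> {0..1} \<Longrightarrow> \<phi> t \<le> c + L * integral {0..t} (\<lambda>s. norm (u s) * \<phi> s)"
    and t: "t \<in> {0..1}"
  shows "\<phi> t \<le> sqrt 2 * exp (L\<^sup>2 * (L2_norm u)\<^sup>2) * c"
proof -
  define A where "A = 2 * L\<^sup>2 * (L2_norm u)\<^sup>2"
  have A: "A \<ge> 0" by (simp add: A_def)
  define \<psi> where "\<psi> = (\<lambda>t. 2 * c\<^sup>2 + A * integral {0..t} (\<lambda>s. (\<phi> s)\<^sup>2))"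
  have \<phi>2c: "continuous_on {0..1} (\<lambda>s. (\<phi> s)\<^sup>2)" by (intro continuous_intros \<phi>)
  have sq: "(\<phi> t)\<^sup>2 \<le> \<psi> t" if t: "t \<in> {0..1}" for t
  proof -
    define J where "J = integral {0..t} (\<lambda>s. norm (u s) * \<phi> s)"
    have "(\<phi> t)\<^sup>2 \<le> (c + L * J)\<^sup>2" using le[OF t] nonneg[OF t] by (intro power_mono) (auto simp: J_def)
    also have "\<dots> \<le> 2 * c\<^sup>2 + 2 * (L * J)\<^sup>2"
    proof -
      have "0 \<le> (c - L * J)\<^sup>2" by simp
      then show ?thesis by (simp add: power2_eq_square algebra_simps)
    qed
    also have "\<dots> = 2 * c\<^sup>2 + 2 * L\<^sup>2 * J\<^sup>2" by (simp add: power_mult_distrib)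
    also have "\<dots> \<le> 2 * c\<^sup>2 + 2 * L\<^sup>2 * ((L2_norm u)\<^sup>2 * integral {0..t} (\<lambda>s. (\<phi> s)\<^sup>2))"
      using L2_Cauchy_Schwarz[OF u _ \<phi>, of 0 t] t by (auto simp: J_def intro!: mult_left_mono)
    also have "\<dots> = \<psi> t" by (simp add: \<psi>_def A_def algebra_simps)
    finally show ?thesis .
  qed
  define h where "h = (\<lambda>t. \<psi> t * exp (- A * t))"
  have "((\<lambda>t. integral {0..t} (\<lambda>s. (\<phi> s)\<^sup>2)) has_real_derivative (\<phi> s)\<^sup>2) (at s within {0..1})" if "s \<in> {0..1}" for s
    using integral_has_real_derivative[OF \<phi>2c that] .
  then have hd: "(h has_real_derivative (A * (\<phi> s)\<^sup>2 - A * \<psi> s) * exp (- A * s)) (at s within {0..1})" if "s \<in> {0..1}" for s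
    unfolding h_def \<psi>_def using that
    by (auto intro!: derivative_eq_intros simp: algebra_simps)
  have "h t \<le> h 0"
  proof (rule DERIV_nonpos_imp_decreasing_open[of 0 t h])
    show "0 \<le> t" using t by simp
    show "\<exists>y. (h has_real_derivative y) (at s) \<and> y \<le> 0" if "0 < s" "s < t" for s
    proof (intro exI conjI)
      have "s \<in> {0..1}" "s \<in> interior {0..1}" using that t by auto
      then show "(h has_real_derivative (A * (\<phi> s)\<^sup>2 - A * \<psi> s) * exp (- A * s)) (at s)"
        using hd[of s] at_within_interior by metis
      show "(A * (\<phi> s)\<^sup>2 - A * \<psi> s) * exp (- A * s) \<le> 0"
        using sq[of s] A \<open>s \<in> {0..1}\<close> by (intro mult_nonpos_nonneg) (auto simp: mult_left_mono)
    qed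
    have "continuous_on {0..1} h"
      using hd DERIV_continuous continuous_on_eq_continuous_within by blast
    then show "continuous_on {0..t} h" using t by (auto intro: continuous_on_subset)
  qed
  also have "h 0 = 2 * c\<^sup>2" by (simp add: h_def \<psi>_def)
  finally have "\<psi> t \<le> 2 * c\<^sup>2 * exp (A * t)" by (simp add: h_def exp_minus field_simps)
  also have "\<dots> \<le> 2 * c\<^sup>2 * exp A" using A t by (intro mult_left_mono) (auto simp: mult_left_le)
  also have "\<dots> = (sqrt 2 * exp (L\<^sup>2 * (L2_norm u)\<^sup>2) * c)\<^sup>2"
    by (simp add: power_mult_distrib A_def exp_double[symmetric] algebra_simps)
  finally have "(\<phi> t)\<^sup>2 \<le> (sqrt 2 * exp (L\<^sup>2 * (L2_norm u)\<^sup>2) * c)\<^sup>2" using sq[OF t] by linarith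
  then show ?thesis by (rule power2_le_imp_le) (use c in auto)
qed

section \<open>Trajectories of the control system\<close>

lemma absolutely_continuous_on_subset:
  assumes f: "absolutely_continuous_on S f" and TS: "T \<subseteq> S"
  shows "absolutely_continuous_on T f"
  unfolding absolutely_continuous_on_def
proof (intro allI impI)
  fix \<epsilon> :: real assume "\<epsilon> > 0"
  then obtain \<delta> where "\<delta> > 0" "\<And>D U. D division_of U \<and> U \<subseteq> S \<and> (\<Sum>k\<in>D. Sup k - Inf k) < \<delta> \<Longrightarrow>
      (\<Sum>k\<in>D. norm (f (Sup k) - f (Inf k))) < \<epsilon>"
    using f unfolding absolutely_continuous_on_def by meson
  with TS show "\<exists>\<delta>>0. \<forall>D U. D division_of U \<and> U \<subseteq> T \<and> (\<Sum>k\<in>D. Sup k - Inf k) < \<delta> \<longrightarrow>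
      (\<Sum>k\<in>D. norm (f (Sup k) - f (Inf k))) < \<epsilon>"
    by (meson subset_trans)
qed

text \<open>The only properties of the vector fields that enter the theory of their flows.\<close>

locale bounded_lipschitz_fields =
  fixes F :: "'l::finite \<Rightarrow> real^'n \<Rightarrow> real^'n" and B L :: real
  assumes bounded: "norm (F i x) \<le> B"
    and lipschitz: "norm (F i x - F i y) \<le> L * norm (x - y)"
    and L_nonneg: "0 \<le> L"
begin

definition V :: "real^'n \<Rightarrow> real^'l \<Rightarrow> real^'n" where
  "V x w = (\<Sum>i\<in>UNIV. (w $ i) *\<^sub>R F i x)"

definition C :: real where "C = real CARD('l) * B"

definition \<Lambda> :: real where "\<Lambda> = real CARD('l) * L"

lemma B_nonneg: "0 \<le> B"
  using bounded[of undefined 0] norm_ge_zero order_trans by blast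

lemma C_nonneg: "0 \<le> C" by (simp add: C_def B_nonneg)

lemma \<Lambda>_nonneg: "0 \<le> \<Lambda>" by (simp add: \<Lambda>_def L_nonneg)

lemma norm_V_le: "norm (V x w) \<le> C * norm w"
proof -
  have "norm (V x w) \<le> (\<Sum>i\<in>(UNIV::'l set). norm w * B)"
    unfolding V_def
    by (rule sum_norm_le) (auto intro!: mult_mono bounded simp: component_le_norm_cart)
  then show ?thesis by (simp add: C_def mult_ac)
qed

lemma norm_V_diff_le: "norm (V x w - V y w) \<le> \<Lambda> * norm (x - y) * norm w"
proof -
  have "V x w - V y w = (\<Sum>i\<in>UNIV. (w $ i) *\<^sub>R (F i x - F i y))"
    by (simp add: V_def sum_subtractf scaleR_diff_right)
  also have "norm \<dots> \<le> (\<Sum>i\<in>(UNIV::'l set). norm w * (L * norm (x - y)))"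
    by (rule sum_norm_le) (auto intro!: mult_mono lipschitz simp: component_le_norm_cart)
  finally show ?thesis by (simp add: \<Lambda>_def mult_ac)
qed

lemma linear_V: "linear (V x)"
  by (rule linearI) (auto simp: V_def algebra_simps sum.distrib scaleR_sum_right)

lemma V_diff: "V x (w - z) = V x w - V x z"
  by (rule linear_diff[OF linear_V])

lemma continuous_on_F: "continuous_on UNIV (F i)"
proof -
  have "L-lipschitz_on UNIV (F i)"
    by (rule lipschitz_onI) (auto simp: dist_norm lipschitz L_nonneg)
  then show ?thesis by (rule lipschitz_on_continuous_on)
qed

lemma V_absolutely_integrable:
  assumes u: "u \<in> L2_controls" and x: "continuous_on {0..1} x" and ab: "{a..b} \<subseteq> {0..1}"
  shows "(\<lambda>s. V (x s) (u s)) absolutely_integrable_on {a..b}"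
proof -
  have um [measurable]: "u \<in> borel_measurable (lebesgue_on {0..1})"
    by (rule L2_controls_measurable[OF u])
  have [measurable]: "(\<lambda>s. F i (x s)) \<in> borel_measurable (lebesgue_on {0..1})" for i
    by (rule continuous_imp_measurable_on_sets_lebesgue)
       (auto intro!: continuous_on_compose2[OF continuous_on_F x])
  have [measurable]: "(\<lambda>s. u s $ i) \<in> borel_measurable (lebesgue_on {0..1})" for i
    by (rule measurable_compose[OF um]) (intro borel_measurable_continuous_onI continuous_intros)
  have "(\<lambda>s. V (x s) (u s)) absolutely_integrable_on {0..1}"
  proof (rule measurable_bounded_by_integrable_imp_absolutely_integrable)
    show "(\<lambda>s. V (x s) (u s)) \<in> borel_measurable (lebesgue_on {0..1})"
      unfolding V_def by measurable
    show "(\<lambda>s. C * norm (u s)) integrable_on {0..1}"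
      using L2_controls_integrable_on(2)[OF u, of 0 1] by (intro integrable_on_mult_right) auto
    show "norm (V (x s) (u s)) \<le> C * norm (u s)" for s by (rule norm_V_le)
  qed auto
  then show ?thesis using ab absolutely_integrable_on_subinterval by blast
qed

lemma V_integrable:
  assumes "u \<in> L2_controls" "continuous_on {0..1} x" "{a..b} \<subseteq> {0..1}"
  shows "(\<lambda>s. V (x s) (u s)) integrable_on {a..b}"
  using V_absolutely_integrable[OF assms] absolutely_integrable_on_def by blast

definition trajectory :: "(real \<Rightarrow> real^'l) \<Rightarrow> real^'n \<Rightarrow> (real \<Rightarrow> real^'n) \<Rightarrow> bool" where
  "trajectory u x0 x \<longleftrightarrow> continuous_on {0..1} x \<and>
     (\<forall>t\<in>{0..1}. x t = x0 + integral {0..t} (\<lambda>s. V (x s) (u s)))"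

lemma trajectory_iff_caratheodory_solution:
  assumes u: "u \<in> L2_controls"
  shows "trajectory u x0 x \<longleftrightarrow> caratheodory_solution F u x0 x"
proof
  assume tr: "trajectory u x0 x"
  then have x: "continuous_on {0..1} x"
    and eq: "\<And>t. t \<in> {0..1} \<Longrightarrow> x t = x0 + integral {0..t} (\<lambda>s. V (x s) (u s))"
    by (auto simp: trajectory_def)
  let ?I = "\<lambda>t. integral {0..t} (\<lambda>s. V (x s) (u s))"
  have int: "(\<lambda>s. V (x s) (u s)) integrable_on {0..1}" by (rule V_integrable[OF u x]) simp
  have acI: "absolutely_continuous_on {0..1} ?I"
  proof (rule square_integrable_imp_absolutely_continuous[OF int])
    show "(\<lambda>s. C * norm (u s)) integrable_on {0..1}"
      using L2_controls_integrable_on(2)[OF u, of 0 1] by (intro integrable_on_mult_right) auto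
    show "(\<lambda>s. (C * norm (u s))\<^sup>2) integrable_on {0..1}"
      unfolding power_mult_distrib
      using L2_controls_square_integrable_on[OF u, of 0 1] by (intro integrable_on_mult_right) auto
  qed (rule norm_V_le)
  have SI: "Sup k \<in> {0..1} \<and> Inf k \<in> {0..1}" if DT: "D division_of T" "T \<subseteq> {0..1}" "k \<in> D" for D T and k :: "real set"
  proof -
    obtain a b where "k = cbox a b" using division_ofD(4)[OF DT(1,3)] by blast
    moreover have "k \<noteq> {}" "k \<subseteq> {0..1}" using division_ofD(2,3)[OF DT(1,3)] DT(2) by auto
    ultimately show ?thesis by auto
  qed
  have "absolutely_continuous_on {0..1} x"
    unfolding absolutely_continuous_on_def
  proof (intro allI impI)
    fix \<epsilon> :: real assume "\<epsilon> > 0"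
    then obtain \<delta> where \<delta>: "\<delta> > 0" and ac: "\<And>D T. D division_of T \<and> T \<subseteq> {0..1} \<and> (\<Sum>k\<in>D. Sup k - Inf k) < \<delta> \<Longrightarrow>
        (\<Sum>k\<in>D. norm (?I (Sup k) - ?I (Inf k))) < \<epsilon>"
      using acI unfolding absolutely_continuous_on_def by meson
    have "(\<Sum>k\<in>D. norm (x (Sup k) - x (Inf k))) < \<epsilon>"
      if "D division_of T \<and> T \<subseteq> {0..1} \<and> (\<Sum>k\<in>D. Sup k - Inf k) < \<delta>" for D T
    proof -
      have "(\<Sum>k\<in>D. norm (x (Sup k) - x (Inf k))) = (\<Sum>k\<in>D. norm (?I (Sup k) - ?I (Inf k)))"
      proof (rule sum.cong[OF refl])
        fix k assume "k \<in> D"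
        then have "Sup k \<in> {0..1}" "Inf k \<in> {0..1}" using SI that by blast+
        then show "norm (x (Sup k) - x (Inf k)) = norm (?I (Sup k) - ?I (Inf k))" by (simp only: eq add_diff_cancel_left)
      qed
      then show ?thesis using ac[OF that] by simp
    qed
    then show "\<exists>\<delta>>0. \<forall>D T. D division_of T \<and> T \<subseteq> {0..1} \<and> (\<Sum>k\<in>D. Sup k - Inf k) < \<delta> \<longrightarrow>
        (\<Sum>k\<in>D. norm (x (Sup k) - x (Inf k))) < \<epsilon>" using \<delta> by blast
  qed
  moreover have "x 0 = x0" using eq[of 0] by simp
  moreover have "AE s in lebesgue_on {0..1}. (x has_vector_derivative V (x s) (u s)) (at s within {0..1})"
  proof -
    obtain N where N: "negligible N" and der: "\<And>s. s \<in> {0..1} - N \<Longrightarrow>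
        (?I has_vector_derivative V (x s) (u s)) (at s within {0..1})"
      by (rule indefinite_integral_has_vector_derivative_ae[OF int]) blast
    have "(x has_vector_derivative V (x s) (u s)) (at s within {0..1})" if "s \<in> {0..1}" "s \<notin> N" for s
    proof -
      have "((\<lambda>t. x0 + ?I t) has_vector_derivative V (x s) (u s)) (at s within {0..1})"
        using has_vector_derivative_add[OF has_vector_derivative_const der] that by simp
      then show ?thesis
        by (rule has_vector_derivative_transform[rotated 2]) (use that eq in auto)
    qed
    moreover have "AE s in lebesgue. s \<notin> N"
      using N by (simp add: AE_not_in negligible_iff_null_sets)
    ultimately show ?thesis
      by (subst AE_restrict_space_iff) auto
  qed
  ultimately show "caratheodory_solution F u x0 x"
    by (simp add: caratheodory_solution_def V_def)
next
  assume "caratheodory_solution F u x0 x"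
  then have ac: "absolutely_continuous_on {0..1} x" and x0: "x 0 = x0"
    and ae: "AE s in lebesgue_on {0..1}. (x has_vector_derivative V (x s) (u s)) (at s within {0..1})"
    by (simp_all add: caratheodory_solution_def V_def)
  define N where "N = {s \<in> {0..1}. \<not> (x has_vector_derivative V (x s) (u s)) (at s within {0..1})}"
  have "AE s in lebesgue. s \<notin> N"
    using ae by (subst (asm) AE_restrict_space_iff) (auto simp: N_def elim: eventually_mono)
  then obtain N' where "N' \<in> null_sets lebesgue" "N \<subseteq> N'"
    by (auto simp: eventually_ae_filter)
  then have N: "negligible N"
    using negligible_iff_null_sets negligible_subset by blast
  show "trajectory u x0 x"
    unfolding trajectory_def
  proof (intro conjI ballI)
    show "continuous_on {0..1} x" by (rule absolutely_continuous_on_imp_continuous_on[OF ac])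
    fix t :: real assume t: "t \<in> {0..1}"
    have "((\<lambda>s. V (x s) (u s)) has_integral (x t - x 0)) {0..t}"
    proof (rule absolutely_continuous_has_integral[OF _ _ N])
      show "absolutely_continuous_on {0..t} x"
        using ac by (rule absolutely_continuous_on_subset) (use t in auto)
      show "(x has_vector_derivative V (x s) (u s)) (at s within {0..t})" if "s \<in> {0..t} - N" for s
        using that t by (auto simp: N_def intro: has_vector_derivative_within_subset)
    qed (use t in auto)
    then show "x t = x0 + integral {0..t} (\<lambda>s. V (x s) (u s))"
      using x0 by (simp add: integral_unique)
  qed
qed


text \<open>
  Picard iteration contracts by the factor \<open>1/2\<close> for the weighted norm
  \<open>sup\<^sub>t exp (- \<omega> * t) * norm (x t)\<close> when \<open>\<omega>\<close> is large compared with \<open>\<Lambda>\<^sup>2 * (L2_norm u)\<^sup>2\<close>. The weight is built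
  into the unknown \<open>y t = exp (- \<omega> * t) * x t\<close>, so that the plain supremum norm on bounded continuous functions
  can be used.
\<close>

lemma trajectory_exists:
  assumes u: "u \<in> L2_controls"
  shows "\<exists>x. trajectory u x0 x"
proof -
  define R where "R = L2_norm u"
  have R: "R \<ge> 0" by (simp add: R_def)
  define \<omega> where "\<omega> = 2 * \<Lambda>\<^sup>2 * R\<^sup>2 + 1"
  have \<omega>: "\<omega> > 0" by (simp add: \<omega>_def add_nonneg_pos)
  define X :: "(real \<Rightarrow>\<^sub>C (real^'n)) \<Rightarrow> real \<Rightarrow> real^'n" where "X = (\<lambda>y s. exp (\<omega> * s) *\<^sub>R y s)"
  have cX: "continuous_on {0..1} (X y)" for y
    unfolding X_def by (intro continuous_intros continuous_on_apply_bcontfun)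
  define G :: "(real \<Rightarrow>\<^sub>C (real^'n)) \<Rightarrow> real \<Rightarrow> real^'n" where "G = (\<lambda>y t. exp (- \<omega> * t) *\<^sub>R (x0 + integral {0..t} (\<lambda>s. V (X y s) (u s))))"
  have cG: "continuous_on (cbox 0 1) (G y)" for y
    unfolding G_def cbox_interval
    by (intro continuous_intros indefinite_integral_continuous_1 V_integrable u cX) simp
  have "\<exists>g :: real \<Rightarrow>\<^sub>C (real^'n). \<forall>t. g t = G y (clamp 0 1 t)" for y
    using continuous_on_cbox_bcontfunE[OF cG] by metis
  then obtain S :: "(real \<Rightarrow>\<^sub>C (real^'n)) \<Rightarrow> (real \<Rightarrow>\<^sub>C (real^'n))"
    where S: "\<And>y t. S y t = G y (clamp 0 1 t)" by metis
  have G_contr: "norm (G y t - G z t) \<le> 1/2 * dist y z" if t: "t \<in> {0..1}" for y z :: "real \<Rightarrow>\<^sub>C (real^'n)" and t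
  proof -
    define D where "D = dist y z"
    have D: "norm (y s - z s) \<le> D" for s
      unfolding D_def dist_norm[symmetric] by (rule dist_bounded)
    have D0: "D \<ge> 0" by (simp add: D_def)
    have sub: "{0..t} \<subseteq> {0..1}" using t by auto
    define J where "J = integral {0..t} (\<lambda>s. norm (u s) * exp (\<omega> * s))"
    have ce: "continuous_on {0..1} (\<lambda>s. exp (\<omega> * s))" by (intro continuous_intros)
    have "J\<^sup>2 \<le> R\<^sup>2 * integral {0..t} (\<lambda>s. (exp (\<omega> * s))\<^sup>2)"
      unfolding J_def R_def by (rule L2_Cauchy_Schwarz[OF u sub ce])
    also have "integral {0..t} (\<lambda>s. (exp (\<omega> * s))\<^sup>2) = exp (2 * \<omega> * t) / (2 * \<omega>) - exp (2 * \<omega> * 0) / (2 * \<omega>)"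
    proof (rule integral_unique, rule fundamental_theorem_of_calculus)
      show "((\<lambda>s. exp (2 * \<omega> * s) / (2 * \<omega>)) has_vector_derivative (exp (\<omega> * s))\<^sup>2) (at s within {0..t})" for s
        unfolding has_real_derivative_iff_has_vector_derivative[symmetric]
        using \<omega> by (auto intro!: derivative_eq_intros simp: exp_double[symmetric] mult_ac)
    qed (use t in auto)
    also have "R\<^sup>2 * (exp (2 * \<omega> * t) / (2 * \<omega>) - exp (2 * \<omega> * 0) / (2 * \<omega>)) \<le> R\<^sup>2 * (exp (2 * \<omega> * t) / (2 * \<omega>))"
      using \<omega> by (intro mult_left_mono) auto
    finally have "J\<^sup>2 \<le> R\<^sup>2 * (exp (2 * \<omega> * t) / (2 * \<omega>))" .
    then have "(\<Lambda> * J)\<^sup>2 \<le> \<Lambda>\<^sup>2 * (R\<^sup>2 * (exp (2 * \<omega> * t) / (2 * \<omega>)))"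
      unfolding power_mult_distrib by (rule mult_left_mono) simp
    also have "\<dots> = (\<Lambda>\<^sup>2 * R\<^sup>2 / (2 * \<omega>)) * exp (2 * \<omega> * t)" by simp
    also have "\<dots> \<le> (1/4) * exp (2 * \<omega> * t)"
      using \<omega> by (intro mult_right_mono) (auto simp: field_simps \<omega>_def)
    also have "\<dots> = (1/2 * exp (\<omega> * t))\<^sup>2"
      by (simp add: power2_eq_square field_simps flip: exp_add)
    finally have J: "\<Lambda> * J \<le> 1/2 * exp (\<omega> * t)" by (rule power2_le_imp_le) simp
    have i1: "(\<lambda>s. V (X y s) (u s)) integrable_on {0..t}" for y by (rule V_integrable[OF u cX sub])
    have "norm (G y t - G z t) = exp (- \<omega> * t) * norm (integral {0..t} (\<lambda>s. V (X y s) (u s) - V (X z s) (u s)))"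
      unfolding Henstock_Kurzweil_Integration.integral_diff[OF i1 i1] G_def
      by (simp add: scaleR_diff_right[symmetric])
    also have "norm (integral {0..t} (\<lambda>s. V (X y s) (u s) - V (X z s) (u s)))
        \<le> integral {0..t} (\<lambda>s. (\<Lambda> * D) * (norm (u s) * exp (\<omega> * s)))"
    proof (rule Henstock_Kurzweil_Integration.integral_norm_bound_integral)
      show "(\<lambda>s. V (X y s) (u s) - V (X z s) (u s)) integrable_on {0..t}"
        by (intro integrable_diff i1)
      show "(\<lambda>s. (\<Lambda> * D) * (norm (u s) * exp (\<omega> * s))) integrable_on {0..t}"
        by (intro integrable_on_mult_right L2_controls_bounded_mult_integrable[OF u sub ce])
      fix s
      have "norm (V (X y s) (u s) - V (X z s) (u s)) \<le> \<Lambda> * norm (X y s - X z s) * norm (u s)"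
        by (rule norm_V_diff_le)
      also have "norm (X y s - X z s) = exp (\<omega> * s) * norm (y s - z s)"
        by (simp add: X_def scaleR_diff_right[symmetric])
      also have "\<Lambda> * (exp (\<omega> * s) * norm (y s - z s)) * norm (u s) \<le> \<Lambda> * (exp (\<omega> * s) * D) * norm (u s)"
        using D \<Lambda>_nonneg by (intro mult_right_mono mult_left_mono) auto
      finally show "norm (V (X y s) (u s) - V (X z s) (u s)) \<le> (\<Lambda> * D) * (norm (u s) * exp (\<omega> * s))"
        by (simp add: mult_ac)
    qed
    also have "integral {0..t} (\<lambda>s. (\<Lambda> * D) * (norm (u s) * exp (\<omega> * s))) = D * (\<Lambda> * J)"
      by (simp add: J_def)
    also have "D * (\<Lambda> * J) \<le> D * (1/2 * exp (\<omega> * t))" using J D0 by (rule mult_left_mono)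
    finally have "norm (G y t - G z t) \<le> exp (- \<omega> * t) * (D * (1/2 * exp (\<omega> * t)))" by simp
    also have "\<dots> = 1/2 * D" by (simp add: exp_minus field_simps)
    finally show ?thesis by (simp add: D_def)
  qed
  have cl: "clamp 0 1 t \<in> {0..1}" for t :: real using clamp_in_interval[of 0 1 t] by simp
  have "\<exists>!y. S y = y"
  proof (rule banach_fix_type[of "1/2"])
    show "\<forall>y z. dist (S y) (S z) \<le> 1 / 2 * dist y z"
    proof (intro allI dist_bound)
      fix y z t
      have "dist (S y t) (S z t) = norm (G y (clamp 0 1 t) - G z (clamp 0 1 t))"
        by (simp add: S dist_norm)
      also have "\<dots> \<le> 1 / 2 * dist y z" by (rule G_contr[OF cl])
      finally show "dist (S y t) (S z t) \<le> 1 / 2 * dist y z" .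
    qed
  qed auto
  then obtain y where y: "S y = y" by blast
  have "trajectory u x0 (X y)"
    unfolding trajectory_def
  proof (intro conjI ballI cX)
    fix t :: real assume t: "t \<in> {0..1}"
    have "y t = S y t" by (simp add: y)
    also have "\<dots> = G y t" using t by (simp add: S clamp_cancel_cbox)
    finally have "X y t = exp (\<omega> * t) *\<^sub>R G y t" by (simp add: X_def)
    then show "X y t = x0 + integral {0..t} (\<lambda>s. V (X y s) (u s))"
      by (simp add: G_def exp_minus)
  qed
  then show ?thesis by blast
qed

text \<open>
  The forcing term \<open>\<integral> V (y s) (u s - v s)\<close> is kept inside the norm. Estimating it by \<open>L2_norm (u - v)\<close> gives
  strong continuity in the control, while weak continuity exploits cancellation in this integral.
\<close>

lemma trajectory_stability:
  assumes u: "u \<in> L2_controls" and v: "v \<in> L2_controls"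
    and x: "trajectory u x0 x" and y: "trajectory v y0 y"
    and \<eta>: "\<And>t. t \<in> {0..1} \<Longrightarrow> norm (integral {0..t} (\<lambda>s. V (y s) (u s - v s))) \<le> \<eta>"
    and t: "t \<in> {0..1}"
  shows "norm (x t - y t) \<le> sqrt 2 * exp (\<Lambda>\<^sup>2 * (L2_norm u)\<^sup>2) * (norm (x0 - y0) + \<eta>)"
proof -
  have cx: "continuous_on {0..1} x" and cy: "continuous_on {0..1} y"
    using x y by (auto simp: trajectory_def)
  have c\<phi>: "continuous_on {0..1} (\<lambda>t. norm (x t - y t))" by (intro continuous_intros cx cy)
  have "0 \<le> \<eta>" using \<eta>[of 0] by simp
  show ?thesis
  proof (rule Gronwall_L2[OF u c\<phi> _ _ \<Lambda>_nonneg _ t])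
    fix t :: real assume t: "t \<in> {0..1}"
    then have sub: "{0..t} \<subseteq> {0..1}" by auto
    let ?d = "\<lambda>s. V (x s) (u s) - V (y s) (u s)" and ?w = "\<lambda>s. V (y s) (u s - v s)"
    have ixu: "(\<lambda>s. V (x s) (u s)) integrable_on {0..t}" and iyu: "(\<lambda>s. V (y s) (u s)) integrable_on {0..t}"
      and iyv: "(\<lambda>s. V (y s) (v s)) integrable_on {0..t}" 
      using V_integrable u v cx cy sub by blast+
    have iw: "?w integrable_on {0..t}" using integrable_diff[OF iyu iyv] by (simp add: V_diff)
    have "x t - y t = (x0 - y0) + (integral {0..t} ?d + integral {0..t} ?w)"
      using x y t Henstock_Kurzweil_Integration.integral_diff[OF ixu iyu]
        Henstock_Kurzweil_Integration.integral_diff[OF iyu iyv]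
      by (simp add: trajectory_def V_diff)
    then have "norm (x t - y t) = norm ((x0 - y0) + (integral {0..t} ?d + integral {0..t} ?w))" by (simp only:)
    also have "\<dots> \<le> norm (x0 - y0) + (norm (integral {0..t} ?d) + norm (integral {0..t} ?w))"
      by (intro order_trans[OF norm_triangle_ineq] add_left_mono norm_triangle_ineq)
    also have "norm (integral {0..t} ?d) \<le> integral {0..t} (\<lambda>s. \<Lambda> * (norm (u s) * norm (x s - y s)))"
    proof (rule Henstock_Kurzweil_Integration.integral_norm_bound_integral)
      show "?d integrable_on {0..t}" by (rule integrable_diff[OF ixu iyu])
      show "(\<lambda>s. \<Lambda> * (norm (u s) * norm (x s - y s))) integrable_on {0..t}"
        by (intro integrable_on_mult_right L2_controls_bounded_mult_integrable[OF u sub c\<phi>])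
      show "norm (?d s) \<le> \<Lambda> * (norm (u s) * norm (x s - y s))" for s
        using norm_V_diff_le[of "x s" "u s" "y s"] by (simp add: mult_ac)
    qed
    also have "norm (integral {0..t} ?w) \<le> \<eta>" by (rule \<eta>[OF t])
    finally show "norm (x t - y t) \<le> (norm (x0 - y0) + \<eta>) + \<Lambda> * integral {0..t} (\<lambda>s. norm (u s) * norm (x s - y s))"
      by simp
  qed (use \<open>0 \<le> \<eta>\<close> in auto)
qed

lemma trajectory_stability_initial:
  assumes u: "u \<in> L2_controls" and x: "trajectory u x0 x" and y: "trajectory u y0 y" and t: "t \<in> {0..1}"
  shows "norm (x t - y t) \<le> sqrt 2 * exp (\<Lambda>\<^sup>2 * (L2_norm u)\<^sup>2) * norm (x0 - y0)"
  using trajectory_stability[OF u u x y, of 0] t by (simp add: linear_0[OF linear_V])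

text \<open>Uniqueness is the case of equal controls and equal initial points in the stability estimate.\<close>

lemma flow_eq:
  assumes u: "u \<in> L2_controls" and x: "trajectory u x0 x"
  shows "flow F u x0 = x 1"
  unfolding flow_def
proof (rule the_equality)
  show "\<exists>y. caratheodory_solution F u x0 y \<and> y 1 = x 1"
    using x trajectory_iff_caratheodory_solution[OF u] by blast
next
  fix z assume "\<exists>y. caratheodory_solution F u x0 y \<and> y 1 = z"
  then obtain y where "trajectory u x0 y" "y 1 = z"
    using trajectory_iff_caratheodory_solution[OF u] by blast
  then show "z = x 1" using trajectory_stability_initial[OF u x, of x0 y 1] by simp
qed

lemma flow_zero: "flow F (\<lambda>s. 0) x0 = x0"
proof -
  have "trajectory (\<lambda>s. 0) x0 (\<lambda>s. x0)" by (simp add: trajectory_def linear_0[OF linear_V])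
  from flow_eq[OF L2_controls_zero this] show ?thesis .
qed

lemma flow_lipschitz:
  assumes u: "u \<in> L2_controls"
  shows "norm (flow F u x0 - flow F u y0) \<le> sqrt 2 * exp (\<Lambda>\<^sup>2 * (L2_norm u)\<^sup>2) * norm (x0 - y0)"
proof -
  obtain x y where "trajectory u x0 x" "trajectory u y0 y" using trajectory_exists[OF u] by meson
  then show ?thesis
    using trajectory_stability_initial[OF u, of x0 x y0 y 1] flow_eq[OF u] by simp
qed

lemma flow_diff_control_le:
  assumes u: "u \<in> L2_controls" and v: "v \<in> L2_controls"
  shows "norm (flow F u x0 - flow F v x0)
    \<le> sqrt 2 * exp (\<Lambda>\<^sup>2 * (L2_norm u)\<^sup>2) * (C * L2_norm (\<lambda>s. u s - v s))"
proof -
  obtain x y where x: "trajectory u x0 x" and y: "trajectory v x0 y"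
    using trajectory_exists u v by meson
  then have cy: "continuous_on {0..1} y" by (simp add: trajectory_def)
  let ?w = "\<lambda>s. u s - v s"
  have w: "?w \<in> L2_controls" by (rule L2_controls_diff[OF u v])
  have "norm (x 1 - y 1) \<le> sqrt 2 * exp (\<Lambda>\<^sup>2 * (L2_norm u)\<^sup>2) * (norm (x0 - x0) + C * L2_norm ?w)"
  proof (rule trajectory_stability[OF u v x y])
    fix t :: real assume t: "t \<in> {0..1}"
    then have sub: "{0..t} \<subseteq> {0..1}" "0 \<le> t" by auto
    have "norm (integral {0..t} (\<lambda>s. V (y s) (?w s))) \<le> integral {0..t} (\<lambda>s. C * norm (?w s))"
      by (rule Henstock_Kurzweil_Integration.integral_norm_bound_integral[OF V_integrable[OF w cy sub(1)]])
         (auto intro!: integrable_on_mult_right L2_controls_integrable_on(2)[OF w sub(1)] norm_V_le)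
    also have "\<dots> \<le> C * (L2_norm ?w * sqrt (t - 0))"
      using mult_left_mono[OF L2_integral_norm_le[OF w sub] C_nonneg] by simp
    also have "\<dots> \<le> C * (L2_norm ?w * 1)"
      using t C_nonneg by (intro mult_left_mono) auto
    finally show "norm (integral {0..t} (\<lambda>s. V (y s) (?w s))) \<le> C * L2_norm ?w" by simp
  qed simp
  then show ?thesis using flow_eq[OF u x] flow_eq[OF v y] by simp
qed

end

section \<open>Continuity of the flow under weak convergence of controls\<close>

context bounded_lipschitz_fields
begin

lemma trajectory_modulus:
  assumes v: "v \<in> L2_controls" and y: "trajectory v y0 y" and st: "0 \<le> s" "s \<le> t" "t \<le> 1"
  shows "norm (y t - y s) \<le> C * (L2_norm v * sqrt (t - s))"
proof -
  have cy: "continuous_on {0..1} y" using y by (simp add: trajectory_def)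
  have sub: "{s..t} \<subseteq> {0..1}" using st by auto
  have "integral {0..s} (\<lambda>r. V (y r) (v r)) + integral {s..t} (\<lambda>r. V (y r) (v r)) = integral {0..t} (\<lambda>r. V (y r) (v r))"
    by (rule Henstock_Kurzweil_Integration.integral_combine[OF st(1,2)]) (use V_integrable[OF v cy] st in auto)
  then have "y t - y s = integral {s..t} (\<lambda>r. V (y r) (v r))"
    using y st by (simp add: trajectory_def algebra_simps)
  also have "norm \<dots> \<le> integral {s..t} (\<lambda>r. C * norm (v r))"
    by (rule Henstock_Kurzweil_Integration.integral_norm_bound_integral[OF V_integrable[OF v cy sub]])
       (auto intro!: integrable_on_mult_right L2_controls_integrable_on(2)[OF v sub] norm_V_le)
  also have "\<dots> \<le> C * (L2_norm v * sqrt (t - s))"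
    using mult_left_mono[OF L2_integral_norm_le[OF v sub st(2)] C_nonneg] by simp
  finally show ?thesis .
qed

text \<open>
  On each of \<open>N\<close> equal pieces of \<open>[0,t]\<close> the trajectory \<open>y\<close> is frozen at the left end point. The error is governed
  by the modulus of continuity of \<open>y\<close>; the frozen term equals \<open>V (y (T j))\<close> applied to an increment of the primitive of
  \<open>w\<close>, which has norm at most \<open>2 * \<delta>\<close>.
\<close>

lemma weak_integral_bound:
  assumes v: "v \<in> L2_controls" and y: "trajectory v y0 y" and w: "w \<in> L2_controls"
    and t: "t \<in> {0..1}" and N: "0 < N"
    and \<delta>: "\<And>r. r \<in> {0..1} \<Longrightarrow> norm (integral {0..r} w) \<le> \<delta>"
  shows "norm (integral {0..t} (\<lambda>s. V (y s) (w s)))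
    \<le> \<Lambda> * (C * (L2_norm v * sqrt (1 / real N))) * L2_norm w + 2 * real N * C * \<delta>"
proof -
  have cy: "continuous_on {0..1} y" using y by (simp add: trajectory_def)
  define \<omega> where "\<omega> = \<Lambda> * (C * (L2_norm v * sqrt (1 / real N)))"
  have \<omega>0: "\<omega> \<ge> 0" using \<Lambda>_nonneg C_nonneg by (simp add: \<omega>_def)
  define T where "T = (\<lambda>j::nat. t * real j / real N)"
  have T0: "T 0 = 0" and TN: "T N = t" using N by (auto simp: T_def)
  have Tmono: "T j \<le> T (Suc j)" for j
    using t by (auto simp: T_def divide_right_mono mult_left_mono)
  have Tpos: "0 \<le> T j" for j using t by (simp add: T_def)
  have T1: "T j \<le> 1" if "j \<le> N" for j
  proof -
    have "t * real j \<le> 1 * real N" using t that by (intro mult_mono) auto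
    then show ?thesis using N by (simp add: T_def)
  qed
  have mesh: "T (Suc j) - T j \<le> 1 / real N" for j
    using t by (simp add: T_def diff_divide_distrib[symmetric] algebra_simps divide_right_mono)
  have "norm (integral {0..T j} (\<lambda>s. V (y s) (w s)))
      \<le> \<omega> * integral {0..T j} (\<lambda>s. norm (w s)) + 2 * real j * C * \<delta>" if "j \<le> N" for j
    using that
  proof (induction j)
    case 0 then show ?case by (simp add: T0)
  next
    case (Suc j)
    let ?a = "T j" and ?b = "T (Suc j)"
    have ab: "0 \<le> ?a" "?a \<le> ?b" "?b \<le> 1" using Tpos Tmono T1[OF Suc.prems] by auto
    have sub: "{?a..?b} \<subseteq> {0..1}" "{0..?b} \<subseteq> {0..1}" "{0..?a} \<subseteq> {0..1}" using ab by auto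
    let ?f = "\<lambda>s. V (y s) (w s)" and ?g = "\<lambda>s. V (y ?a) (w s)"
    have fi: "?f integrable_on {?a..?b}" by (rule V_integrable[OF w cy sub(1)])
    have gi: "?g integrable_on {?a..?b}" by (rule V_integrable[OF w _ sub(1)]) simp
    have wi: "w integrable_on {?a..?b}" "(\<lambda>s. norm (w s)) integrable_on {?a..?b}"
      using L2_controls_integrable_on[OF w sub(1)] by auto
    have 1: "norm (integral {?a..?b} (\<lambda>s. ?f s - ?g s)) \<le> integral {?a..?b} (\<lambda>s. \<omega> * norm (w s))"
    proof (rule Henstock_Kurzweil_Integration.integral_norm_bound_integral)
      show "(\<lambda>s. ?f s - ?g s) integrable_on {?a..?b}" by (rule integrable_diff[OF fi gi])
      show "(\<lambda>s. \<omega> * norm (w s)) integrable_on {?a..?b}" by (rule integrable_on_mult_right[OF wi(2)])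
      fix s assume s: "s \<in> {?a..?b}"
      have "norm (y s - y ?a) \<le> C * (L2_norm v * sqrt (s - ?a))"
        by (rule trajectory_modulus[OF v y]) (use s ab in auto)
      also have "\<dots> \<le> C * (L2_norm v * sqrt (1 / real N))"
        using mesh[of j] s C_nonneg by (intro mult_left_mono real_sqrt_le_mono) auto
      finally have yy: "norm (y s - y ?a) \<le> C * (L2_norm v * sqrt (1 / real N))" .
      have "norm (?f s - ?g s) \<le> \<Lambda> * norm (y s - y ?a) * norm (w s)" by (rule norm_V_diff_le)
      also have "\<dots> \<le> \<omega> * norm (w s)"
        unfolding \<omega>_def by (intro mult_right_mono mult_left_mono yy \<Lambda>_nonneg) simp
      finally show "norm (?f s - ?g s) \<le> \<omega> * norm (w s)" .
    qed
    have combw: "integral {0..?a} w + integral {?a..?b} w = integral {0..?b} w"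
      by (rule Henstock_Kurzweil_Integration.integral_combine[OF ab(1,2)])
         (rule L2_controls_integrable_on(1)[OF w sub(2)])
    have combn: "integral {0..?a} (\<lambda>s. norm (w s)) + integral {?a..?b} (\<lambda>s. norm (w s)) = integral {0..?b} (\<lambda>s. norm (w s))"
      by (rule Henstock_Kurzweil_Integration.integral_combine[OF ab(1,2)])
         (rule L2_controls_integrable_on(2)[OF w sub(2)])
    have combf: "integral {0..?a} ?f + integral {?a..?b} ?f = integral {0..?b} ?f"
      by (rule Henstock_Kurzweil_Integration.integral_combine[OF ab(1,2)])
         (rule V_integrable[OF w cy sub(2)])
    have 2: "norm (integral {?a..?b} ?g) \<le> 2 * C * \<delta>"
    proof -
      have "integral {?a..?b} ?g = V (y ?a) (integral {?a..?b} w)"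
        using integral_linear[OF wi(1), of "V (y ?a)"] linear_V linear_conv_bounded_linear
        by (auto simp: o_def)
      also have "norm \<dots> \<le> C * norm (integral {?a..?b} w)" by (rule norm_V_le)
      also have "\<dots> \<le> C * (\<delta> + \<delta>)"
      proof (rule mult_left_mono[OF _ C_nonneg])
        have "integral {?a..?b} w = integral {0..?b} w - integral {0..?a} w"
          using combw by (simp add: algebra_simps)
        then show "norm (integral {?a..?b} w) \<le> \<delta> + \<delta>"
          using norm_triangle_ineq4[of "integral {0..?b} w" "integral {0..?a} w"] \<delta>[of ?a] \<delta>[of ?b] ab by auto
      qed
      finally show ?thesis by simp
    qed
    have "integral {?a..?b} ?f = integral {?a..?b} (\<lambda>s. ?f s - ?g s) + integral {?a..?b} ?g"
      using Henstock_Kurzweil_Integration.integral_diff[OF fi gi] by simp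
    then have "integral {0..?b} ?f = integral {0..?a} ?f + (integral {?a..?b} (\<lambda>s. ?f s - ?g s) + integral {?a..?b} ?g)"
      using combf by simp
    then have "norm (integral {0..?b} ?f) = norm (integral {0..?a} ?f + (integral {?a..?b} (\<lambda>s. ?f s - ?g s) + integral {?a..?b} ?g))"
      by (rule arg_cong)
    also have "\<dots> \<le> norm (integral {0..?a} ?f) + (norm (integral {?a..?b} (\<lambda>s. ?f s - ?g s)) + norm (integral {?a..?b} ?g))"
      by (intro order_trans[OF norm_triangle_ineq] add_left_mono norm_triangle_ineq)
    also have "\<dots> \<le> (\<omega> * integral {0..?a} (\<lambda>s. norm (w s)) + 2 * real j * C * \<delta>)
        + (integral {?a..?b} (\<lambda>s. \<omega> * norm (w s)) + 2 * C * \<delta>)"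
      using Suc.prems by (intro add_mono[OF Suc.IH add_mono[OF 1 2]]) simp
    also have "\<dots> = \<omega> * (integral {0..?a} (\<lambda>s. norm (w s)) + integral {?a..?b} (\<lambda>s. norm (w s))) + 2 * real (Suc j) * C * \<delta>"
      by (simp add: algebra_simps)
    finally show ?case unfolding combn .
  qed
  from this[of N] have "norm (integral {0..t} (\<lambda>s. V (y s) (w s)))
      \<le> \<omega> * integral {0..t} (\<lambda>s. norm (w s)) + 2 * real N * C * \<delta>" by (simp add: TN)
  also have "\<omega> * integral {0..t} (\<lambda>s. norm (w s)) \<le> \<omega> * L2_norm w"
  proof (rule mult_left_mono[OF _ \<omega>0])
    have "integral {0..t} (\<lambda>s. norm (w s)) \<le> L2_norm w * sqrt (t - 0)"
      by (rule L2_integral_norm_le[OF w]) (use t in auto)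
    also have "\<dots> \<le> L2_norm w * 1" using t by (intro mult_left_mono) auto
    finally show "integral {0..t} (\<lambda>s. norm (w s)) \<le> L2_norm w" by simp
  qed
  finally show ?thesis by (simp add: \<omega>_def)
qed

text \<open>
  Choose \<open>N\<close> large to make the first summand in \<open>weak_integral_bound\<close> small uniformly over the ball of radius \<open>R\<close>, and then \<open>\<delta>\<close>
  small depending on \<open>N\<close>. The result is uniform in the initial point.
\<close>

lemma flow_weakly_continuous:
  assumes \<epsilon>: "0 < \<epsilon>"
  obtains \<delta> where "0 < \<delta>"
    "\<And>u v x0. \<lbrakk>u \<in> L2_controls; v \<in> L2_controls; L2_norm u \<le> R; L2_norm v \<le> R;
       \<And>t. t \<in> {0..1} \<Longrightarrow> norm (integral {0..t} (\<lambda>s. u s - v s)) \<le> \<delta>\<rbrakk>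
       \<Longrightarrow> norm (flow F u x0 - flow F v x0) \<le> \<epsilon>"
proof (cases "0 \<le> R")
  case False
  then show ?thesis using that[of 1] L2_norm_nonneg order_trans by (metis zero_less_one)
next
  case R: True
  define E where "E = sqrt 2 * exp (\<Lambda>\<^sup>2 * R\<^sup>2)"
  have E: "E > 0" by (simp add: E_def)
  define A where "A = \<Lambda> * (C * R) * (2 * R)"
  have A: "A \<ge> 0" using \<Lambda>_nonneg C_nonneg R by (simp add: A_def)
  have "((\<lambda>N. E * (A * sqrt (1 / real N))) \<longlongrightarrow> E * (A * sqrt 0)) sequentially"
    by (intro tendsto_intros lim_1_over_n)
  then have "\<forall>\<^sub>F N in sequentially. E * (A * sqrt (1 / real N)) < \<epsilon> / 2"
    using \<epsilon> by (intro order_tendstoD(2)) auto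
  then have "\<forall>\<^sub>F N in sequentially. E * (A * sqrt (1 / real N)) < \<epsilon> / 2 \<and> 0 < N"
    using eventually_gt_at_top[of "0::nat"] by eventually_elim auto
  then obtain N where N: "E * (A * sqrt (1 / real N)) < \<epsilon> / 2" "0 < N"
    using eventually_happens[of _ sequentially] by auto
  define S where "S = E * (2 * real N * C) + 1"
  define \<delta> where "\<delta> = \<epsilon> / (2 * S)"
  have den: "S > 0" using E C_nonneg by (simp add: S_def add_nonneg_pos)
  have \<delta>: "\<delta> > 0" using \<epsilon> den by (simp add: \<delta>_def)
  show ?thesis
  proof (rule that[OF \<delta>])
    fix u v :: "real \<Rightarrow> real^'l" and x0 assume u: "u \<in> L2_controls" and v: "v \<in> L2_controls" and Ru: "L2_norm u \<le> R" and Rv: "L2_norm v \<le> R"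
      and close: "\<And>t. t \<in> {0..1} \<Longrightarrow> norm (integral {0..t} (\<lambda>s. u s - v s)) \<le> \<delta>"
    let ?w = "\<lambda>s. u s - v s"
    have w: "?w \<in> L2_controls" by (rule L2_controls_diff[OF u v])
    have Rw: "L2_norm ?w \<le> 2 * R" by (rule L2_norm_diff_le[OF u Ru v Rv])
    obtain x y where x: "trajectory u x0 x" and y: "trajectory v x0 y"
      using trajectory_exists u v by meson
    let ?\<eta> = "A * sqrt (1 / real N) + 2 * real N * C * \<delta>"
    have "norm (x 1 - y 1) \<le> sqrt 2 * exp (\<Lambda>\<^sup>2 * (L2_norm u)\<^sup>2) * (norm (x0 - x0) + ?\<eta>)"
    proof (rule trajectory_stability[OF u v x y])
      fix t :: real assume t: "t \<in> {0..1}"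
      have "norm (integral {0..t} (\<lambda>s. V (y s) (?w s)))
        \<le> \<Lambda> * (C * (L2_norm v * sqrt (1 / real N))) * L2_norm ?w + 2 * real N * C * \<delta>"
        by (rule weak_integral_bound[OF v y w t N(2) close])
      also have "\<Lambda> * (C * (L2_norm v * sqrt (1 / real N))) * L2_norm ?w \<le> \<Lambda> * (C * (R * sqrt (1 / real N))) * (2 * R)"
        using \<Lambda>_nonneg C_nonneg R Rv Rw by (intro mult_mono mult_nonneg_nonneg) auto
      also have "\<Lambda> * (C * (R * sqrt (1 / real N))) * (2 * R) = A * sqrt (1 / real N)"
        by (simp add: A_def)
      finally show "norm (integral {0..t} (\<lambda>s. V (y s) (?w s))) \<le> ?\<eta>" by simp
    qed simp
    also have "sqrt 2 * exp (\<Lambda>\<^sup>2 * (L2_norm u)\<^sup>2) * (norm (x0 - x0) + ?\<eta>) \<le> E * (norm (x0 - x0) + ?\<eta>)"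
    proof (rule mult_right_mono)
      have "\<Lambda>\<^sup>2 * (L2_norm u)\<^sup>2 \<le> \<Lambda>\<^sup>2 * R\<^sup>2" using Ru by (intro mult_left_mono power_mono) auto
      then show "sqrt 2 * exp (\<Lambda>\<^sup>2 * (L2_norm u)\<^sup>2) \<le> E" by (simp add: E_def)
      show "0 \<le> norm (x0 - x0) + ?\<eta>" using A C_nonneg \<delta> by (intro add_nonneg_nonneg mult_nonneg_nonneg) auto
    qed
    also have "\<dots> = E * (A * sqrt (1 / real N)) + (E * (2 * real N * C)) * \<delta>"
      by (simp add: algebra_simps)
    also have "\<dots> \<le> \<epsilon> / 2 + \<epsilon> / 2"
    proof (rule add_mono)
      have "(E * (2 * real N * C)) * \<delta> \<le> S * \<delta>"
        using \<delta> by (intro mult_right_mono) (auto simp: S_def)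
      also have "\<dots> = \<epsilon> / 2" using den by (simp add: \<delta>_def)
      finally show "(E * (2 * real N * C)) * \<delta> \<le> \<epsilon> / 2" .
    qed (use N in simp)
    finally show "norm (flow F u x0 - flow F v x0) \<le> \<epsilon>"
      using flow_eq[OF u x] flow_eq[OF v y] by simp
  qed
qed

end

section \<open>Weak compactness of bounded sets of controls\<close>

lemma L2_integral_norm_diff_le:
  fixes u v :: "real \<Rightarrow> real^'l"
  assumes u: "u \<in> L2_controls" and v: "v \<in> L2_controls" and t: "t \<in> {0..1}"
  shows "norm (integral {0..t} u - integral {0..t} v) \<le> L2_norm (\<lambda>s. u s - v s)"
proof -
  have w: "(\<lambda>s. u s - v s) \<in> L2_controls" by (rule L2_controls_diff[OF u v])
  have sub: "{0..t} \<subseteq> {0..1}" using t by auto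
  have "integral {0..t} u - integral {0..t} v = integral {0..t} (\<lambda>s. u s - v s)"
    by (rule Henstock_Kurzweil_Integration.integral_diff[symmetric])
       (rule L2_controls_integrable_on(1)[OF u sub], rule L2_controls_integrable_on(1)[OF v sub])
  also have "norm (integral {0..t} (\<lambda>s. u s - v s)) \<le> integral {0..t} (\<lambda>s. norm (u s - v s))"
    by (rule Henstock_Kurzweil_Integration.integral_norm_bound_integral)
       (use L2_controls_integrable_on[OF w sub] in auto)
  also have "\<dots> \<le> L2_norm (\<lambda>s. u s - v s) * sqrt (t - 0)"
    by (rule L2_integral_norm_le[OF w sub]) (use t in auto)
  also have "\<dots> \<le> L2_norm (\<lambda>s. u s - v s) * 1" using t by (intro mult_left_mono) auto
  finally show ?thesis by simp
qed

lemma L2_Fatou: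
  fixes f :: "nat \<Rightarrow> real \<Rightarrow> real^'l"
  assumes f: "\<And>n. f n \<in> L2_controls" and le: "\<And>n. L2_norm (f n) \<le> c"
    and g: "g \<in> borel_measurable (lebesgue_on {0..1})"
    and lim: "AE s in lebesgue_on {0..1}. (\<lambda>n. f n s) \<longlonglongrightarrow> g s"
  shows "g \<in> L2_controls" "L2_norm g \<le> c"
proof -
  let ?M = "lebesgue_on {0..1::real}"
  have c: "0 \<le> c" using le[of 0] L2_norm_nonneg[of "f 0"] by linarith
  have fm [measurable]: "f n \<in> borel_measurable ?M" for n by (rule L2_controls_measurable[OF f])
  have "(\<integral>\<^sup>+s. ennreal ((norm (g s))\<^sup>2) \<partial>?M) = (\<integral>\<^sup>+s. liminf (\<lambda>n. ennreal ((norm (f n s))\<^sup>2)) \<partial>?M)"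
  proof (rule nn_integral_cong_AE, use lim in eventually_elim)
    fix s assume "(\<lambda>n. f n s) \<longlonglongrightarrow> g s"
    then have "(\<lambda>n. ennreal ((norm (f n s))\<^sup>2)) \<longlonglongrightarrow> ennreal ((norm (g s))\<^sup>2)"
      by (intro tendsto_intros)
    then show "ennreal ((norm (g s))\<^sup>2) = liminf (\<lambda>n. ennreal ((norm (f n s))\<^sup>2))"
      by (rule lim_imp_Liminf[OF trivial_limit_sequentially, symmetric])
  qed
  also have "\<dots> \<le> liminf (\<lambda>n. \<integral>\<^sup>+s. ennreal ((norm (f n s))\<^sup>2) \<partial>?M)"
    by (rule nn_integral_liminf) measurable
  also have "\<dots> \<le> ennreal (c\<^sup>2)"
  proof (rule Liminf_le)
    have "(\<integral>\<^sup>+s. ennreal ((norm (f n s))\<^sup>2) \<partial>?M) = ennreal ((L2_norm (f n))\<^sup>2)" for n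
      using nn_integral_eq_integral[OF L2_controls_integrable[OF f]]
      by (simp add: L2_norm_def integral_nonneg_AE)
    then show "\<forall>\<^sub>F n in sequentially. (\<integral>\<^sup>+s. ennreal ((norm (f n s))\<^sup>2) \<partial>?M) \<le> ennreal (c\<^sup>2)"
      using le by (intro always_eventually allI) (simp add: power_mono ennreal_leI)
  qed simp
  finally have fin: "(\<integral>\<^sup>+s. ennreal ((norm (g s))\<^sup>2) \<partial>?M) \<le> ennreal (c\<^sup>2)" .
  have int: "integrable ?M (\<lambda>s. (norm (g s))\<^sup>2)"
  proof (rule integrableI_nonneg)
    show "(\<integral>\<^sup>+s. ennreal ((norm (g s))\<^sup>2) \<partial>?M) < \<infinity>" using fin by (simp add: le_less_trans)
  qed (use g in auto)
  then show gL: "g \<in> L2_controls" using g by (simp add: L2_controls_def)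
  have "ennreal (LINT s|?M. (norm (g s))\<^sup>2) \<le> ennreal (c\<^sup>2)"
    using fin nn_integral_eq_integral[OF int] by simp
  then have "(L2_norm g)\<^sup>2 \<le> c\<^sup>2" by (simp add: L2_norm_def integral_nonneg_AE)
  then show "L2_norm g \<le> c" by (rule power2_le_imp_le) (rule c)
qed

text \<open>The core of the completeness of \<open>L\<^sup>2\<close>: the sum of the increments has finite integral, hence is finite almost everywhere.\<close>

lemma L2_fast_Cauchy_imp_AE_convergent:
  fixes v :: "nat \<Rightarrow> real \<Rightarrow> real^'l"
  assumes v: "\<And>n. v n \<in> L2_controls" and fast: "\<And>n. L2_norm (\<lambda>s. v (Suc n) s - v n s) \<le> (1/2)^n"
  shows "AE s in lebesgue_on {0..1}. convergent (\<lambda>n. v n s)"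
proof -
  let ?M = "lebesgue_on {0..1::real}"
  have [measurable]: "v n \<in> borel_measurable ?M" for n by (rule L2_controls_measurable[OF v])
  let ?g = "\<lambda>n s. norm (v (Suc n) s - v n s)"
  have d: "(\<lambda>s. v (Suc n) s - v n s) \<in> L2_controls" for n by (rule L2_controls_diff[OF v v])
  have "(\<integral>\<^sup>+s. (\<Sum>n. ennreal (?g n s)) \<partial>?M) = (\<Sum>n. \<integral>\<^sup>+s. ennreal (?g n s) \<partial>?M)"
    by (rule nn_integral_suminf) measurable
  also have "\<dots> \<le> (\<Sum>n. ennreal ((1/2)^n))"
  proof (rule suminf_le)
    fix n
    have "integrable ?M (\<lambda>s. v (Suc n) s - v n s)"
      using L2_controls_absolutely_integrable[OF d, of 0 1 n] unfolding set_integrable_def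
      by (subst integrable_restrict_space) auto
    then have gi: "integrable ?M (?g n)" by (rule integrable_norm)
    have "(\<integral>\<^sup>+s. ennreal (?g n s) \<partial>?M) = ennreal (LINT s|?M. ?g n s)"
      by (rule nn_integral_eq_integral[OF gi]) simp
    also have "(LINT s|?M. ?g n s) = integral {0..1} (?g n)"
      by (rule lebesgue_integral_eq_integral[OF gi]) simp
    also have "integral {0..1} (?g n) \<le> (1/2)^n"
      using L2_integral_norm_le[OF d, of 0 1 n] fast[of n] by simp
    finally show "(\<integral>\<^sup>+s. ennreal (?g n s) \<partial>?M) \<le> ennreal ((1/2)^n)" by (simp add: ennreal_leI)
  qed auto
  also have "\<dots> = ennreal (\<Sum>n. (1/2)^n)" by (rule suminf_ennreal2) (auto intro: summable_geometric)
  also have "\<dots> < \<infinity>" by simp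
  finally have "AE s in ?M. (\<Sum>n. ennreal (?g n s)) \<noteq> \<infinity>"
    by (intro nn_integral_PInf_AE) (auto simp: less_top)
  then show ?thesis
  proof eventually_elim
    case (elim s)
    then have "summable (\<lambda>n. ?g n s)" by (intro summable_suminf_not_top) auto
    then have "summable (\<lambda>n. v (Suc n) s - v n s)" by (rule summable_norm_cancel)
    then have "(\<lambda>n. \<Sum>i<n. v (Suc i) s - v i s) \<longlonglongrightarrow> (\<Sum>i. v (Suc i) s - v i s)" by (rule summable_LIMSEQ)
    then have "(\<lambda>n. v n s - v 0 s) \<longlonglongrightarrow> (\<Sum>i. v (Suc i) s - v i s)" by (simp add: sum_lessThan_telescope[of "\<lambda>n. v n s"])
    from tendsto_add[OF this tendsto_const[of "v 0 s"]] show ?case by (auto simp: convergent_def)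
  qed
qed

text \<open>
  The primitives of the \<open>u k\<close> are equi-Hoelder continuous, so a subsequence converges uniformly to some \<open>g\<close>. To recognize \<open>g\<close> as the
  primitive of a control of norm at most \<open>\<rho>\<close>, consider the convex sets \<open>D e\<close> of controls whose primitive is within \<open>e\<close> of \<open>g\<close>. They
  decrease with \<open>e\<close> and contain all but finitely many members of the subsequence, so the infima \<open>d n\<close> of the norm over \<open>D (1/2\<^sup>n)\<close>
  increase to a limit at most \<open>\<rho>\<close>. As midpoints remain in these sets, the parallelogram identity forces almost minimal elements
  of the sets to form a Cauchy sequence, and its limit has the primitive \<open>g\<close>.
\<close>

theorem L2_weakly_compact:
  fixes u :: "nat \<Rightarrow> real \<Rightarrow> real^'l"
  assumes u: "\<And>k. u k \<in> L2_controls" and \<rho>: "(\<lambda>k. L2_norm (u k)) \<longlonglongrightarrow> \<rho>"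
  obtains v r where "strict_mono (r :: nat \<Rightarrow> nat)" "v \<in> L2_controls" "L2_norm v \<le> \<rho>"
    "\<And>\<delta>. 0 < \<delta> \<Longrightarrow> \<forall>\<^sub>F k in sequentially. \<forall>t\<in>{0..1}. norm (integral {0..t} (\<lambda>s. u (r k) s - v s)) \<le> \<delta>"
proof -
  obtain R where R: "\<And>k. L2_norm (u k) \<le> R"
    using \<rho> by (metis Bseq_def convergent_def convergent_imp_Bseq real_norm_def abs_le_D1)
  define U where "U = (\<lambda>k t. integral {0..t} (u k))"
  have Uinc: "norm (U k t - U k s) \<le> R * sqrt (t - s)" if "0 \<le> s" "s \<le> t" "t \<le> 1" for k s t
  proof -
    have sub: "{s..t} \<subseteq> {0..1}" "{0..t} \<subseteq> {0..1}" using that by auto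
    have "integral {0..s} (u k) + integral {s..t} (u k) = integral {0..t} (u k)"
      by (rule Henstock_Kurzweil_Integration.integral_combine[OF that(1,2)])
         (rule L2_controls_integrable_on(1)[OF u sub(2)])
    then have "U k t - U k s = integral {s..t} (u k)" by (simp add: U_def algebra_simps)
    then have "norm (U k t - U k s) \<le> integral {s..t} (\<lambda>r. norm (u k r))"
      using Henstock_Kurzweil_Integration.integral_norm_bound_integral[OF L2_controls_integrable_on[OF u sub(1)]] by simp
    also have "\<dots> \<le> L2_norm (u k) * sqrt (t - s)" by (rule L2_integral_norm_le[OF u sub(1) that(2)])
    also have "\<dots> \<le> R * sqrt (t - s)" using R that by (intro mult_right_mono) auto
    finally show ?thesis .
  qed
  have R0: "0 \<le> R" using R[of 0] L2_norm_nonneg[of "u 0"] by linarith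
  obtain g r where r: "strict_mono (r :: nat \<Rightarrow> nat)" and
    g: "\<And>e. 0 < e \<Longrightarrow> \<exists>N. \<forall>n t. n \<ge> N \<and> t \<in> {0..1} \<longrightarrow> norm (U (r n) t - g t) < e"
  proof (rule Arzela_Ascoli[of "{0..1}" U R])
    show "norm (U n t) \<le> R" if "t \<in> {0..1}" for n t
    proof -
      have "norm (U n t) \<le> R * sqrt t" using Uinc[of 0 t n] that by (simp add: U_def)
      also have "\<dots> \<le> R * 1" using that R0 by (intro mult_left_mono) auto
      finally show ?thesis by simp
    qed
    show "\<exists>d. 0 < d \<and> (\<forall>n y. y \<in> {0..1} \<and> norm (x - y) < d \<longrightarrow> norm (U n x - U n y) < e)"
      if x: "x \<in> {0..1}" and e: "0 < e" for x e
    proof (intro exI conjI allI impI)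
      show "0 < (e / (R + 1))\<^sup>2" using e R0 by simp
      fix n y assume y: "y \<in> {0..1} \<and> norm (x - y) < (e / (R + 1))\<^sup>2"
      have "norm (U n x - U n y) \<le> R * sqrt \<bar>x - y\<bar>"
        using Uinc[of x y n] Uinc[of y x n] x y by (cases "x \<le> y") (auto simp: norm_minus_commute)
      also have "\<dots> \<le> R * (e / (R + 1))"
      proof (rule mult_left_mono[OF _ R0])
        have "sqrt \<bar>x - y\<bar> \<le> sqrt ((e / (R + 1))\<^sup>2)" using y by (intro real_sqrt_le_mono) auto
        then show "sqrt \<bar>x - y\<bar> \<le> e / (R + 1)" using e R0 by simp
      qed
      also have "\<dots> < e" using e R0 by (simp add: field_simps)
      finally show "norm (U n x - U n y) < e" .
    qed
  qed auto
  define D where "D = (\<lambda>e. {w \<in> L2_controls. \<forall>t\<in>{0..1}. norm (integral {0..t} w - g t) \<le> e})"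
  have D_mono: "D e \<subseteq> D e'" if "e \<le> e'" for e e' using that by (force simp: D_def)
  define e where "e = (\<lambda>n::nat. (1/2::real)^n)"
  have e0: "0 < e n" for n by (simp add: e_def)
  have e_dec: "e n \<le> e m" if "m \<le> n" for m n using that by (simp add: e_def power_decreasing)
  have e_lim: "e \<longlonglongrightarrow> 0" unfolding e_def by (intro LIMSEQ_realpow_zero) auto
  have uD: "\<forall>\<^sub>F k in sequentially. u (r k) \<in> D (e n)" for n
  proof -
    obtain N where "\<And>k t. k \<ge> N \<and> t \<in> {0..1} \<Longrightarrow> norm (U (r k) t - g t) < e n"
      using g[OF e0[of n]] by blast
    then have "u (r k) \<in> D (e n)" if "k \<ge> N" for k
      using u that by (auto simp: D_def U_def intro: less_imp_le)
    then show ?thesis by (rule eventually_sequentiallyI)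
  qed
  define d where "d = (\<lambda>n. INF w\<in>D (e n). L2_norm w)"
  have bdd: "bdd_below (L2_norm ` D (e n))" for n by (rule bdd_belowI[of _ 0]) auto
  have d_le: "d n \<le> L2_norm w" if "w \<in> D (e n)" for n w
    unfolding d_def by (rule cINF_lower[OF bdd that])
  have ne: "D (e n) \<noteq> {}" for n using eventually_happens[OF uD[of n]] by auto
  have d0: "0 \<le> d n" for n unfolding d_def by (rule cINF_greatest[OF ne]) simp
  have \<rho>r: "(\<lambda>k. L2_norm (u (r k))) \<longlonglongrightarrow> \<rho>" using LIMSEQ_subseq_LIMSEQ[OF \<rho> r] by (simp add: o_def)
  have d_\<rho>: "d n \<le> \<rho>" for n
    by (rule tendsto_lowerbound[OF \<rho>r]) (use uD[of n] d_le in \<open>auto elim: eventually_mono\<close>)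
  have "incseq d"
    unfolding d_def by (intro monoI cINF_superset_mono ne bdd D_mono e_dec) auto
  then obtain d' where d': "d \<longlonglongrightarrow> d'"
    using incseq_convergent[of d \<rho>] d_\<rho> by blast
  have "\<exists>w\<in>D (e n). L2_norm w < d n + e n" for n
    using cInf_lessD[of "L2_norm ` D (e n)" "d n + e n"] ne[of n] e0[of n] by (auto simp: d_def)
  then obtain v where vD: "\<And>n. v n \<in> D (e n)" and v_lt: "\<And>n. L2_norm (v n) < d n + e n" by metis
  have v: "v n \<in> L2_controls" for n using vD[of n] by (simp add: D_def)
  have close: "(L2_norm (\<lambda>s. v n s - v m s))\<^sup>2 \<le> 2 * (d n + e n)\<^sup>2 + 2 * (d m + e m)\<^sup>2 - 4 * (d m)\<^sup>2" if mn: "m \<le> n" for m n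
  proof -
    let ?h = "\<lambda>s. (1/2) *\<^sub>R (v n s + v m s)"
    have s: "(\<lambda>s. v n s + v m s) \<in> L2_controls" by (rule L2_controls_add[OF v v])
    have "?h \<in> D (e m)"
      unfolding D_def
    proof (safe)
      show "?h \<in> L2_controls" by (rule L2_controls_scaleR[OF s])
      fix t :: real assume t: "t \<in> {0..1}"
      then have sub: "{0..t} \<subseteq> {0..1}" by auto
      have "integral {0..t} ?h = (1/2) *\<^sub>R (integral {0..t} (v n) + integral {0..t} (v m))"
        using L2_controls_integrable_on(1)[OF v sub]
        by (simp add: Henstock_Kurzweil_Integration.integral_add)
      then have "integral {0..t} ?h - g t = (1/2) *\<^sub>R ((integral {0..t} (v n) - g t) + (integral {0..t} (v m) - g t))"
        by (simp add: algebra_simps scaleR_2[symmetric])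
      then have "norm (integral {0..t} ?h - g t) = (1/2) * norm ((integral {0..t} (v n) - g t) + (integral {0..t} (v m) - g t))"
        by simp
      also have "\<dots> \<le> (1/2) * (e n + e m)"
        using vD[of n] vD[of m] t by (intro mult_left_mono norm_triangle_mono) (auto simp: D_def)
      also have "\<dots> \<le> e m" using e_dec[OF mn] by simp
      finally show "norm (integral {0..t} ?h - g t) \<le> e m" .
    qed
    then have "d m \<le> L2_norm ?h" by (rule d_le)
    also have "\<dots> = 1/2 * L2_norm (\<lambda>s. v n s + v m s)" using L2_norm_scaleR[OF s, of "1/2"] by simp
    finally have "(2 * d m)\<^sup>2 \<le> (L2_norm (\<lambda>s. v n s + v m s))\<^sup>2" using d0 by (intro power_mono) auto
    moreover have "(L2_norm (v n))\<^sup>2 \<le> (d n + e n)\<^sup>2" "(L2_norm (v m))\<^sup>2 \<le> (d m + e m)\<^sup>2"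
      using v_lt[of n] v_lt[of m] by (auto intro!: power_mono)
    ultimately show ?thesis using L2_parallelogram[OF v[of n] v[of m]] by (simp add: power_mult_distrib)
  qed
  have "\<exists>N. \<forall>m n. N \<le> m \<and> m \<le> n \<longrightarrow> L2_norm (\<lambda>s. v n s - v m s) \<le> (1/2)^j" for j :: nat
  proof -
    define \<epsilon> where "\<epsilon> = ((1/2::real)^j)\<^sup>2 / 8"
    have \<epsilon>: "\<epsilon> > 0" by (simp add: \<epsilon>_def)
    have "(\<lambda>n. (d n + e n)\<^sup>2) \<longlonglongrightarrow> (d' + 0)\<^sup>2" by (intro tendsto_intros d' e_lim)
    then have "\<forall>\<^sub>F n in sequentially. (d n + e n)\<^sup>2 < d'\<^sup>2 + \<epsilon>" using \<epsilon> by (intro order_tendstoD(2)) auto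
    moreover have "(\<lambda>n. (d n)\<^sup>2) \<longlonglongrightarrow> d'\<^sup>2" by (intro tendsto_intros d')
    then have "\<forall>\<^sub>F n in sequentially. d'\<^sup>2 - \<epsilon> < (d n)\<^sup>2" using \<epsilon> by (intro order_tendstoD(1)) auto
    ultimately have "\<forall>\<^sub>F n in sequentially. (d n + e n)\<^sup>2 < d'\<^sup>2 + \<epsilon> \<and> d'\<^sup>2 - \<epsilon> < (d n)\<^sup>2" by (rule eventually_conj)
    then obtain N where N: "\<And>n. N \<le> n \<Longrightarrow> (d n + e n)\<^sup>2 < d'\<^sup>2 + \<epsilon> \<and> d'\<^sup>2 - \<epsilon> < (d n)\<^sup>2"
      by (auto simp: eventually_sequentially)
    show ?thesis
    proof (intro exI allI impI)
      fix m n assume mn: "N \<le> m \<and> m \<le> n"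
      have "(L2_norm (\<lambda>s. v n s - v m s))\<^sup>2 \<le> 8 * \<epsilon>"
        using close[of m n] N[of m] N[of n] mn by auto
      then have "(L2_norm (\<lambda>s. v n s - v m s))\<^sup>2 \<le> ((1/2)^j)\<^sup>2" by (simp add: \<epsilon>_def)
      then show "L2_norm (\<lambda>s. v n s - v m s) \<le> (1/2)^j" by (rule power2_le_imp_le) simp
    qed
  qed
  then obtain N where N: "\<And>j m n. \<lbrakk>N j \<le> m; m \<le> n\<rbrakk> \<Longrightarrow> L2_norm (\<lambda>s. v n s - v m s) \<le> (1/2)^j" by metis
  define k where "k = (\<lambda>j. j + (\<Sum>i\<le>j. N i))"
  have kN: "N j \<le> k j" for j unfolding k_def by (rule trans_le_add2) (rule member_le_sum, auto)
  have kmono: "k i \<le> k j" if "i \<le> j" for i j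
    unfolding k_def using that by (intro add_mono sum_mono2) auto
  have kj: "j \<le> k j" for j by (simp add: k_def)
  define w where "w = (\<lambda>j. v (k j))"
  have w: "w j \<in> L2_controls" for j by (simp add: w_def v)
  have wc: "L2_norm (\<lambda>s. w j s - w i s) \<le> (1/2)^i" if "i \<le> j" for i j
    unfolding w_def using N[OF kN kmono[OF that]] .
  have conv: "AE s in lebesgue_on {0..1}. convergent (\<lambda>j. w j s)"
    by (rule L2_fast_Cauchy_imp_AE_convergent[OF w]) (rule wc, simp)
  define f where "f = (\<lambda>s. lim (\<lambda>j. w j s))"
  have f_meas: "f \<in> borel_measurable (lebesgue_on {0..1})"
    unfolding f_def by (intro borel_measurable_lim_metric L2_controls_measurable w)
  have w_lim: "AE s in lebesgue_on {0..1}. (\<lambda>j. w (j + i) s) \<longlonglongrightarrow> f s" for i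
    using conv by eventually_elim (auto simp: f_def convergent_LIMSEQ_iff intro: LIMSEQ_ignore_initial_segment)
  have w_le: "L2_norm (w (j + i)) \<le> \<rho> + e i" for i j
  proof -
    have "L2_norm (w (j + i)) \<le> d (k (j + i)) + e (k (j + i))" using v_lt[of "k (j + i)"] by (simp add: w_def)
    also have "\<dots> \<le> \<rho> + e i" using kj[of "j + i"] by (intro add_mono d_\<rho> e_dec) simp
    finally show ?thesis .
  qed
  have f: "f \<in> L2_controls" by (rule L2_Fatou(1)[OF w w_le f_meas w_lim[of 0]])
  have f_le: "L2_norm f \<le> \<rho> + e i" for i by (rule L2_Fatou(2)[OF w w_le f_meas w_lim])
  have f_\<rho>: "L2_norm f \<le> \<rho>"
  proof (rule tendsto_lowerbound)
    show "(\<lambda>i. \<rho> + e i) \<longlonglongrightarrow> \<rho>" using tendsto_add[OF tendsto_const e_lim, of \<rho>] by simp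
  qed (use f_le in auto)
  have fw: "L2_norm (\<lambda>s. f s - w i s) \<le> (1/2)^i" for i
  proof (rule L2_Fatou(2))
    show "(\<lambda>s. w (j + i) s - w i s) \<in> L2_controls" for j by (rule L2_controls_diff[OF w w])
    show "L2_norm (\<lambda>s. w (j + i) s - w i s) \<le> (1/2)^i" for j by (rule wc) simp
    show "(\<lambda>s. f s - w i s) \<in> borel_measurable (lebesgue_on {0..1})"
      using f_meas L2_controls_measurable[OF w] by measurable
    show "AE s in lebesgue_on {0..1}. (\<lambda>j. w (j + i) s - w i s) \<longlonglongrightarrow> f s - w i s"
      using w_lim[of i] by eventually_elim (intro tendsto_intros)
  qed
  have fg: "integral {0..t} f = g t" if t: "t \<in> {0..1}" for t
  proof -
    have le: "norm (integral {0..t} f - g t) \<le> 2 * e i" for i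
    proof -
      have "norm (integral {0..t} f - integral {0..t} (w i)) \<le> e i"
        unfolding e_def by (rule order_trans[OF L2_integral_norm_diff_le[OF f w t] fw])
      moreover have "norm (integral {0..t} (w i) - g t) \<le> e i"
      proof -
        have "norm (integral {0..t} (w i) - g t) \<le> e (k i)" using vD[of "k i"] t by (simp add: D_def w_def)
        also have "\<dots> \<le> e i" by (rule e_dec[OF kj])
        finally show ?thesis .
      qed
      ultimately show ?thesis using norm_triangle_ineq[of "integral {0..t} f - integral {0..t} (w i)" "integral {0..t} (w i) - g t"] by simp
    qed
    have "(\<lambda>i. 2 * e i) \<longlonglongrightarrow> 2 * 0" by (intro tendsto_intros e_lim)
    then have "norm (integral {0..t} f - g t) \<le> 2 * 0"
      by (rule tendsto_lowerbound) (use le in auto)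
    then show ?thesis by simp
  qed
  show thesis
  proof (rule that[OF r f f_\<rho>])
    fix \<delta> :: real assume "0 < \<delta>"
    then obtain n0 where n0: "\<And>n t. n \<ge> n0 \<and> t \<in> {0..1} \<Longrightarrow> norm (U (r n) t - g t) < \<delta>"
      using g by blast
    have "norm (integral {0..t} (\<lambda>s. u (r n) s - f s)) \<le> \<delta>" if "n \<ge> n0" "t \<in> {0..1}" for n t
    proof -
      have sub: "{0..t} \<subseteq> {0..1}" using that by auto
      have "integral {0..t} (\<lambda>s. u (r n) s - f s) = U (r n) t - g t"
        unfolding U_def fg[OF that(2), symmetric]
        by (rule Henstock_Kurzweil_Integration.integral_diff)
           (rule L2_controls_integrable_on(1)[OF u sub], rule L2_controls_integrable_on(1)[OF f sub])
      then show ?thesis using n0[of n t] that by simp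
    qed
    then show "\<forall>\<^sub>F k in sequentially. \<forall>t\<in>{0..1}. norm (integral {0..t} (\<lambda>s. u (r k) s - f s)) \<le> \<delta>"
      unfolding eventually_sequentially by blast
  qed
qed

section \<open>Measures on a compact set and the Wasserstein distance\<close>

lemma borel_prob_on_AE:
  assumes "borel_prob_on K \<nu>" shows "AE y in \<nu>. y \<in> K"
  using assms prob_space.AE_prob_1 by (auto simp: borel_prob_on_def)

lemma borel_prob_on_integrable:
  fixes g :: "'a::euclidean_space \<Rightarrow> real"
  assumes K: "compact K" and \<nu>: "borel_prob_on K \<nu>" and g: "continuous_on UNIV g"
  shows "integrable \<nu> g"
proof -
  interpret prob_space \<nu> using \<nu> by (simp add: borel_prob_on_def)
  have "bounded (g ` K)"
    using K g by (intro compact_imp_bounded compact_continuous_image) (auto intro: continuous_on_subset)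
  then obtain B where B: "\<And>y. y \<in> K \<Longrightarrow> norm (g y) \<le> B" by (auto simp: bounded_iff)
  have "AE y in \<nu>. norm (g y) \<le> B"
    using borel_prob_on_AE[OF \<nu>] by eventually_elim (rule B)
  moreover have "g \<in> borel_measurable \<nu>"
    using borel_measurable_continuous_onI[OF g] \<nu> measurable_cong_sets[of \<nu> borel borel borel]
    by (auto simp: borel_prob_on_def)
  ultimately show ?thesis by (intro integrable_const_bound)
qed

lemma borel_prob_on_set_integral:
  fixes g :: "'a::euclidean_space \<Rightarrow> real"
  assumes K: "compact K" and \<nu>: "borel_prob_on K \<nu>" and g: "continuous_on UNIV g"
  shows "(LINT y:K|\<nu>. g y) = (LINT y|\<nu>. g y)"
  unfolding set_lebesgue_integral_def
proof (rule integral_cong_AE)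
  have gm: "g \<in> borel_measurable \<nu>" using borel_prob_on_integrable[OF K \<nu> g] by auto
  have "K \<in> sets \<nu>" using \<nu> K by (auto simp: borel_prob_on_def intro: borel_compact)
  then show "(\<lambda>y. indicat_real K y *\<^sub>R g y) \<in> borel_measurable \<nu>" using gm by measurable
  show "AE y in \<nu>. indicat_real K y *\<^sub>R g y = g y"
    using borel_prob_on_AE[OF \<nu>] by eventually_elim simp
qed (use borel_prob_on_integrable[OF K \<nu> g] in auto)

lemma borel_prob_on_integral_mono:
  fixes f g :: "'a::euclidean_space \<Rightarrow> real"
  assumes K: "compact K" and \<nu>: "borel_prob_on K \<nu>" and f: "continuous_on UNIV f" and g: "continuous_on UNIV g"
    and le: "\<And>y. y \<in> K \<Longrightarrow> f y \<le> g y"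
  shows "(LINT y|\<nu>. f y) \<le> (LINT y|\<nu>. g y)"
  by (rule integral_mono_AE[OF borel_prob_on_integrable[OF K \<nu> f] borel_prob_on_integrable[OF K \<nu> g]])
     (use borel_prob_on_AE[OF \<nu>] in \<open>eventually_elim\<close>, rule le)

lemma borel_prob_on_empirical_measure:
  fixes p :: "nat \<Rightarrow> 'a::euclidean_space"
  assumes M: "M \<ge> 1" and p: "p ` {1..M} \<subseteq> K" and K: "compact K"
  shows "borel_prob_on K (empirical_measure M p)"
proof -
  interpret U: prob_space "uniform_count_measure {1..M}"
    using M by (intro prob_space_uniform_count_measure) auto
  have pm: "p \<in> measurable (uniform_count_measure {1..M}) borel"
    by (auto simp: measurable_def space_uniform_count_measure sets_uniform_count_measure)
  have E: "prob_space (empirical_measure M p)"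
    unfolding empirical_measure_def by (rule U.prob_space_distr[OF pm])
  have "measure (empirical_measure M p) K = measure (uniform_count_measure {1..M}) (p -` K \<inter> {1..M})"
    unfolding empirical_measure_def
    using K by (subst measure_distr[OF pm]) (auto simp: space_uniform_count_measure borel_compact)
  also have "p -` K \<inter> {1..M} = space (uniform_count_measure {1..M})"
    using p by (auto simp: space_uniform_count_measure)
  finally show ?thesis
    using E U.prob_space by (simp add: borel_prob_on_def empirical_measure_def)
qed

text \<open>The product measure is a coupling; otherwise the infimum defining \<open>W1\<close> would be over an empty set.\<close>

lemma couplings_nonempty:
  fixes \<nu>1 \<nu>2 :: "'a::euclidean_space measure"
  assumes K: "compact K" and \<nu>1: "borel_prob_on K \<nu>1" and \<nu>2: "borel_prob_on K \<nu>2"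
  shows "couplings K \<nu>1 \<nu>2 \<noteq> {}"
proof -
  interpret P1: prob_space \<nu>1 using \<nu>1 by (simp add: borel_prob_on_def)
  interpret P2: prob_space \<nu>2 using \<nu>2 by (simp add: borel_prob_on_def)
  interpret P: pair_prob_space \<nu>1 \<nu>2 ..
  let ?P = "\<nu>1 \<Otimes>\<^sub>M \<nu>2"
  have s1 [measurable_cong]: "sets \<nu>1 = sets borel" and s2 [measurable_cong]: "sets \<nu>2 = sets borel"
    using \<nu>1 \<nu>2 by (auto simp: borel_prob_on_def)
  have sp: "space \<nu>1 = UNIV" "space \<nu>2 = UNIV" using sets_eq_imp_space_eq[OF s1] sets_eq_imp_space_eq[OF s2] by simp_all
  have sP: "sets ?P = sets borel"
    by (simp only: sets_pair_measure_cong[OF s1 s2] borel_prod)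
  have Kb: "K \<in> sets borel" using K by (rule borel_compact)
  have times: "emeasure ?P (A \<times> B) = emeasure \<nu>1 A * emeasure \<nu>2 B" if "A \<in> sets borel" "B \<in> sets borel" for A B
    using that s1 s2 by (intro P2.emeasure_pair_measure_Times) auto
  have "emeasure ?P (K \<times> K) = 1"
    using times[OF Kb Kb] \<nu>1 \<nu>2 by (simp add: borel_prob_on_def P1.emeasure_eq_measure P2.emeasure_eq_measure)
  then have "measure ?P (K \<times> K) = 1" by (simp add: measure_def)
  then have on: "borel_prob_on (K \<times> K) ?P"
    using sP P.prob_space_axioms by (simp add: borel_prob_on_def)
  have f1: "fst \<in> measurable ?P borel" using measurable_fst[of \<nu>1 \<nu>2] measurable_cong_sets[OF refl s1] by blast
  have f2: "snd \<in> measurable ?P borel" using measurable_snd[of \<nu>1 \<nu>2] measurable_cong_sets[OF refl s2] by blast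
  have d1: "distr ?P borel fst = \<nu>1"
  proof (rule measure_eqI)
    fix A assume "A \<in> sets (distr ?P borel fst)"
    then have A: "A \<in> sets borel" by simp
    have "emeasure (distr ?P borel fst) A = emeasure ?P (fst -` A \<inter> space ?P)"
      by (rule emeasure_distr[OF f1 A])
    also have "fst -` A \<inter> space ?P = A \<times> UNIV" by (auto simp: space_pair_measure sp)
    finally show "emeasure (distr ?P borel fst) A = emeasure \<nu>1 A"
      using times[OF A, of UNIV] P2.emeasure_space_1 sp by simp
  qed (simp add: s1)
  have d2: "distr ?P borel snd = \<nu>2"
  proof (rule measure_eqI)
    fix A assume "A \<in> sets (distr ?P borel snd)"
    then have A: "A \<in> sets borel" by simp
    have "emeasure (distr ?P borel snd) A = emeasure ?P (snd -` A \<inter> space ?P)"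
      by (rule emeasure_distr[OF f2 A])
    also have "snd -` A \<inter> space ?P = UNIV \<times> A" by (auto simp: space_pair_measure sp)
    finally show "emeasure (distr ?P borel snd) A = emeasure \<nu>2 A"
      using times[of UNIV A] A P1.emeasure_space_1 sp by simp
  qed (simp add: s2)
  show ?thesis using on d1 d2 by (auto simp: couplings_def)
qed

lemma W1_nonneg:
  fixes \<nu>1 \<nu>2 :: "'a::euclidean_space measure"
  assumes "compact K" "borel_prob_on K \<nu>1" "borel_prob_on K \<nu>2"
  shows "0 \<le> W1 K \<nu>1 \<nu>2"
  unfolding W1_def
  by (rule cINF_greatest[OF couplings_nonempty[OF assms]])
     (auto simp: set_lebesgue_integral_def intro!: integral_nonneg_AE)

text \<open>The easy half of Kantorovich duality.\<close>

lemma lipschitz_integral_le_W1: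
  fixes g :: "'a::euclidean_space \<Rightarrow> real"
  assumes K: "compact K" and \<nu>1: "borel_prob_on K \<nu>1" and \<nu>2: "borel_prob_on K \<nu>2"
    and g: "C-lipschitz_on UNIV g"
  shows "(LINT y|\<nu>2. g y) \<le> (LINT y|\<nu>1. g y) + C * W1 K \<nu>1 \<nu>2"
proof -
  have C: "0 \<le> C" using g by (rule lipschitz_on_nonneg)
  have gc: "continuous_on UNIV g" by (rule lipschitz_on_continuous_on[OF g])
  let ?I = "\<lambda>\<pi>. LINT z:(K \<times> K)|\<pi>. norm (fst z - snd z)"
  have le: "(LINT y|\<nu>2. g y) - (LINT y|\<nu>1. g y) \<le> C * ?I \<pi>" if \<pi>: "\<pi> \<in> couplings K \<nu>1 \<nu>2" for \<pi>
  proof -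
    have on: "borel_prob_on (K \<times> K) \<pi>" and d1: "distr \<pi> borel fst = \<nu>1" and d2: "distr \<pi> borel snd = \<nu>2"
      using \<pi> by (auto simp: couplings_def)
    have s [measurable_cong]: "sets \<pi> = sets borel" using on by (simp add: borel_prob_on_def)
    have KK: "compact (K \<times> K)" using K by (rule compact_Times[OF _ K])
    have gm: "g \<in> borel_measurable borel" by (rule borel_measurable_continuous_onI[OF gc])
    have fm: "fst \<in> measurable \<pi> (borel :: 'a measure)" "snd \<in> measurable \<pi> (borel :: 'a measure)"
      using s by (auto simp: measurable_cong_sets[OF s refl] borel_prod[symmetric])
    have c1: "continuous_on UNIV (\<lambda>z::'a\<times>'a. g (fst z))" and c2: "continuous_on UNIV (\<lambda>z::'a\<times>'a. g (snd z))"
      by (auto intro!: continuous_on_compose2[OF gc] continuous_intros)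
    have cn: "continuous_on UNIV (\<lambda>z::'a\<times>'a. C * norm (fst z - snd z))" "continuous_on UNIV (\<lambda>z::'a\<times>'a. norm (fst z - snd z))"
      by (intro continuous_intros)+
    have "(LINT y|\<nu>2. g y) - (LINT y|\<nu>1. g y) = (LINT z|\<pi>. g (snd z)) - (LINT z|\<pi>. g (fst z))"
      using integral_distr[OF fm(1) gm] integral_distr[OF fm(2) gm] d1 d2 by simp
    also have "\<dots> = (LINT z|\<pi>. g (snd z) - g (fst z))"
      by (rule Bochner_Integration.integral_diff[symmetric]; rule borel_prob_on_integrable[OF KK on]) (rule c2, rule c1)
    also have "\<dots> \<le> (LINT z|\<pi>. C * norm (fst z - snd z))"
    proof (rule borel_prob_on_integral_mono[OF KK on _ cn(1)])
      show "continuous_on UNIV (\<lambda>z::'a\<times>'a. g (snd z) - g (fst z))" by (intro continuous_on_diff c1 c2)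
      show "g (snd z) - g (fst z) \<le> C * norm (fst z - snd z)" for z
        using lipschitz_onD[OF g, of "fst z" "snd z"] by (simp add: dist_norm)
    qed
    also have "\<dots> = C * ?I \<pi>" by (simp add: borel_prob_on_set_integral[OF KK on cn(2)])
    finally show ?thesis .
  qed
  have ne: "couplings K \<nu>1 \<nu>2 \<noteq> {}" by (rule couplings_nonempty[OF K \<nu>1 \<nu>2])
  show ?thesis
  proof (cases "C = 0")
    case True
    then show ?thesis using le ne by auto
  next
    case False
    with C have C': "C > 0" by simp
    have "((LINT y|\<nu>2. g y) - (LINT y|\<nu>1. g y)) / C \<le> W1 K \<nu>1 \<nu>2"
      unfolding W1_def by (rule cINF_greatest[OF ne]) (use le C' in \<open>simp add: field_simps\<close>)
    then show ?thesis using C' by (simp add: field_simps)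
  qed
qed

text \<open>Outside the compact set \<open>K\<close> the function may be truncated, which makes it bounded without changing the integrals.\<close>

lemma weakly_converges_continuous:
  fixes g :: "'a::euclidean_space \<Rightarrow> real"
  assumes K: "compact K" and \<nu>: "\<And>k. borel_prob_on K (\<nu> k)" and \<mu>: "borel_prob_on K \<mu>"
    and conv: "weakly_converges \<nu> \<mu>" and g: "continuous_on UNIV g"
  shows "(\<lambda>k. LINT y|\<nu> k. g y) \<longlonglongrightarrow> (LINT y|\<mu>. g y)"
proof -
  have "bounded (g ` K)"
    using K g by (intro compact_imp_bounded compact_continuous_image) (auto intro: continuous_on_subset)
  then obtain B where B: "\<And>y. y \<in> K \<Longrightarrow> \<bar>g y\<bar> \<le> B" by (auto simp: bounded_iff)
  define g' where "g' = (\<lambda>y. max (-B) (min B (g y)))"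
  have g': "continuous_on UNIV g'" unfolding g'_def by (intro continuous_intros g)
  have eq: "g' y = g y" if "y \<in> K" for y using B[OF that] by (auto simp: g'_def)
  have "bounded (range g')" by (rule boundedI[of _ "\<bar>B\<bar>"]) (auto simp: g'_def)
  with conv g' have "(\<lambda>k. LINT y|\<nu> k. g' y) \<longlonglongrightarrow> (LINT y|\<mu>. g' y)"
    unfolding weakly_converges_def by blast
  moreover have "(LINT y|\<nu>'. g' y) = (LINT y|\<nu>'. g y)" if "borel_prob_on K \<nu>'" for \<nu>'
    using borel_prob_on_integral_mono[OF K that g' g] borel_prob_on_integral_mono[OF K that g g'] eq
    by (intro antisym) auto
  ultimately show ?thesis using \<nu> \<mu> by simp
qed

section \<open>Minimizers and their limits\<close>

lemma minimizers_iff: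
  "u \<in> minimizers F \<Psi> a \<beta> \<nu> \<longleftrightarrow>
    u \<in> L2_controls \<and> (\<forall>w\<in>L2_controls. cost F \<Psi> a \<beta> \<nu> u \<le> cost F \<Psi> a \<beta> \<nu> w)"
  by (auto simp: minimizers_def is_arg_min_linorder)

lemma (in bounded_lipschitz_fields) flow_sequentially_compact:
  assumes u: "\<And>k. u k \<in> L2_controls" and \<rho>: "(\<lambda>k. L2_norm (u k)) \<longlonglongrightarrow> \<rho>"
  obtains v r where "strict_mono (r :: nat \<Rightarrow> nat)" "v \<in> L2_controls" "L2_norm v \<le> \<rho>"
    "\<And>\<epsilon>. 0 < \<epsilon> \<Longrightarrow> \<forall>\<^sub>F k in sequentially. \<forall>y. norm (flow F (u (r k)) y - flow F v y) \<le> \<epsilon>"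
proof -
  obtain v r where r: "strict_mono (r :: nat \<Rightarrow> nat)" and v: "v \<in> L2_controls" "L2_norm v \<le> \<rho>"
    and weak: "\<And>\<delta>. 0 < \<delta> \<Longrightarrow> \<forall>\<^sub>F k in sequentially. \<forall>t\<in>{0..1}. norm (integral {0..t} (\<lambda>s. u (r k) s - v s)) \<le> \<delta>"
    by (rule L2_weakly_compact[OF u \<rho>]) blast
  obtain R0 where R0: "\<And>k. norm (L2_norm (u k)) \<le> R0"
    using convergent_imp_Bseq[OF convergentI[OF \<rho>]] by (auto simp: Bseq_def)
  have R1: "L2_norm (u k) \<le> max R0 \<rho>" for k using R0[of k] by simp
  show thesis
  proof (rule that[OF r v])
    fix \<epsilon> :: real assume "0 < \<epsilon>"
    then obtain \<delta> where \<delta>: "0 < \<delta>" and close: "\<And>u v x0. \<lbrakk>u \<in> L2_controls; v \<in> L2_controls; L2_norm u \<le> max R0 \<rho>; L2_norm v \<le> max R0 \<rho>;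
       \<And>t. t \<in> {0..1} \<Longrightarrow> norm (integral {0..t} (\<lambda>s. u s - v s)) \<le> \<delta>\<rbrakk>
       \<Longrightarrow> norm (flow F u x0 - flow F v x0) \<le> \<epsilon>"
      by (rule flow_weakly_continuous[where R="max R0 \<rho>"]) blast
    show "\<forall>\<^sub>F k in sequentially. \<forall>y. norm (flow F (u (r k)) y - flow F v y) \<le> \<epsilon>"
      using weak[OF \<delta>] by eventually_elim (use u v R1 in \<open>auto intro!: close\<close>)
  qed
qed

locale approximation_problem = bounded_lipschitz_fields F B L
  for F :: "'l::finite \<Rightarrow> real^'n \<Rightarrow> real^'n" and B L :: real +
  fixes \<Psi> :: "real^'n \<Rightarrow> real^'n" and a :: "real^'n \<Rightarrow> real" and L\<^sub>\<Psi> L\<^sub>a \<beta> :: real and K :: "(real^'n) set"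
  assumes \<Psi>_lipschitz: "L\<^sub>\<Psi>-lipschitz_on UNIV \<Psi>"
    and a_nonneg: "0 \<le> a y" and a_lipschitz: "L\<^sub>a-lipschitz_on UNIV a"
    and a_differentiable: "a differentiable at y"
    and \<beta>_pos: "0 < \<beta>" and K_compact: "compact K"
begin

definition error :: "(real \<Rightarrow> real^'l) \<Rightarrow> real^'n \<Rightarrow> real" where
  "error u y = a (flow F u y - \<Psi> y)"

definition mean_error :: "(real^'n) measure \<Rightarrow> (real \<Rightarrow> real^'l) \<Rightarrow> real" where
  "mean_error \<nu> u = (LINT y|\<nu>. error u y)"

abbreviation "J \<equiv> cost F \<Psi> a \<beta>"

lemma cost_eq: "J \<nu> u = mean_error \<nu> u + \<beta> / 2 * (L2_norm u)\<^sup>2"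
  by (simp add: cost_def mean_error_def error_def)

lemma L_nonneg': "0 \<le> L\<^sub>a" "0 \<le> L\<^sub>\<Psi>"
  using a_lipschitz \<Psi>_lipschitz lipschitz_on_nonneg by blast+

lemma error_nonneg: "0 \<le> error u y" by (simp add: error_def a_nonneg)

lemma mean_error_nonneg: "0 \<le> mean_error \<nu> u"
  unfolding mean_error_def by (intro integral_nonneg_AE) (simp add: error_nonneg)

lemma error_diff_le: "\<bar>error u y - error v y\<bar> \<le> L\<^sub>a * norm (flow F u y - flow F v y)"
  using lipschitz_onD[OF a_lipschitz, of "flow F u y - \<Psi> y" "flow F v y - \<Psi> y"]
  by (simp add: error_def dist_norm)

lemma error_lipschitz:
  assumes "E-lipschitz_on UNIV (flow F u)"
  shows "(L\<^sub>a * (L\<^sub>\<Psi> + E))-lipschitz_on UNIV (error u)"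
proof -
  have "(E + L\<^sub>\<Psi>)-lipschitz_on UNIV (\<lambda>y. flow F u y - \<Psi> y)"
    by (rule lipschitz_on_diff[OF assms \<Psi>_lipschitz])
  from lipschitz_on_compose2[OF this lipschitz_on_subset[OF a_lipschitz subset_UNIV]]
  show ?thesis by (simp add: error_def[abs_def] add.commute)
qed

lemma flow_lipschitz_on:
  assumes "u \<in> L2_controls"
  shows "(sqrt 2 * exp (\<Lambda>\<^sup>2 * (L2_norm u)\<^sup>2))-lipschitz_on UNIV (flow F u)"
  by (rule lipschitz_onI) (auto simp: dist_norm intro: flow_lipschitz[OF assms])

lemma error_continuous:
  assumes "u \<in> L2_controls" shows "continuous_on UNIV (error u)"
  by (rule lipschitz_on_continuous_on[OF error_lipschitz[OF flow_lipschitz_on[OF assms]]])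

text \<open>The cost of the zero control on any probability measure on \<open>K\<close>, and hence the minimal cost, is at most this number.\<close>

definition error_bound :: real where "error_bound = (SUP y\<in>K. error (\<lambda>s. 0) y)"

lemma error_zero_le_bound: "y \<in> K \<Longrightarrow> error (\<lambda>s. 0) y \<le> error_bound"
proof -
  have "bounded (error (\<lambda>s. 0) ` K)"
    using K_compact error_continuous[OF L2_controls_zero]
    by (intro compact_imp_bounded compact_continuous_image) (auto intro: continuous_on_subset)
  then show "y \<in> K \<Longrightarrow> error (\<lambda>s. 0) y \<le> error_bound"
    unfolding error_bound_def by (intro cSUP_upper bounded_imp_bdd_above)
qed

lemma cost_zero_le_bound:
  assumes "borel_prob_on K \<nu>" shows "J \<nu> (\<lambda>s. 0) \<le> error_bound"
proof -
  interpret prob_space \<nu> using assms by (simp add: borel_prob_on_def)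
  have "mean_error \<nu> (\<lambda>s. 0) \<le> (LINT y|\<nu>. error_bound)"
    unfolding mean_error_def
    by (rule borel_prob_on_integral_mono[OF K_compact assms])
       (auto intro: error_continuous L2_controls_zero error_zero_le_bound)
  then show ?thesis by (simp add: cost_eq L2_norm_zero prob_space)
qed

definition control_bound :: real where "control_bound = sqrt (2 * error_bound / \<beta>)"

lemma minimizer_bounds:
  assumes \<nu>: "borel_prob_on K \<nu>" and u: "u \<in> minimizers F \<Psi> a \<beta> \<nu>"
  shows "L2_norm u \<le> control_bound" "mean_error \<nu> u \<le> error_bound"
proof -
  have "J \<nu> u \<le> J \<nu> (\<lambda>s. 0)" using u L2_controls_zero unfolding minimizers_iff by blast
  then have "J \<nu> u \<le> error_bound" using cost_zero_le_bound[OF \<nu>] by linarith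
  then have le: "mean_error \<nu> u + \<beta> / 2 * (L2_norm u)\<^sup>2 \<le> error_bound" by (simp only: cost_eq)
  then have "\<beta> / 2 * (L2_norm u)\<^sup>2 \<le> error_bound" using mean_error_nonneg[of \<nu> u] by linarith
  then have "(L2_norm u)\<^sup>2 \<le> 2 * error_bound / \<beta>" using \<beta>_pos by (simp add: field_simps)
  then show "L2_norm u \<le> control_bound" unfolding control_bound_def by (rule real_le_rsqrt)
  show "mean_error \<nu> u \<le> error_bound" 
  proof -
    have "0 \<le> \<beta> / 2 * (L2_norm u)\<^sup>2" using \<beta>_pos by simp
    then show ?thesis using le by linarith
  qed
qed

text \<open>
  Uniform convergence of the flows reduces the claim to the fixed integrand \<open>error v\<close>, to which weak convergence of the measures applies.
\<close>

lemma mean_error_convergent: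
  assumes \<nu>: "\<And>k. borel_prob_on K (\<nu> k)" and \<mu>: "borel_prob_on K \<mu>" and conv: "weakly_converges \<nu> \<mu>"
    and u: "\<And>k. u k \<in> L2_controls" and v: "v \<in> L2_controls"
    and close: "\<And>\<epsilon>. 0 < \<epsilon> \<Longrightarrow> \<forall>\<^sub>F k in sequentially. \<forall>y. norm (flow F (u k) y - flow F v y) \<le> \<epsilon>"
  shows "(\<lambda>k. mean_error (\<nu> k) (u k)) \<longlonglongrightarrow> mean_error \<mu> v"
proof -
  have v_lim: "(\<lambda>k. mean_error (\<nu> k) v) \<longlonglongrightarrow> mean_error \<mu> v"
    unfolding mean_error_def
    by (rule weakly_converges_continuous[OF K_compact \<nu> \<mu> conv error_continuous[OF v]])
  have "(\<lambda>k. mean_error (\<nu> k) (u k) - mean_error (\<nu> k) v) \<longlonglongrightarrow> 0"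
  proof (rule tendstoI)
    fix e :: real assume e: "0 < e"
    have "0 < e / (2 * (L\<^sub>a + 1))" using e L_nonneg'(1) by simp
    from close[OF this]
    show "\<forall>\<^sub>F k in sequentially. dist (mean_error (\<nu> k) (u k) - mean_error (\<nu> k) v) 0 < e"
    proof eventually_elim
      case (elim k)
      interpret prob_space "\<nu> k" using \<nu> by (simp add: borel_prob_on_def)
      let ?c = "L\<^sub>a * (e / (2 * (L\<^sub>a + 1)))"
      have iu: "integrable (\<nu> k) (error (u k))" and iv: "integrable (\<nu> k) (error v)"
        by (intro borel_prob_on_integrable[OF K_compact \<nu>] error_continuous u v)+
      have "\<bar>error (u k) y - error v y\<bar> \<le> ?c" for y
        using error_diff_le[of "u k" y v] mult_left_mono[OF elim[rule_format, of y] L_nonneg'(1)] by linarith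
      then have "norm (LINT y|\<nu> k. error (u k) y - error v y) \<le> (LINT y|\<nu> k. ?c)"
        using iu iv by (intro Bochner_Integration.integral_norm_bound_integral) auto
      also have "\<dots> = ?c" by (simp add: prob_space)
      also have "?c < e"
      proof -
        have "L\<^sub>a * e < 2 * (L\<^sub>a + 1) * e"
          using e L_nonneg'(1) by (intro mult_strict_right_mono) auto
        then show ?thesis using L_nonneg'(1) by (simp add: field_simps)
      qed
      finally show ?case using iu iv by (simp add: mean_error_def)
    qed
  qed
  from tendsto_add[OF this v_lim] show ?thesis by simp
qed

text \<open>
  Compactness together with the two halves of \<open>\<Gamma>\<close>-convergence: constant sequences recover the cost of every competitor, and
  weak lower semicontinuity of the norm bounds the cost of the limit from below. The slack \<open>\<eta>\<close> allows minimizing sequences of a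
  single functional as well as exact minimizers of varying functionals.
\<close>

proposition approximate_minimizers_converge:
  assumes \<nu>: "\<And>k. borel_prob_on K (\<nu> k)" and \<mu>: "borel_prob_on K \<mu>" and conv: "weakly_converges \<nu> \<mu>"
    and u: "\<And>k. u k \<in> L2_controls" and \<eta>: "\<eta> \<longlonglongrightarrow> 0"
    and min: "\<And>k w. w \<in> L2_controls \<Longrightarrow> J (\<nu> k) (u k) \<le> J (\<nu> k) w + \<eta> k"
  obtains v r where "strict_mono (r :: nat \<Rightarrow> nat)" "v \<in> minimizers F \<Psi> a \<beta> \<mu>"
    "(\<lambda>k. mean_error (\<nu> (r k)) (u (r k))) \<longlonglongrightarrow> mean_error \<mu> v"
proof -
  obtain H where H: "\<And>k. \<bar>\<eta> k\<bar> \<le> H"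
    using convergent_imp_Bseq[OF convergentI[OF \<eta>]] by (auto simp: Bseq_def)
  have "\<bar>L2_norm (u k)\<bar> \<le> sqrt (2 * (error_bound + H) / \<beta>)" for k
  proof -
    have "mean_error (\<nu> k) (u k) + \<beta> / 2 * (L2_norm (u k))\<^sup>2 \<le> error_bound + H"
      using min[OF L2_controls_zero, of k] cost_zero_le_bound[OF \<nu>, of k] H[of k] by (simp add: cost_eq)
    then have "\<beta> / 2 * (L2_norm (u k))\<^sup>2 \<le> error_bound + H" using mean_error_nonneg[of "\<nu> k" "u k"] by linarith
    then have "(L2_norm (u k))\<^sup>2 \<le> 2 * (error_bound + H) / \<beta>" using \<beta>_pos by (simp add: field_simps)
    then show ?thesis by (simp add: real_le_rsqrt)
  qed
  then have "bounded (range (\<lambda>k. L2_norm (u k)))" by (intro boundedI) auto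
  then obtain \<rho> r1 where r1: "strict_mono (r1 :: nat \<Rightarrow> nat)" and \<rho>: "(\<lambda>k. L2_norm (u (r1 k))) \<longlonglongrightarrow> \<rho>"
    using bounded_imp_convergent_subsequence[of "\<lambda>k. L2_norm (u k)"] by (auto simp: o_def)
  obtain v r2 where r2: "strict_mono (r2 :: nat \<Rightarrow> nat)" and v: "v \<in> L2_controls" "L2_norm v \<le> \<rho>"
    and close: "\<And>\<epsilon>. 0 < \<epsilon> \<Longrightarrow> \<forall>\<^sub>F k in sequentially. \<forall>y. norm (flow F (u (r1 (r2 k))) y - flow F v y) \<le> \<epsilon>"
    by (rule flow_sequentially_compact[of "\<lambda>k. u (r1 k)", OF u \<rho>]) blast
  define r where "r = (\<lambda>k. r1 (r2 k))"
  have r: "strict_mono r" using strict_mono_o[OF r1 r2] by (simp add: r_def o_def)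
  have convr: "weakly_converges (\<lambda>k. \<nu> (r k)) \<mu>"
    using conv LIMSEQ_subseq_LIMSEQ[OF _ r] unfolding weakly_converges_def o_def by blast
  have lim: "(\<lambda>k. mean_error (\<nu> (r k)) (u (r k))) \<longlonglongrightarrow> mean_error \<mu> v"
    by (rule mean_error_convergent[OF \<nu> \<mu> convr u v(1)]) (use close in \<open>simp add: r_def\<close>)
  have \<rho>r: "(\<lambda>k. L2_norm (u (r k))) \<longlonglongrightarrow> \<rho>"
    using LIMSEQ_subseq_LIMSEQ[OF \<rho> r2] by (simp add: r_def o_def)
  have J_lim: "(\<lambda>k. J (\<nu> (r k)) (u (r k))) \<longlonglongrightarrow> mean_error \<mu> v + \<beta> / 2 * \<rho>\<^sup>2"
    unfolding cost_eq by (intro tendsto_intros lim \<rho>r)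
  have "J \<mu> v \<le> J \<mu> w" if w: "w \<in> L2_controls" for w
  proof -
    have "(\<lambda>k. mean_error (\<nu> (r k)) w) \<longlonglongrightarrow> mean_error \<mu> w"
      by (rule mean_error_convergent[OF \<nu> \<mu> convr w w]) simp
    moreover have "(\<lambda>k. \<eta> (r k)) \<longlonglongrightarrow> 0" using LIMSEQ_subseq_LIMSEQ[OF \<eta> r] by (simp add: o_def)
    ultimately have "(\<lambda>k. J (\<nu> (r k)) w + \<eta> (r k)) \<longlonglongrightarrow> J \<mu> w + 0"
      unfolding cost_eq by (intro tendsto_intros)
    then have "mean_error \<mu> v + \<beta> / 2 * \<rho>\<^sup>2 \<le> J \<mu> w + 0"
      using J_lim min[OF w] by (intro LIMSEQ_le) auto
    moreover have "\<beta> / 2 * (L2_norm v)\<^sup>2 \<le> \<beta> / 2 * \<rho>\<^sup>2"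
      using v \<beta>_pos by (intro mult_left_mono power_mono) auto
    ultimately show ?thesis by (simp add: cost_eq)
  qed
  then have "v \<in> minimizers F \<Psi> a \<beta> \<mu>" using v by (simp add: minimizers_iff)
  from that[OF r this lim] show thesis .
qed

lemma minimizers_nonempty:
  assumes \<mu>: "borel_prob_on K \<mu>"
  shows "minimizers F \<Psi> a \<beta> \<mu> \<noteq> {}"
proof -
  define m where "m = (INF w\<in>L2_controls. J \<mu> w)"
  have J0: "0 \<le> J \<mu> w" for w using \<beta>_pos by (simp add: cost_eq mean_error_nonneg)
  have bdd: "bdd_below (J \<mu> ` L2_controls)" by (rule bdd_belowI[of _ 0]) (auto simp: J0)
  have ne: "J \<mu> ` L2_controls \<noteq> {}" using L2_controls_zero by blast
  have "\<exists>w\<in>L2_controls. J \<mu> w < m + 1 / real (Suc k)" for k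
    using cInf_lessD[OF ne, of "m + 1 / real (Suc k)"] by (auto simp: m_def)
  then obtain u where u: "\<And>k. u k \<in> L2_controls" and lt: "\<And>k. J \<mu> (u k) < m + 1 / real (Suc k)" by metis
  obtain v r where "strict_mono (r :: nat \<Rightarrow> nat)" "v \<in> minimizers F \<Psi> a \<beta> \<mu>"
    "(\<lambda>k. mean_error \<mu> (u (r k))) \<longlonglongrightarrow> mean_error \<mu> v"
  proof (rule approximate_minimizers_converge[of "\<lambda>_. \<mu>" \<mu> u "\<lambda>k. 1 / real (Suc k)"])
    show "weakly_converges (\<lambda>_. \<mu>) \<mu>" by (simp add: weakly_converges_def)
    show "(\<lambda>k. 1 / real (Suc k)) \<longlonglongrightarrow> 0" using LIMSEQ_Suc[OF lim_1_over_n] by simp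
    show "J \<mu> (u k) \<le> J \<mu> w + 1 / real (Suc k)" if "w \<in> L2_controls" for k w
      using lt[of k] cINF_lower[OF bdd that] by (simp add: m_def)
  qed (use \<mu> u in auto)
  then show ?thesis by blast
qed

lemma \<kappa>_eq:
  assumes \<mu>: "borel_prob_on K \<mu>"
  shows "\<kappa> F \<Psi> a \<beta> K \<mu> = (SUP u\<in>minimizers F \<Psi> a \<beta> \<mu>. mean_error \<mu> u)"
  unfolding \<kappa>_def mean_error_def
  using borel_prob_on_set_integral[OF K_compact \<mu> error_continuous]
  by (intro SUP_cong refl) (auto simp: minimizers_iff error_def[abs_def])

lemma mean_error_le_\<kappa>:
  assumes \<mu>: "borel_prob_on K \<mu>" and u: "u \<in> minimizers F \<Psi> a \<beta> \<mu>"
  shows "mean_error \<mu> u \<le> \<kappa> F \<Psi> a \<beta> K \<mu>"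
  unfolding \<kappa>_eq[OF \<mu>]
  by (rule cSUP_upper[OF u bdd_aboveI2]) (rule minimizer_bounds(2)[OF \<mu>])


text \<open>
  The competitors \<open>(1 - \<epsilon>) v\<close> have error \<open>o(\<epsilon>)\<close>, by dominated convergence from the pointwise statement, but energy smaller by
  \<open>\<beta> / 2 * (2 * \<epsilon> - \<epsilon>\<^sup>2) * (L2_norm v)\<^sup>2\<close>. Dividing by \<open>\<epsilon>\<close> and letting \<open>\<epsilon>\<close> tend to \<open>0\<close> shows that the energy of \<open>v\<close> is zero.
\<close>

lemma minimizer_with_zero_mean_error:
  assumes \<mu>: "borel_prob_on K \<mu>" and v: "v \<in> minimizers F \<Psi> a \<beta> \<mu>" and A0: "mean_error \<mu> v = 0"
  shows "mean_error \<mu> (\<lambda>s. 0) = 0"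
proof -
  have vL: "v \<in> L2_controls" and min: "\<And>w. w \<in> L2_controls \<Longrightarrow> J \<mu> v \<le> J \<mu> w"
    using v by (auto simp: minimizers_iff)
  define \<epsilon> where "\<epsilon> = (\<lambda>n. 1 / real (Suc n))"
  have \<epsilon>: "0 < \<epsilon> n" for n by (simp add: \<epsilon>_def)
  have \<epsilon>_lim: "\<epsilon> \<longlonglongrightarrow> 0" unfolding \<epsilon>_def using LIMSEQ_Suc[OF lim_1_over_n] by simp
  define w where "w = (\<lambda>n s. (1 - \<epsilon> n) *\<^sub>R v s)"
  have w: "w n \<in> L2_controls" for n unfolding w_def by (rule L2_controls_scaleR[OF vL])
  define q where "q = sqrt 2 * exp (\<Lambda>\<^sup>2 * (L2_norm v)\<^sup>2) * (C * L2_norm v)"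
  have q0: "0 \<le> q" by (simp add: q_def C_nonneg)
  have flow_close: "norm (flow F (w n) y - flow F v y) \<le> q * \<epsilon> n" for n y
  proof -
    have "(\<lambda>s. v s - w n s) = (\<lambda>s. \<epsilon> n *\<^sub>R v s)" by (auto simp: w_def algebra_simps)
    then have "L2_norm (\<lambda>s. v s - w n s) = \<epsilon> n * L2_norm v" using L2_norm_scaleR[OF vL, of "\<epsilon> n"] \<epsilon>[of n] by simp
    then show ?thesis
      using flow_diff_control_le[OF vL w[of n], of y] by (simp add: q_def norm_minus_commute mult_ac)
  qed
  have iv: "integrable \<mu> (error v)" by (rule borel_prob_on_integrable[OF K_compact \<mu> error_continuous[OF vL]])
  have iw: "integrable \<mu> (error (w n))" for n by (rule borel_prob_on_integrable[OF K_compact \<mu> error_continuous[OF w]])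
  have ae: "AE y in \<mu>. error v y = 0"
    using integral_nonneg_eq_0_iff_AE[OF iv] A0 by (simp add: mean_error_def error_nonneg)
  \<comment> \<open>zeros of \<open>a\<close> are minima, so \<open>a\<close> is small compared with the distance to them\<close>
  have small: "(\<lambda>n. error (w n) y / \<epsilon> n) \<longlonglongrightarrow> 0" if y: "error v y = 0" for y
  proof (rule tendstoI)
    fix e :: real assume e: "0 < e"
    let ?z = "flow F v y - \<Psi> y"
    have az: "a ?z = 0" using y by (simp add: error_def)
    obtain a' where a': "(a has_derivative a') (at ?z)" using a_differentiable unfolding differentiable_def by blast
    have "a' = (\<lambda>h. 0)"
      by (rule differential_zero_maxmin[OF _ open_UNIV a']) (auto simp: az a_nonneg)
    with a' have "(a has_derivative (\<lambda>h. 0)) (at ?z)" by simp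
    moreover define e' where "e' = e / (2 * (q + 1))"
    have e': "0 < e'" using e q0 by (simp add: e'_def)
    ultimately obtain d where d: "0 < d" "\<And>z. norm (z - ?z) < d \<Longrightarrow> norm (a z - a ?z - 0) \<le> e' * norm (z - ?z)"
      unfolding has_derivative_at_alt by blast
    have "(\<lambda>n. q * \<epsilon> n) \<longlonglongrightarrow> q * 0" by (intro tendsto_intros \<epsilon>_lim)
    then have "\<forall>\<^sub>F n in sequentially. q * \<epsilon> n < d" using d(1) by (intro order_tendstoD(2)) auto
    then show "\<forall>\<^sub>F n in sequentially. dist (error (w n) y / \<epsilon> n) 0 < e"
    proof eventually_elim
      case (elim n)
      let ?z' = "flow F (w n) y - \<Psi> y"
      have zz: "norm (?z' - ?z) \<le> q * \<epsilon> n" using flow_close[of n y] by simp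
      then have "norm (?z' - ?z) < d" using elim by linarith
      from d(2)[OF this] have "error (w n) y \<le> e' * norm (?z' - ?z)"
        using a_nonneg by (simp add: az error_def)
      also have "\<dots> \<le> e' * (q * \<epsilon> n)" using zz e' by (intro mult_left_mono) auto
      finally have "error (w n) y / \<epsilon> n \<le> e' * q" using \<epsilon>[of n] by (simp add: field_simps)
      also have "e' * q < e"
      proof -
        have "e * q < 2 * (q + 1) * e" using e q0 by (simp add: algebra_simps add_strict_increasing2)
        then show ?thesis using q0 by (simp add: e'_def field_simps)
      qed
      finally show ?case using \<epsilon>[of n] error_nonneg[of "w n" y] by simp
    qed
  qed
  have "(\<lambda>n. LINT y|\<mu>. error (w n) y / \<epsilon> n) \<longlonglongrightarrow> (LINT y|\<mu>. 0)"
  proof (rule integral_dominated_convergence)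
    interpret prob_space \<mu> using \<mu> by (simp add: borel_prob_on_def)
    show "integrable \<mu> (\<lambda>y. L\<^sub>a * q)" by simp
    show "(\<lambda>y. error (w n) y / \<epsilon> n) \<in> borel_measurable \<mu>" for n using iw[of n] by measurable
    show "AE y in \<mu>. (\<lambda>n. error (w n) y / \<epsilon> n) \<longlonglongrightarrow> 0"
      using ae by eventually_elim (rule small)
    show "AE y in \<mu>. norm (error (w n) y / \<epsilon> n) \<le> L\<^sub>a * q" for n
      using ae
    proof eventually_elim
      case (elim y)
      have "\<bar>error (w n) y\<bar> \<le> L\<^sub>a * (q * \<epsilon> n)"
        using error_diff_le[of "w n" y v] mult_left_mono[OF flow_close[of n y] L_nonneg'(1)] elim by simp
      then show ?case using \<epsilon>[of n] by (simp add: field_simps)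
    qed
  qed simp
  then have lim: "(\<lambda>n. mean_error \<mu> (w n) / \<epsilon> n) \<longlonglongrightarrow> 0" by (simp add: mean_error_def)
  have le: "\<beta> / 2 * (2 - \<epsilon> n) * (L2_norm v)\<^sup>2 \<le> mean_error \<mu> (w n) / \<epsilon> n" for n
  proof -
    have "(L2_norm (w n))\<^sup>2 = (1 - \<epsilon> n)\<^sup>2 * (L2_norm v)\<^sup>2"
      using L2_norm_scaleR[OF vL, of "1 - \<epsilon> n"] by (simp add: w_def power_mult_distrib)
    then have "\<beta> / 2 * (L2_norm v)\<^sup>2 \<le> mean_error \<mu> (w n) + \<beta> / 2 * ((1 - \<epsilon> n)\<^sup>2 * (L2_norm v)\<^sup>2)"
      using min[OF w[of n]] A0 by (simp add: cost_eq)
    then have "\<epsilon> n * (\<beta> / 2 * (2 - \<epsilon> n) * (L2_norm v)\<^sup>2) \<le> mean_error \<mu> (w n)"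
      by (simp add: power2_eq_square algebra_simps)
    then show ?thesis using \<epsilon>[of n] by (simp add: pos_le_divide_eq mult.commute)
  qed
  have "(\<lambda>n. \<beta> / 2 * (2 - \<epsilon> n) * (L2_norm v)\<^sup>2) \<longlonglongrightarrow> \<beta> / 2 * (2 - 0) * (L2_norm v)\<^sup>2"
    by (intro tendsto_intros \<epsilon>_lim)
  from LIMSEQ_le[OF this lim] le have "\<beta> * (L2_norm v)\<^sup>2 \<le> 0" by simp
  then have v0: "L2_norm v = 0" using \<beta>_pos by (simp add: mult_le_0_iff)
  have "flow F v y = flow F (\<lambda>s. 0) y" for y
    using flow_diff_control_le[OF vL L2_controls_zero, of y] v0 by simp
  then have "error v = error (\<lambda>s. 0)" by (auto simp: error_def)
  then show ?thesis using A0 by (simp add: mean_error_def)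
qed

text \<open>
  The summand \<open>L\<^sub>\<Psi> + E\<close> comes from passing from the empirical measure to \<open>\<mu>\<close>. The summand \<open>L\<^sub>\<Psi> + 1\<close> is the Lipschitz
  constant of the residual \<open>y \<mapsto> y - \<Psi> y\<close> of the zero control, with which the minimizers are compared when \<open>\<kappa> = 0\<close>.
\<close>

theorem empirical_minimizer_bound:
  fixes x :: "nat \<Rightarrow> nat \<Rightarrow> real^'n"
  assumes \<mu>: "borel_prob_on K \<mu>" and x: "\<And>M. M \<ge> 1 \<Longrightarrow> x M ` {1..M} \<subseteq> K"
    and conv: "weakly_converges (\<lambda>M. empirical_measure M (x M)) \<mu>"
    and E: "\<And>u. u \<in> L2_controls \<Longrightarrow> L2_norm u \<le> control_bound \<Longrightarrow> E-lipschitz_on UNIV (flow F u)"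
    and u: "\<And>M. M \<ge> 1 \<Longrightarrow> u M \<in> minimizers F \<Psi> a \<beta> (empirical_measure M (x M))"
  shows "\<forall>\<^sub>F M in sequentially. mean_error \<mu> (u M)
    \<le> 2 * \<kappa> F \<Psi> a \<beta> K \<mu> + L\<^sub>a * (L\<^sub>\<Psi> + (E + L\<^sub>\<Psi> + 1)) * W1 K (empirical_measure M (x M)) \<mu>"
proof -
  let ?\<nu> = "\<lambda>M. empirical_measure M (x M)"
  let ?\<kappa> = "\<kappa> F \<Psi> a \<beta> K \<mu>"
  have \<nu>: "borel_prob_on K (?\<nu> M)" if "M \<ge> 1" for M
    by (rule borel_prob_on_empirical_measure[OF that x[OF that] K_compact])
  have W: "0 \<le> W1 K (?\<nu> M) \<mu>" if "M \<ge> 1" for M by (rule W1_nonneg[OF K_compact \<nu>[OF that] \<mu>])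
  have uL: "u M \<in> L2_controls" and uR: "L2_norm (u M) \<le> control_bound" if "M \<ge> 1" for M
    using u[OF that] minimizer_bounds(1)[OF \<nu>[OF that] u[OF that]] by (auto simp: minimizers_iff)
  have transfer: "mean_error \<mu> (u M) \<le> mean_error (?\<nu> M) (u M) + L\<^sub>a * (L\<^sub>\<Psi> + E) * W1 K (?\<nu> M) \<mu>" if "M \<ge> 1" for M
    unfolding mean_error_def
    by (rule lipschitz_integral_le_W1[OF K_compact \<nu>[OF that] \<mu> error_lipschitz[OF E[OF uL[OF that] uR[OF that]]]])
  obtain v where v: "v \<in> minimizers F \<Psi> a \<beta> \<mu>" using minimizers_nonempty[OF \<mu>] by blast
  have \<kappa>0: "0 \<le> ?\<kappa>" using mean_error_le_\<kappa>[OF \<mu> v] mean_error_nonneg[of \<mu> v] by linarith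
  show ?thesis
  proof (cases "?\<kappa> = 0")
    case True
    have "mean_error \<mu> v = 0" using mean_error_le_\<kappa>[OF \<mu> v] mean_error_nonneg[of \<mu> v] True by linarith
    then have zero: "mean_error \<mu> (\<lambda>s. 0) = 0" by (rule minimizer_with_zero_mean_error[OF \<mu> v])
    have "1-lipschitz_on UNIV (flow F (\<lambda>s. 0))" by (rule lipschitz_onI) (auto simp: flow_zero)
    then have lip0: "(L\<^sub>a * (L\<^sub>\<Psi> + 1))-lipschitz_on UNIV (\<lambda>y. - error (\<lambda>s. 0) y)"
      using error_lipschitz lipschitz_on_minus by blast
    have "mean_error \<mu> (u M) \<le> 2 * ?\<kappa> + L\<^sub>a * (L\<^sub>\<Psi> + (E + L\<^sub>\<Psi> + 1)) * W1 K (?\<nu> M) \<mu>" if M: "M \<ge> 1" for M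
    proof -
      have "mean_error (?\<nu> M) (\<lambda>s. 0) \<le> L\<^sub>a * (L\<^sub>\<Psi> + 1) * W1 K (?\<nu> M) \<mu>"
        using lipschitz_integral_le_W1[OF K_compact \<nu>[OF M] \<mu> lip0] zero by (simp add: mean_error_def)
      moreover have "J (?\<nu> M) (u M) \<le> J (?\<nu> M) (\<lambda>s. 0)"
        using u[OF M] L2_controls_zero unfolding minimizers_iff by blast
      then have "mean_error (?\<nu> M) (u M) + \<beta> / 2 * (L2_norm (u M))\<^sup>2 \<le> mean_error (?\<nu> M) (\<lambda>s. 0)"
        by (simp add: cost_eq L2_norm_zero)
      moreover have "0 \<le> \<beta> / 2 * (L2_norm (u M))\<^sup>2" using \<beta>_pos by simp
      ultimately have "mean_error \<mu> (u M) \<le> L\<^sub>a * (L\<^sub>\<Psi> + 1) * W1 K (?\<nu> M) \<mu> + L\<^sub>a * (L\<^sub>\<Psi> + E) * W1 K (?\<nu> M) \<mu>"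
        using transfer[OF M] by linarith
      then show ?thesis using True by (simp add: algebra_simps)
    qed
    then show ?thesis by (rule eventually_sequentiallyI)
  next
    case False
    have "\<forall>\<^sub>F M in sequentially. M \<ge> 1 \<longrightarrow> mean_error (?\<nu> M) (u M) \<le> 2 * ?\<kappa>"
    proof (rule ccontr)
      assume "\<not> ?thesis"
      then obtain s where s: "strict_mono (s :: nat \<Rightarrow> nat)" and s1: "\<And>k. s k \<ge> 1"
        and big: "\<And>k. mean_error (?\<nu> (s k)) (u (s k)) > 2 * ?\<kappa>"
        by (auto dest!: not_eventually_sequentiallyD simp: not_le)
      obtain w r where w: "w \<in> minimizers F \<Psi> a \<beta> \<mu>"
        and lim: "(\<lambda>k. mean_error (?\<nu> (s (r k))) (u (s (r k)))) \<longlonglongrightarrow> mean_error \<mu> w"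
      proof (rule approximate_minimizers_converge[of "\<lambda>k. ?\<nu> (s k)" \<mu> "\<lambda>k. u (s k)" "\<lambda>k. 0"])
        show "weakly_converges (\<lambda>k. ?\<nu> (s k)) \<mu>"
          using conv LIMSEQ_subseq_LIMSEQ[OF _ s] unfolding weakly_converges_def o_def by blast
        show "J (?\<nu> (s k)) (u (s k)) \<le> J (?\<nu> (s k)) w + 0" if "w \<in> L2_controls" for k w
          using u[OF s1[of k]] that by (simp add: minimizers_iff)
      qed (use \<nu> s1 uL \<mu> in auto)
      have "2 * ?\<kappa> \<le> mean_error \<mu> w"
        by (rule LIMSEQ_le_const[OF lim]) (use big in \<open>auto intro: less_imp_le\<close>)
      then show False using mean_error_le_\<kappa>[OF \<mu> w] \<kappa>0 False by linarith
    qed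
    then show ?thesis using eventually_ge_at_top[of "1::nat"]
    proof eventually_elim
      case (elim M)
      then have "mean_error \<mu> (u M) \<le> 2 * ?\<kappa> + L\<^sub>a * (L\<^sub>\<Psi> + E) * W1 K (?\<nu> M) \<mu>"
        using transfer[of M] by linarith
      also have "L\<^sub>a * (L\<^sub>\<Psi> + E) * W1 K (?\<nu> M) \<mu> \<le> L\<^sub>a * (L\<^sub>\<Psi> + (E + L\<^sub>\<Psi> + 1)) * W1 K (?\<nu> M) \<mu>"
        using L_nonneg' W[of M] elim by (intro mult_right_mono mult_left_mono) auto
      finally show ?case by simp
    qed
  qed
qed

end

text \<open>Boundedness of the derivative along the basis vectors bounds its operator norm.\<close>

lemma bounded_derivatives_imp_lipschitz:
  fixes f :: "'a::euclidean_space \<Rightarrow> 'b::euclidean_space"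
  assumes "smooth f" "bounded_with_derivatives f"
  obtains B where "0 \<le> B" "\<And>x y. norm (f x - f y) \<le> B * norm (x - y)"
proof -
  have diff: "f differentiable (at x)" for x
    using assms(1) unfolding smooth_on_open_def by (metis UNIV_I iterated_derivative.simps(1))
  have "\<exists>c. \<forall>x. norm (frechet_derivative f (at x) v) \<le> c" for v
  proof -
    have "bounded (range (iterated_derivative [v] f))"
      using assms(2) unfolding bounded_with_derivatives_def by blast
    then show ?thesis by (auto simp: bounded_iff)
  qed
  then obtain c where c: "\<And>v x. norm (frechet_derivative f (at x) v) \<le> c v" by metis
  define B where "B = (\<Sum>e\<in>Basis. c e)"
  have c0: "0 \<le> c v" for v using c[of undefined v] norm_ge_zero order_trans by blast
  have on: "onorm (frechet_derivative f (at x)) \<le> B" for x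
  proof (rule onorm_le)
    fix h
    have lin: "linear (frechet_derivative f (at x))"
      using diff frechet_derivative_works has_derivative_linear by blast
    have "frechet_derivative f (at x) h = frechet_derivative f (at x) (\<Sum>e\<in>Basis. (h \<bullet> e) *\<^sub>R e)"
      by (simp add: euclidean_representation)
    also have "\<dots> = (\<Sum>e\<in>Basis. (h \<bullet> e) *\<^sub>R frechet_derivative f (at x) e)"
      by (simp add: linear_sum[OF lin] linear_scale[OF lin])
    finally have "norm (frechet_derivative f (at x) h) = norm (\<Sum>e\<in>Basis. (h \<bullet> e) *\<^sub>R frechet_derivative f (at x) e)"
      by (rule arg_cong)
    also have "\<dots> \<le> (\<Sum>e\<in>Basis. norm h * c e)"
      by (rule sum_norm_le) (auto intro!: mult_mono c Basis_le_norm)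
    finally show "norm (frechet_derivative f (at x) h) \<le> B * norm h"
      by (simp add: B_def sum_distrib_left[symmetric] mult.commute)
  qed
  show thesis
  proof
    show "0 \<le> B" unfolding B_def by (intro sum_nonneg c0)
    show "norm (f x - f y) \<le> B * norm (x - y)" for x y
    proof (rule differentiable_bound[OF convex_UNIV _ on])
      show "(f has_derivative frechet_derivative f (at z)) (at z)" for z
        using diff frechet_derivative_works by blast
    qed auto
  qed
qed

lemma bounded_lipschitz_fields_exist:
  fixes F :: "'l::finite \<Rightarrow> real^'n \<Rightarrow> real^'n"
  assumes smooth: "\<And>i. smooth (F i)" and bdd: "\<And>i. bounded_with_derivatives (F i)"
  obtains B L where "bounded_lipschitz_fields F B L"
proof -
  have "\<exists>b. \<forall>x. norm (F i x) \<le> b" for i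
  proof -
    have "bounded (range (iterated_derivative [] (F i)))"
      using bdd unfolding bounded_with_derivatives_def by blast
    then show ?thesis by (auto simp: bounded_iff)
  qed
  then obtain b where b: "\<And>i x. norm (F i x) \<le> b i" by metis
  have "\<exists>l. 0 \<le> l \<and> (\<forall>x y. norm (F i x - F i y) \<le> l * norm (x - y))" for i
    using bounded_derivatives_imp_lipschitz[OF smooth bdd] by metis
  then obtain l where l0: "\<And>i. 0 \<le> l i" and l: "\<And>i x y. norm (F i x - F i y) \<le> l i * norm (x - y)" by metis
  have b0: "0 \<le> b i" for i using b[of i 0] norm_ge_zero order_trans by blast
  show thesis
  proof (rule that, unfold_locales)
    show "norm (F i x) \<le> (\<Sum>i\<in>UNIV. b i)" for i x
      using b[of i x] member_le_sum[of i UNIV b] b0 by (meson UNIV_I finite order_trans)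
    show "norm (F i x - F i y) \<le> (\<Sum>i\<in>UNIV. l i) * norm (x - y)" for i x y
    proof -
      have "l i \<le> (\<Sum>i\<in>UNIV. l i)" using member_le_sum[of i UNIV l] l0 by auto
      then show ?thesis using l[of i x y] by (meson mult_right_mono norm_ge_zero order_trans)
    qed
    show "0 \<le> (\<Sum>i\<in>UNIV. l i)" by (intro sum_nonneg l0)
  qed
qed

theorem mainTheorem2:
  fixes F :: "'l::finite \<Rightarrow> real^'n \<Rightarrow> real^'n"
    and \<Psi> :: "real^'n \<Rightarrow> real^'n"
    and a :: "real^'n \<Rightarrow> real"
    and L\<^sub>\<Psi> L\<^sub>a \<beta> :: real
    and K :: "(real^'n) set"
    and x :: "nat \<Rightarrow> nat \<Rightarrow> real^'n"
    and \<mu> :: "(real^'n) measure"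
  assumes F: "\<And>i. smooth (F i)" "\<And>i. bounded_with_derivatives (F i)"
    and \<Psi>: "diffeomorphism \<Psi>" "diffeotopic_to_id \<Psi>" "L\<^sub>\<Psi>-lipschitz_on UNIV \<Psi>"
    and a: "smooth a" "\<And>y. a y \<ge> 0" "a 0 = 0" "L\<^sub>a-lipschitz_on UNIV a"
    and \<beta>: "\<beta> > 0"
    and K: "compact K"
    and x: "\<And>M. M \<ge> 1 \<Longrightarrow> inj_on (x M) {1..M}" "\<And>M. M \<ge> 1 \<Longrightarrow> x M ` {1..M} \<subseteq> K"
    and \<mu>: "borel_prob_on K \<mu>" "weakly_converges (\<lambda>M. empirical_measure M (x M)) \<mu>"
  shows "\<exists>L\<^sub>\<beta>. \<forall>u :: nat \<Rightarrow> real \<Rightarrow> real^'l.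
           (\<forall>M\<ge>1. u M \<in> minimizers F \<Psi> a \<beta> (empirical_measure M (x M))) \<longrightarrow>
             (\<forall>M\<ge>1. L\<^sub>\<beta>-lipschitz_on UNIV (flow F (u M))) \<and>
             (\<forall>\<^sub>F M in sequentially.
                prob_space.expectation \<mu> (\<lambda>y. a (flow F (u M) y - \<Psi> y))
                  = (LINT y:K|\<mu>. a (flow F (u M) y - \<Psi> y)) \<and>
                (LINT y:K|\<mu>. a (flow F (u M) y - \<Psi> y))
                  \<le> 2 * \<kappa> F \<Psi> a \<beta> K \<mu> + L\<^sub>a * (L\<^sub>\<Psi> + L\<^sub>\<beta>) * W1 K (empirical_measure M (x M)) \<mu>)"
proof -
  obtain B L where "bounded_lipschitz_fields F B L"
    using bounded_lipschitz_fields_exist[of F] F by metis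
  then interpret bounded_lipschitz_fields F B L .
  have a_diff: "a differentiable (at y)" for y
    using a(1) unfolding smooth_on_open_def by (metis UNIV_I iterated_derivative.simps(1))
  interpret approximation_problem F B L \<Psi> a L\<^sub>\<Psi> L\<^sub>a \<beta> K
    by unfold_locales (use \<Psi> a \<beta> K a_diff in auto)
  define E where "E = sqrt 2 * exp (\<Lambda>\<^sup>2 * control_bound\<^sup>2)"
  have E: "E-lipschitz_on UNIV (flow F u)" if "u \<in> L2_controls" "L2_norm u \<le> control_bound" for u
  proof (rule lipschitz_on_mono[OF flow_lipschitz_on[OF that(1)]])
    have "(L2_norm u)\<^sup>2 \<le> control_bound\<^sup>2" using that(2) by (rule power_mono) simp
    then show "sqrt 2 * exp (\<Lambda>\<^sup>2 * (L2_norm u)\<^sup>2) \<le> E" by (simp add: E_def mult_left_mono)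
  qed simp
  show ?thesis
  proof (intro exI[of _ "E + L\<^sub>\<Psi> + 1"] allI impI conjI)
    fix u :: "nat \<Rightarrow> real \<Rightarrow> real^'l"
    assume "\<forall>M\<ge>1. u M \<in> minimizers F \<Psi> a \<beta> (empirical_measure M (x M))"
    then have u: "u M \<in> minimizers F \<Psi> a \<beta> (empirical_measure M (x M))" if "M \<ge> 1" for M using that by blast
    have uL: "u M \<in> L2_controls" if "M \<ge> 1" for M using u[OF that] by (simp add: minimizers_iff)
    show "(E + L\<^sub>\<Psi> + 1)-lipschitz_on UNIV (flow F (u M))" if M: "M \<ge> 1" for M
    proof (rule lipschitz_on_mono[OF E[OF uL[OF M]]])
      show "L2_norm (u M) \<le> control_bound"
        by (rule minimizer_bounds(1)[OF borel_prob_on_empirical_measure[OF M x(2)[OF M] K] u[OF M]])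
    qed (use L_nonneg' in auto)
    have "\<forall>\<^sub>F M in sequentially. mean_error \<mu> (u M)
        \<le> 2 * \<kappa> F \<Psi> a \<beta> K \<mu> + L\<^sub>a * (L\<^sub>\<Psi> + (E + L\<^sub>\<Psi> + 1)) * W1 K (empirical_measure M (x M)) \<mu>"
      by (rule empirical_minimizer_bound[OF \<mu>(1) x(2) \<mu>(2) E u])
    then show "\<forall>\<^sub>F M in sequentially.
                prob_space.expectation \<mu> (\<lambda>y. a (flow F (u M) y - \<Psi> y))
                  = (LINT y:K|\<mu>. a (flow F (u M) y - \<Psi> y)) \<and>
                (LINT y:K|\<mu>. a (flow F (u M) y - \<Psi> y))
                  \<le> 2 * \<kappa> F \<Psi> a \<beta> K \<mu> + L\<^sub>a * (L\<^sub>\<Psi> + (E + L\<^sub>\<Psi> + 1)) * W1 K (empirical_measure M (x M)) \<mu>"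
      using eventually_ge_at_top[of "1::nat"]
    proof eventually_elim
      case (elim M)
      have "(LINT y:K|\<mu>. error (u M) y) = (LINT y|\<mu>. error (u M) y)"
        by (rule borel_prob_on_set_integral[OF K \<mu>(1) error_continuous[OF uL[OF elim(2)]]])
      then show ?case using elim(1) by (simp add: mean_error_def error_def)
    qed
  qed
qed

end
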